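(* Let $(X,\phi)$ be a non-compact connected calibrated manifold with $\phi$ parallel, and suppose that $X$ is strictly $\phi$-convex. Let $K$ be a compact subset of $X$ and $x\in X-K$. Then there exists a Green's current $T_x$ for $(K,x)$ if and only if $x\in\widehat K$.
   Context: A calibrated manifold $(X,\phi)$ is an oriented Riemannian manifold $X$ with a smooth $d$-closed $p$-form $\phi$ of comass one, i.e. $\phi(\xi)\le 1$ for every unit simple $p$-vector $\xi$. A $\phi$-plane is a unit simple $p$-vector $\xi\in\Lambda_pT_xX$ with $\phi(\xi)=1$; $G(\phi)$ denotes the set of all $\phi$-planes. $\phi$ is parallel if $\nabla\phi=0$. For $f\in C^\infty(X)$ let $d^\phi f=\nabla f\lrcorner\phi$ (contraction of $\phi$ with the gradient of $f$). For $\phi$ parallel, $f$ is $\phi$-plurisubharmonic if $(dd^\phi f)(\xi)\ge 0$ for all $\xi\in G(\phi)$, and strictly $\phi$-plurisubharmonic if $(dd^\phi f)(\xi)>0$ for all $\xi\in G(\phi)$. $\mathrm{PSH}(X,\phi)\subset C^\infty(X)$ is the set of smooth $\phi$-plurisubharmonic functions. $X$ is strictly $\phi$-convex if it admits a smooth strictly $\phi$-plurisubharmonic proper exhaustion function $f:X\to\mathbb R$ (all sublevel sets $\{f\le c\}$ compact). The $\phi$-convex hull of $K$ is $\widehat K=\{x\in X: f(x)\le\sup_K f\ \text{for all } f\in\mathrm{PSH}(X,\phi)\}$. A smooth $p$-form $\alpha$ is $\Lambda^+(\phi)$-positive if $\alpha(\xi)\ge0$ for all $\xi\in G(\phi)$.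 A $p$-dimensional current $T$ is $\Lambda_+(\phi)$-positive if $T(\alpha)\ge 0$ for all compactly supported $\Lambda^+(\phi)$-positive $p$-forms $\alpha$. For a compactly supported $p$-dimensional current $T$, $\partial_\phi\partial T$ is the $0$-dimensional current $(\partial_\phi\partial T)(f)=T(dd^\phi f)$, $f\in C^\infty(X)$. For $K\subset X$ compact and $x$ a point, a Green's current for $(K,x)$ is a $\Lambda_+(\phi)$-positive current $T_x$ with compact support in $X$ satisfying $\partial_\phi\partial T_x=\mu_x-[x]$ for some probability measure $\mu_x$ with support in $K$, where $[x]$ is the Dirac measure at $x$. *)

theory Defs
  imports "HOL-Probability.Probability"
begin

primrec Ck_on :: "nat \<Rightarrow> 'e::euclidean_space set \<Rightarrow> ('e \<Rightarrow> 'f::real_normed_vector) \<Rightarrow> bool" where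
  "Ck_on 0 S f \<longleftrightarrow> continuous_on S f"
| "Ck_on (Suc k) S f \<longleftrightarrow>
     (\<forall>y\<in>S. f differentiable (at y)) \<and> (\<forall>v. Ck_on k S (\<lambda>y. frechet_derivative f (at y) v))"

definition smooth_on :: "'e::euclidean_space set \<Rightarrow> ('e \<Rightarrow> 'f::real_normed_vector) \<Rightarrow> bool" where
  "smooth_on S f \<longleftrightarrow> (\<forall>k. Ck_on k S f)"

type_synonym ('a, 'n) chart = "'a set \<times> ('a \<Rightarrow> real^'n)"

definition is_chart :: "('a::topological_space, 'n::finite) chart \<Rightarrow> bool" where
  "is_chart = (\<lambda>(U, c). open U \<and> open (c ` U) \<and> (\<exists>c'. homeomorphism U (c ` U) c c'))"

definition transition :: "('a, 'n::finite) chart \<Rightarrow> ('a, 'n) chart \<Rightarrow> real^'n \<Rightarrow> real^'n" where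
  "transition = (\<lambda>(U, c) (V, d). d \<circ> inv_into U c)"

text \<open>
  The manifold \<open>X\<close> is the whole type \<open>'a\<close>; its dimension is \<open>CARD('n)\<close>.  Tangent vectors at \<open>x\<close>
  are the derivations at \<open>x\<close> of the algebra of global smooth functions.  Everything is extensional
  (zero on arguments outside the intended domain), so that equality of tangent vectors, of
  vector fields and of forms is equality in HOL.
\<close>

type_synonym 'a tvec = "('a \<Rightarrow> real) \<Rightarrow> real"
type_synonym 'a vfield = "'a \<Rightarrow> 'a tvec"
type_synonym 'a form = "'a \<Rightarrow> 'a tvec list \<Rightarrow> real"

definition lincomb :: "real \<Rightarrow> 'a tvec \<Rightarrow> real \<Rightarrow> 'a tvec \<Rightarrow> 'a tvec" where
  "lincomb a v b w = (\<lambda>f. a * v f + b * w f)"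

definition remove_nth :: "nat \<Rightarrow> 'b list \<Rightarrow> 'b list" where
  "remove_nth i xs = take i xs @ drop (Suc i) xs"

definition apply_form :: "'a form \<Rightarrow> 'a vfield list \<Rightarrow> 'a \<Rightarrow> real" where
  "apply_form \<omega> Vs x = \<omega> x (map (\<lambda>V. V x) Vs)"

definition bracket :: "'a vfield \<Rightarrow> 'a vfield \<Rightarrow> 'a vfield" where
  "bracket V W x f = V x (\<lambda>y. W y f) - W x (\<lambda>y. V y f)"

text \<open>\<open>iterated_deriv [V\<^sub>1, \<dots>, V\<^sub>k] f = V\<^sub>1 (\<dots> (V\<^sub>k f))\<close>.\<close>

definition iterated_deriv :: "'a vfield list \<Rightarrow> ('a \<Rightarrow> real) \<Rightarrow> 'a \<Rightarrow> real" where
  "iterated_deriv Vs f = foldr (\<lambda>V h x. V x h) Vs f"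

locale smooth_manifold =
  fixes atlas :: "('a::{t2_space,second_countable_topology}, 'n::finite) chart set"
  assumes charts: "C \<in> atlas \<Longrightarrow> is_chart C"
    and covering: "(\<Union>C\<in>atlas. fst C) = UNIV"
    and compatible: "C \<in> atlas \<Longrightarrow> D \<in> atlas \<Longrightarrow>
          smooth_on (snd C ` (fst C \<inter> fst D)) (transition C D)"
begin

definition smooth_functions :: "('a \<Rightarrow> real) set" where
  "smooth_functions = {f. \<forall>(U, c)\<in>atlas. smooth_on (c ` U) (f \<circ> inv_into U c)}"

definition tangent :: "'a \<Rightarrow> 'a tvec set" where
  "tangent x = {v.
     (\<forall>f\<in>smooth_functions. \<forall>h\<in>smooth_functions. \<forall>a b.
        v (\<lambda>y. a * f y + b * h y) = a * v f + b * v h) \<and>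
     (\<forall>f\<in>smooth_functions. \<forall>h\<in>smooth_functions.
        v (\<lambda>y. f y * h y) = v f * h x + f x * v h) \<and>
     (\<forall>f. f \<notin> smooth_functions \<longrightarrow> v f = 0)}"

definition vector_fields :: "'a vfield set" where
  "vector_fields = {V. (\<forall>x. V x \<in> tangent x) \<and>
     (\<forall>f\<in>smooth_functions. (\<lambda>x. V x f) \<in> smooth_functions)}"

definition alternating_form_at :: "nat \<Rightarrow> 'a \<Rightarrow> ('a tvec list \<Rightarrow> real) \<Rightarrow> bool" where
  "alternating_form_at q x \<omega> \<longleftrightarrow>
     (\<forall>vs i v w a b. length vs = q \<longrightarrow> set vs \<subseteq> tangent x \<longrightarrow> i < q \<longrightarrow>
        v \<in> tangent x \<longrightarrow> w \<in> tangent x \<longrightarrow>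
        \<omega> (vs[i := lincomb a v b w]) = a * \<omega> (vs[i := v]) + b * \<omega> (vs[i := w])) \<and>
     (\<forall>vs i j. length vs = q \<longrightarrow> set vs \<subseteq> tangent x \<longrightarrow> i < j \<longrightarrow> j < q \<longrightarrow> vs ! i = vs ! j \<longrightarrow>
        \<omega> vs = 0) \<and>
     (\<forall>vs. \<not> (length vs = q \<and> set vs \<subseteq> tangent x) \<longrightarrow> \<omega> vs = 0)"

definition smooth_forms :: "nat \<Rightarrow> 'a form set" where
  "smooth_forms q = {\<omega>. (\<forall>x. alternating_form_at q x (\<omega> x)) \<and>
     (\<forall>Vs. length Vs = q \<longrightarrow> set Vs \<subseteq> vector_fields \<longrightarrow> apply_form \<omega> Vs \<in> smooth_functions)}"

text \<open>The invariant formula for the value of \<open>d\<omega>\<close> on \<open>V\<^sub>0, \<dots>, V\<^sub>q\<close>.\<close>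

definition d_formula :: "nat \<Rightarrow> 'a form \<Rightarrow> 'a vfield list \<Rightarrow> 'a \<Rightarrow> real" where
  "d_formula q \<omega> Vs x =
     (\<Sum>i\<le>q. (-1) ^ i * (Vs ! i) x (apply_form \<omega> (remove_nth i Vs))) +
     (\<Sum>j\<le>q. \<Sum>i<j. (-1) ^ (i + j) *
        apply_form \<omega> (bracket (Vs ! i) (Vs ! j) # remove_nth i (remove_nth j Vs)) x)"

definition ext_deriv :: "nat \<Rightarrow> 'a form \<Rightarrow> 'a form" where
  "ext_deriv q \<omega> = (THE \<eta>. \<eta> \<in> smooth_forms (Suc q) \<and>
     (\<forall>Vs. length Vs = Suc q \<longrightarrow> set Vs \<subseteq> vector_fields \<longrightarrow>
        apply_form \<eta> Vs = d_formula q \<omega> Vs))"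

definition compactly_supported :: "'a form \<Rightarrow> bool" where
  "compactly_supported \<omega> \<longleftrightarrow> compact (closure {x. \<exists>vs. \<omega> x vs \<noteq> 0})"

text \<open>
  The compactly supported \<open>q\<close>-dimensional currents, as the continuous linear functionals on the
  space of \<^emph>\<open>all\<close> smooth \<open>q\<close>-forms with its topology of uniform convergence of all derivatives on
  compact sets; the seminorms are \<open>\<alpha> \<mapsto> sup\<^bsub>L\<^esub> \<bar>U\<^sub>1 \<dots> U\<^sub>k (\<alpha>(W\<^sub>1, \<dots>, W\<^sub>q))\<bar>\<close> for compact \<open>L\<close> and vector
  fields \<open>U\<^sub>i\<close>, \<open>W\<^sub>j\<close>, and the functional is bounded on a neighbourhood of zero.  In particular
  \<open>T \<alpha> = 0\<close> if \<open>\<alpha>\<close> vanishes near \<open>L\<close>.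
\<close>

definition compact_current :: "nat \<Rightarrow> ('a form \<Rightarrow> real) \<Rightarrow> bool" where
  "compact_current q T \<longleftrightarrow>
     (\<forall>\<alpha>\<in>smooth_forms q. \<forall>\<beta>\<in>smooth_forms q. \<forall>a b.
        T (\<lambda>x vs. a * \<alpha> x vs + b * \<beta> x vs) = a * T \<alpha> + b * T \<beta>) \<and>
     (\<exists>L F C. compact L \<and> finite F \<and>
        (\<forall>(Us, Ws)\<in>F. set Us \<subseteq> vector_fields \<and> set Ws \<subseteq> vector_fields \<and> length Ws = q) \<and>
        (\<forall>\<alpha>\<in>smooth_forms q.
           (\<forall>(Us, Ws)\<in>F. \<forall>x\<in>L. \<bar>iterated_deriv Us (apply_form \<alpha> Ws) x\<bar> \<le> 1) \<longrightarrow> \<bar>T \<alpha>\<bar> \<le> C))"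

end

text \<open>The orientation is given by an oriented atlas.\<close>

locale oriented_riemannian_manifold = smooth_manifold atlas
  for atlas :: "('a::{t2_space,second_countable_topology}, 'n::finite) chart set" +
  fixes g :: "'a \<Rightarrow> 'a tvec \<Rightarrow> 'a tvec \<Rightarrow> real"
  assumes oriented: "C \<in> atlas \<Longrightarrow> D \<in> atlas \<Longrightarrow> y \<in> snd C ` (fst C \<inter> fst D) \<Longrightarrow>
          det (matrix (frechet_derivative (transition C D) (at y))) > 0"
    and metric_sym: "v \<in> tangent x \<Longrightarrow> w \<in> tangent x \<Longrightarrow> g x v w = g x w v"
    and metric_linear: "u \<in> tangent x \<Longrightarrow> v \<in> tangent x \<Longrightarrow> w \<in> tangent x \<Longrightarrow>
          g x (lincomb a u b v) w = a * g x u w + b * g x v w"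
    and metric_pos: "v \<in> tangent x \<Longrightarrow> v \<noteq> (\<lambda>f. 0) \<Longrightarrow> g x v v > 0"
    and metric_smooth: "V \<in> vector_fields \<Longrightarrow> W \<in> vector_fields \<Longrightarrow>
          (\<lambda>x. g x (V x) (W x)) \<in> smooth_functions"
begin

definition grad :: "('a \<Rightarrow> real) \<Rightarrow> 'a vfield" where
  "grad f x = (THE v. v \<in> tangent x \<and> (\<forall>w\<in>tangent x. g x v w = w f))"

definition levi_civita :: "('a vfield \<Rightarrow> 'a vfield \<Rightarrow> 'a vfield) \<Rightarrow> bool" where
  "levi_civita D \<longleftrightarrow>
     (\<forall>V\<in>vector_fields. \<forall>W\<in>vector_fields. D V W \<in> vector_fields) \<and>
     (\<forall>U\<in>vector_fields. \<forall>V\<in>vector_fields. \<forall>W\<in>vector_fields.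
        \<forall>f\<in>smooth_functions. \<forall>h\<in>smooth_functions.
        D (\<lambda>x. lincomb (f x) (U x) (h x) (V x)) W = (\<lambda>x. lincomb (f x) (D U W x) (h x) (D V W x))) \<and>
     (\<forall>U\<in>vector_fields. \<forall>V\<in>vector_fields. \<forall>W\<in>vector_fields. \<forall>a b.
        D U (\<lambda>x. lincomb a (V x) b (W x)) = (\<lambda>x. lincomb a (D U V x) b (D U W x))) \<and>
     (\<forall>V\<in>vector_fields. \<forall>W\<in>vector_fields. \<forall>f\<in>smooth_functions.
        D V (\<lambda>x h. f x * W x h) = (\<lambda>x. lincomb (V x f) (W x) (f x) (D V W x))) \<and>
     (\<forall>V\<in>vector_fields. \<forall>W\<in>vector_fields.
        (\<lambda>x. lincomb 1 (D V W x) (-1) (D W V x)) = bracket V W) \<and>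
     (\<forall>U\<in>vector_fields. \<forall>V\<in>vector_fields. \<forall>W\<in>vector_fields. \<forall>x.
        U x (\<lambda>y. g y (V y) (W y)) = g x (D U V x) (W x) + g x (V x) (D U W x))"

text \<open>\<open>\<nabla>\<omega> = 0\<close> for the Levi-Civita connection \<open>D\<close>, which is unique on smooth vector fields.\<close>

definition parallel :: "nat \<Rightarrow> 'a form \<Rightarrow> bool" where
  "parallel q \<omega> \<longleftrightarrow> (\<exists>D. levi_civita D \<and>
     (\<forall>V\<in>vector_fields. \<forall>Ws. set Ws \<subseteq> vector_fields \<longrightarrow> length Ws = q \<longrightarrow>
        (\<forall>x. V x (apply_form \<omega> Ws) - (\<Sum>i<q. apply_form \<omega> (Ws[i := D V (Ws ! i)]) x) = 0)))"

text \<open>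
  The list \<open>[v\<^sub>1, \<dots>, v\<^sub>q]\<close> represents the simple \<open>q\<close>-vector \<open>v\<^sub>1 \<and> \<dots> \<and> v\<^sub>q\<close>, whose squared norm is the
  Gram determinant.  An alternating form \<open>\<omega>\<close> takes the same value on all lists that represent the
  same simple vector, so \<open>\<omega>(v\<^sub>1 \<and> \<dots> \<and> v\<^sub>q) = \<omega>(v\<^sub>1, \<dots>, v\<^sub>q)\<close>.
\<close>

definition gram_det :: "nat \<Rightarrow> 'a \<Rightarrow> 'a tvec list \<Rightarrow> real" where
  "gram_det q x vs =
     (\<Sum>\<sigma> | \<sigma> permutes {..<q}. of_int (sign \<sigma>) * (\<Prod>i<q. g x (vs ! i) (vs ! \<sigma> i)))"

definition unit_simple :: "nat \<Rightarrow> 'a \<Rightarrow> 'a tvec list set" where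
  "unit_simple q x = {vs. length vs = q \<and> set vs \<subseteq> tangent x \<and> gram_det q x vs = 1}"

end

text \<open>The degree is at least one, so that the contraction with a gradient makes sense.\<close>

locale calibrated_manifold = oriented_riemannian_manifold atlas g
  for atlas :: "('a::{t2_space,second_countable_topology}, 'n::finite) chart set"
    and g :: "'a \<Rightarrow> 'a tvec \<Rightarrow> 'a tvec \<Rightarrow> real" +
  fixes p :: nat and \<phi> :: "'a form"
  assumes degree: "1 \<le> p"
    and form: "\<phi> \<in> smooth_forms p"
    and closed: "ext_deriv p \<phi> = (\<lambda>x vs. 0)"
    and comass: "\<xi> \<in> unit_simple p x \<Longrightarrow> \<phi> x \<xi> \<le> 1"
begin

definition phi_planes :: "'a \<Rightarrow> 'a tvec list set" where
  "phi_planes x = {\<xi> \<in> unit_simple p x. \<phi> x \<xi> = 1}"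

definition d_phi :: "('a \<Rightarrow> real) \<Rightarrow> 'a form" where
  "d_phi f = (\<lambda>x vs. \<phi> x (grad f x # vs))"

definition dd_phi :: "('a \<Rightarrow> real) \<Rightarrow> 'a form" where
  "dd_phi f = ext_deriv (p - 1) (d_phi f)"

definition PSH :: "('a \<Rightarrow> real) set" where
  "PSH = {f \<in> smooth_functions. \<forall>x. \<forall>\<xi>\<in>phi_planes x. dd_phi f x \<xi> \<ge> 0}"

definition strict_PSH :: "('a \<Rightarrow> real) set" where
  "strict_PSH = {f \<in> smooth_functions. \<forall>x. \<forall>\<xi>\<in>phi_planes x. dd_phi f x \<xi> > 0}"

definition strictly_convex :: bool where
  "strictly_convex \<longleftrightarrow> (\<exists>f\<in>strict_PSH. \<forall>c. compact {x. f x \<le> c})"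

text \<open>The supremum is taken in the extended reals, so the hull of the empty set is empty.\<close>

definition phi_hull :: "'a set \<Rightarrow> 'a set" where
  "phi_hull K = {x. \<forall>f\<in>PSH. ereal (f x) \<le> (SUP y\<in>K. ereal (f y))}"

definition positive_form :: "'a form \<Rightarrow> bool" where
  "positive_form \<alpha> \<longleftrightarrow> \<alpha> \<in> smooth_forms p \<and> (\<forall>x. \<forall>\<xi>\<in>phi_planes x. \<alpha> x \<xi> \<ge> 0)"

definition positive_current :: "('a form \<Rightarrow> real) \<Rightarrow> bool" where
  "positive_current T \<longleftrightarrow> (\<forall>\<alpha>. positive_form \<alpha> \<longrightarrow> compactly_supported \<alpha> \<longrightarrow> T \<alpha> \<ge> 0)"

definition boundary_phi_boundary :: "('a form \<Rightarrow> real) \<Rightarrow> ('a \<Rightarrow> real) \<Rightarrow> real" where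
  "boundary_phi_boundary T f = T (dd_phi f)"

definition greens_current :: "'a set \<Rightarrow> 'a \<Rightarrow> ('a form \<Rightarrow> real) \<Rightarrow> bool" where
  "greens_current K x T \<longleftrightarrow> compact_current p T \<and> positive_current T \<and>
     (\<exists>\<mu>. prob_space \<mu> \<and> sets \<mu> = sets borel \<and> emeasure \<mu> (- K) = 0 \<and>
        (\<forall>f\<in>smooth_functions.
           boundary_phi_boundary T f = (\<integral>y. f y \<partial>\<mu>) - (\<integral>y. f y \<partial>return borel x)))"

end

end

theory Submission
  imports Defs
begin

text \<open>
  Let \<open>u\<close> be a strictly plurisubharmonic exhaustion function, and write \<open>dd\<^sup>\<phi>\<close> for the operator
  \<open>dd_phi\<close>.

  A Green's current puts \<open>x\<close> into the hull (\<open>greens_current_hull\<close>). A continuous functional on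
  all smooth forms ignores the forms that vanish near some compact set (\<open>current_support\<close>). So
  if \<open>f\<close> is plurisubharmonic and \<open>\<chi>\<close> is a cutoff made from \<open>u\<close> that is \<open>1\<close> near this set, then
  \<open>T (dd\<^sup>\<phi> f) = T (\<chi> dd\<^sup>\<phi> f) \<ge> 0\<close>, that is, \<open>f x\<close> is at most the integral of \<open>f\<close> over \<open>\<mu>\<close>, which
  is at most the supremum of \<open>f\<close> on \<open>K\<close>.

  For the converse, order the pairs \<open>(\<alpha>, h)\<close> of a form and a function by the values of \<open>\<alpha>\<close> on
  \<open>\<phi>\<close>-planes and of \<open>h\<close> on \<open>K\<close>. On the subspace of the pairs \<open>(- dd\<^sup>\<phi> f, f)\<close> consider the
  functional that takes such a pair to \<open>f x\<close>. If a pair of this kind is nonnegative, then \<open>- f\<close>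
  is plurisubharmonic and nonpositive on \<open>K\<close>, so that \<open>f x \<ge> 0\<close> because \<open>x\<close> lies in the hull; so
  the functional is positive. The extension theorem of M. Riesz (\<open>positive_extension\<close>) extends
  it to all pairs that lie between two pairs of the subspace. Among these are the pairs \<open>(0, h)\<close>
  with \<open>h\<close> bounded, since \<open>dd\<^sup>\<phi>\<close> kills constants, and \<open>(\<alpha>, 0)\<close> with \<open>\<alpha>\<close> compactly supported,
  since \<open>dd\<^sup>\<phi> u\<close> has a positive lower bound on the \<open>\<phi>\<close>-planes over a compact set
  (\<open>strict_on_compact\<close>). The restriction to the second component is integration against a
  probability measure \<open>\<mu>\<close> on \<open>K\<close> (\<open>representing_measure\<close>). The restriction \<open>\<Lambda>\<close> to the first
  component is positive, and \<open>\<Lambda> (dd\<^sup>\<phi> f)\<close> is the integral of \<open>f\<close> over \<open>\<mu>\<close> minus \<open>f x\<close>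
  (\<open>duality_functional\<close>).

  It remains to see that \<open>\<Lambda>\<close> has compact support (\<open>greens_current_exists\<close>). Let \<open>v = \<psi> (u - c)\<close>,
  where \<open>c\<close> is an upper bound of \<open>u\<close> on \<open>K\<close> and at \<open>x\<close>, and \<open>\<psi>\<close> is a smooth increasing convex
  function that vanishes on the negative axis and has slope at least \<open>1\<close> from \<open>1\<close> on. Since \<open>v\<close>
  vanishes on \<open>K\<close> and at \<open>x\<close>, \<open>\<Lambda> (dd\<^sup>\<phi> v) = 0\<close>. On the \<open>\<phi>\<close>-plane of an orthonormal list \<open>e\<close> the
  chain rule reads \<open>dd\<^sup>\<phi> v = \<psi>' (u - c) dd\<^sup>\<phi> u + \<psi>'' (u - c) (\<Sum>i. (e i u)\<^sup>2)\<close>: its second term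
  is a sum of squares by the first cousin principle, by which a form of comass one has no first
  variation at a plane where it attains the value \<open>1\<close> (\<open>first_cousin\<close>, \<open>dd_phi_comp\<close>). So
  \<open>dd\<^sup>\<phi> v\<close> is nonnegative everywhere and at least \<open>dd\<^sup>\<phi> u\<close> where \<open>u \<ge> c + 1\<close>, a compactly
  supported form that vanishes where \<open>u < c + 1\<close> is bounded by a multiple of \<open>dd\<^sup>\<phi> v\<close>, and \<open>\<Lambda>\<close>
  is zero on it. Therefore \<open>T \<alpha> = \<Lambda> (\<chi> \<alpha>)\<close>, with a cutoff \<open>\<chi>\<close> that is \<open>1\<close> where \<open>u \<le> c + 1\<close>, has
  the same boundary. Its continuity follows from positivity: \<open>\<phi>\<close> is \<open>1\<close> on all \<open>\<phi>\<close>-planes, so if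
  \<open>\<bar>\<alpha>\<bar> \<le> C\<close> on the planes over the support of \<open>\<chi>\<close>, then \<open>\<bar>T \<alpha>\<bar> \<le> C * T \<phi>\<close>.

  Tangent vectors are derivations here, and the gradient and the exterior derivative are
  described by the properties that determine them. That they exist is a substantial part of the
  text: Hadamard's lemma gives local frames (\<open>local_frame\<close>), an operation on vector fields that
  is linear over the smooth functions is a form (\<open>tensorial_form\<close>), the formula for the exterior
  derivative is such an operation by Cartan's formula (\<open>cartan\<close>), and Cramer's rule gives the
  gradient (\<open>grad_in_frame\<close>).
\<close>

section \<open>Smooth functions on Euclidean spaces\<close>

lemma Ck_on_SucD: "Ck_on (Suc k) S f \<Longrightarrow> Ck_on k S f"
proof (induction k arbitrary: f)
  case 0
  then show ?case
    by (auto intro!: continuous_at_imp_continuous_on differentiable_imp_continuous_within)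
next
  case (Suc k)
  show ?case
    unfolding Ck_on.simps(2)[of k]
    using Suc.prems Suc.IH by (subst (asm) Ck_on.simps(2)) blast
qed

lemma Ck_on_subset: "Ck_on k S f \<Longrightarrow> T \<subseteq> S \<Longrightarrow> Ck_on k T f"
  by (induction k arbitrary: f) (auto intro: continuous_on_subset)

lemma Ck_on_cong:
  assumes "open S" "\<And>y. y \<in> S \<Longrightarrow> f y = h y" "Ck_on k S f"
  shows "Ck_on k S h"
  using assms(2,3)
proof (induction k arbitrary: f h)
  case 0
  then show ?case using continuous_on_cong by force
next
  case (Suc k)
  have D: "(h has_derivative frechet_derivative f (at y)) (at y)" if "y \<in> S" for y
    using has_derivative_transform_within_open[OF _ assms(1) that, of f _ UNIV h] Suc.prems that
    by (auto simp: frechet_derivative_works)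
  have eq: "frechet_derivative f (at y) = frechet_derivative h (at y)" if "y \<in> S" for y
    using frechet_derivative_at[OF D[OF that]] .
  show ?case
    unfolding Ck_on.simps
  proof (intro conjI ballI allI)
    show "h differentiable at y" if "y \<in> S" for y
      using D[OF that] by (auto simp: differentiable_def)
    show "Ck_on k S (\<lambda>y. frechet_derivative h (at y) v)" for v
      by (rule Suc.IH[of "\<lambda>y. frechet_derivative f (at y) v"]) (use eq Suc.prems in auto)
  qed
qed

text \<open>
  A derivative found by calculation may take the place of \<open>frechet_derivative\<close>, because
  derivatives are unique and \<open>Ck_on\<close> depends only on the values in the open set.
\<close>

lemma Ck_on_SucI:
  assumes "open S" "\<And>y. y \<in> S \<Longrightarrow> (f has_derivative f' y) (at y)"
    "\<And>v. Ck_on k S (\<lambda>y. f' y v)"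
  shows "Ck_on (Suc k) S f"
  unfolding Ck_on.simps
proof (intro conjI ballI allI)
  show "f differentiable at y" if "y \<in> S" for y
    using assms(2)[OF that] by (auto simp: differentiable_def)
  show "Ck_on k S (\<lambda>y. frechet_derivative f (at y) v)" for v
    by (rule Ck_on_cong[OF assms(1) _ assms(3)]) (use frechet_derivative_at[OF assms(2)] in auto)
qed

lemma Ck_on_has_derivative:
  "Ck_on (Suc k) S f \<Longrightarrow> y \<in> S \<Longrightarrow> (f has_derivative frechet_derivative f (at y)) (at y)"
  by (auto simp: frechet_derivative_works)

lemma Ck_on_deriv: "Ck_on (Suc k) S f \<Longrightarrow> Ck_on k S (\<lambda>y. frechet_derivative f (at y) v)"
  by auto

lemma Ck_on_local:
  assumes "open S" "\<And>y. y \<in> S \<Longrightarrow> \<exists>O'. open O' \<and> y \<in> O' \<and> Ck_on k (S \<inter> O') f"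
  shows "Ck_on k S f"
  using assms(2)
proof (induction k arbitrary: f)
  case 0
  show ?case unfolding Ck_on.simps
  proof (rule continuous_at_imp_continuous_on, rule ballI)
    fix y assume "y \<in> S"
    then obtain O' where "open O'" "y \<in> O'" "continuous_on (S \<inter> O') f"
      using 0[OF \<open>y \<in> S\<close>] unfolding Ck_on.simps by blast
    then show "isCont f y"
      using \<open>y \<in> S\<close> assms(1) by (auto simp: continuous_on_eq_continuous_at open_Int)
  qed
next
  case (Suc k)
  show ?case unfolding Ck_on.simps
  proof (intro conjI ballI allI)
    show "f differentiable at y" if y: "y \<in> S" for y
    proof -
      obtain O' where "y \<in> O'" "Ck_on (Suc k) (S \<inter> O') f" using Suc.prems[OF y] by blast
      then show ?thesis using y by simp
    qed
    show "Ck_on k S (\<lambda>y. frechet_derivative f (at y) v)" for v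
    proof (rule Suc.IH)
      fix y assume y: "y \<in> S"
      obtain O' where "open O'" "y \<in> O'" "Ck_on (Suc k) (S \<inter> O') f" using Suc.prems[OF y] by blast
      then show "\<exists>O'. open O' \<and> y \<in> O' \<and> Ck_on k (S \<inter> O') (\<lambda>y. frechet_derivative f (at y) v)"
        by (intro exI[of _ O'] conjI Ck_on_deriv)
    qed
  qed
qed

lemma Ck_on_const: "open S \<Longrightarrow> Ck_on k S (\<lambda>_. c)"
proof (induction k arbitrary: c)
  case (Suc k)
  show ?case
    by (rule Ck_on_SucI[where f'="\<lambda>_ _. 0"]) (simp_all add: Suc)
qed auto

lemma Ck_on_bounded_linear:
  assumes "open S" "bounded_linear L" shows "Ck_on k S L"
proof (cases k)
  case 0
  then show ?thesis using assms(2) by (simp add: linear_continuous_on)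
next
  case (Suc m)
  then show ?thesis
    using assms unfolding Suc
    by (intro Ck_on_SucI[where f'="\<lambda>_. L"] Ck_on_const bounded_linear_imp_has_derivative)
qed

lemma Ck_on_add:
  assumes "open S" "Ck_on k S f" "Ck_on k S h" shows "Ck_on k S (\<lambda>y. f y + h y)"
  using assms(2,3)
proof (induction k arbitrary: f h)
  case 0
  then show ?case by (auto intro: continuous_intros)
next
  case (Suc k)
  note D = Ck_on_has_derivative[OF Suc.prems(1)] Ck_on_has_derivative[OF Suc.prems(2)]
  show ?case
    by (rule Ck_on_SucI[OF assms(1), where f'="\<lambda>y v. frechet_derivative f (at y) v + frechet_derivative h (at y) v"])
      (use D Suc in \<open>auto intro: has_derivative_add\<close>)
qed

lemma Ck_on_scaleR:
  fixes f :: "'e::euclidean_space \<Rightarrow> real"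
  assumes "open S" "Ck_on k S f" "Ck_on k S h" shows "Ck_on k S (\<lambda>y. f y *\<^sub>R h y)"
  using assms(2,3)
proof (induction k arbitrary: f h)
  case 0
  then show ?case by (auto intro: continuous_intros)
next
  case (Suc k)
  note D = Ck_on_has_derivative[OF Suc.prems(1)] Ck_on_has_derivative[OF Suc.prems(2)]
  show ?case
  proof (rule Ck_on_SucI[OF assms(1), where f'="\<lambda>y v. f y *\<^sub>R frechet_derivative h (at y) v + frechet_derivative f (at y) v *\<^sub>R h y"])
    show "((\<lambda>y. f y *\<^sub>R h y) has_derivative (\<lambda>v. f y *\<^sub>R frechet_derivative h (at y) v + frechet_derivative f (at y) v *\<^sub>R h y)) (at y)"
      if "y \<in> S" for y using D[OF that] by (rule has_derivative_scaleR)
    show "Ck_on k S (\<lambda>y. f y *\<^sub>R frechet_derivative h (at y) v + frechet_derivative f (at y) v *\<^sub>R h y)" for v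
      by (intro Ck_on_add[OF assms(1)] Suc.IH Ck_on_deriv Ck_on_SucD[OF Suc.prems(1)] Ck_on_SucD[OF Suc.prems(2)] Suc.prems)
  qed
qed

lemma Ck_on_mult:
  fixes f :: "'e::euclidean_space \<Rightarrow> real"
  assumes "open S" "Ck_on k S f" "Ck_on k S h" shows "Ck_on k S (\<lambda>y. f y * h y)"
  using Ck_on_scaleR[OF assms] by simp

lemma Ck_on_sum:
  assumes "open S" "\<And>i. i \<in> I \<Longrightarrow> Ck_on k S (f i)" shows "Ck_on k S (\<lambda>y. \<Sum>i\<in>I. f i y)"
  using assms(2) by (induction I rule: infinite_finite_induct) (simp_all add: assms(1) Ck_on_add Ck_on_const)

lemma Ck_on_linear_compose:
  assumes "open S" "bounded_linear L" "Ck_on k S f" shows "Ck_on k S (\<lambda>y. L (f y))"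
  using assms(3)
proof (induction k arbitrary: f)
  case 0
  then show ?case using assms(2) by (auto intro: bounded_linear.continuous_on)
next
  case (Suc k)
  show ?case
    by (rule Ck_on_SucI[OF assms(1), where f'="\<lambda>y v. L (frechet_derivative f (at y) v)"])
      (use Ck_on_has_derivative[OF Suc.prems] Suc in \<open>auto intro: bounded_linear.has_derivative[OF assms(2)]\<close>)
qed

text \<open>
  By the chain rule, the derivative of \<open>h \<circ> f\<close> in the direction \<open>v\<close> is the derivative of \<open>h\<close> at
  \<open>f y\<close> in a direction that depends on \<open>y\<close>. Expanded in a basis it is a sum of products whose
  factors are of class \<open>C\<^sup>k\<close>, one of them by induction.
\<close>

lemma Ck_on_compose:
  fixes f :: "'e::euclidean_space \<Rightarrow> 'f::euclidean_space" and h :: "'f \<Rightarrow> 'g::real_normed_vector"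
  assumes "open S" "open T" "f ` S \<subseteq> T" "Ck_on k S f" "Ck_on k T h"
  shows "Ck_on k S (\<lambda>y. h (f y))"
  using assms(4,5)
proof (induction k arbitrary: h)
  case 0
  then show ?case using assms(3) by (auto intro: continuous_on_compose2)
next
  case (Suc k)
  let ?h' = "\<lambda>z. frechet_derivative h (at z)" and ?f' = "\<lambda>y. frechet_derivative f (at y)"
  show ?case
  proof (rule Ck_on_SucI[OF assms(1), where f'="\<lambda>y v. \<Sum>b\<in>Basis. (?f' y v \<bullet> b) *\<^sub>R ?h' (f y) b"])
    fix y assume y: "y \<in> S"
    then have fy: "f y \<in> T" using assms(3) by auto
    have D: "((\<lambda>y. h (f y)) has_derivative (\<lambda>v. ?h' (f y) (?f' y v))) (at y)"
      by (rule has_derivative_compose[OF Ck_on_has_derivative[OF Suc.prems(1) y]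
            Ck_on_has_derivative[OF Suc.prems(2) fy]])
    have lin: "linear (?h' (f y))"
      using Ck_on_has_derivative[OF Suc.prems(2) fy] has_derivative_linear by blast
    have "?h' (f y) w = (\<Sum>b\<in>Basis. (w \<bullet> b) *\<^sub>R ?h' (f y) b)" for w
    proof -
      have "?h' (f y) w = ?h' (f y) (\<Sum>b\<in>Basis. (w \<bullet> b) *\<^sub>R b)"
        by (simp only: euclidean_representation)
      also have "\<dots> = (\<Sum>b\<in>Basis. (w \<bullet> b) *\<^sub>R ?h' (f y) b)"
        by (simp only: linear_sum[OF lin] linear_cmul[OF lin])
      finally show ?thesis .
    qed
    then have eq: "(\<lambda>v. ?h' (f y) (?f' y v)) = (\<lambda>v. \<Sum>b\<in>Basis. (?f' y v \<bullet> b) *\<^sub>R ?h' (f y) b)"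
      by (intro ext)
    show "((\<lambda>y. h (f y)) has_derivative (\<lambda>v. \<Sum>b\<in>Basis. (?f' y v \<bullet> b) *\<^sub>R ?h' (f y) b)) (at y)"
      using D unfolding eq .
  next
    fix v
    show "Ck_on k S (\<lambda>y. \<Sum>b\<in>Basis. (?f' y v \<bullet> b) *\<^sub>R ?h' (f y) b)"
    proof (intro Ck_on_sum[OF assms(1)] Ck_on_scaleR[OF assms(1)])
      fix b :: 'f
      show "Ck_on k S (\<lambda>y. ?f' y v \<bullet> b)"
        by (rule Ck_on_linear_compose[OF assms(1) bounded_linear_inner_left Ck_on_deriv[OF Suc.prems(1)]])
      show "Ck_on k S (\<lambda>y. ?h' (f y) b)"
        by (rule Suc.IH[OF Ck_on_SucD[OF Suc.prems(1)] Ck_on_deriv[OF Suc.prems(2)]])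
    qed
  qed
qed

lemma smooth_on_subset: "smooth_on S f \<Longrightarrow> T \<subseteq> S \<Longrightarrow> smooth_on T f"
  by (auto simp: smooth_on_def intro: Ck_on_subset)

lemma smooth_on_cong:
  "open S \<Longrightarrow> (\<And>y. y \<in> S \<Longrightarrow> f y = h y) \<Longrightarrow> smooth_on S f \<Longrightarrow> smooth_on S h"
  by (auto simp: smooth_on_def intro: Ck_on_cong)

lemma smooth_on_local:
  assumes "open S" "\<And>y. y \<in> S \<Longrightarrow> \<exists>O'. open O' \<and> y \<in> O' \<and> smooth_on (S \<inter> O') f"
  shows "smooth_on S f"
  unfolding smooth_on_def
proof
  show "Ck_on k S f" for k
    by (rule Ck_on_local[OF assms(1)]) (meson assms(2) smooth_on_def)
qed

lemma smooth_on_const: "open S \<Longrightarrow> smooth_on S (\<lambda>_. c)"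
  by (simp add: smooth_on_def Ck_on_const)

lemma smooth_on_bounded_linear: "open S \<Longrightarrow> bounded_linear L \<Longrightarrow> smooth_on S L"
  by (simp add: smooth_on_def Ck_on_bounded_linear)

lemma smooth_on_add: "open S \<Longrightarrow> smooth_on S f \<Longrightarrow> smooth_on S h \<Longrightarrow> smooth_on S (\<lambda>y. f y + h y)"
  by (simp add: smooth_on_def Ck_on_add)

lemma smooth_on_sum:
  "open S \<Longrightarrow> (\<And>i. i \<in> I \<Longrightarrow> smooth_on S (F i)) \<Longrightarrow> smooth_on S (\<lambda>y. \<Sum>i\<in>I. F i y)"
  unfolding smooth_on_def by (intro allI Ck_on_sum) auto

lemma smooth_on_mult:
  fixes f :: "'e::euclidean_space \<Rightarrow> real"
  shows "open S \<Longrightarrow> smooth_on S f \<Longrightarrow> smooth_on S h \<Longrightarrow> smooth_on S (\<lambda>y. f y * h y)"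
  by (simp add: smooth_on_def Ck_on_mult)

lemma smooth_on_compose:
  fixes f :: "'e::euclidean_space \<Rightarrow> 'f::euclidean_space"
  shows "open S \<Longrightarrow> open T \<Longrightarrow> f ` S \<subseteq> T \<Longrightarrow> smooth_on S f \<Longrightarrow> smooth_on T h \<Longrightarrow>
    smooth_on S (\<lambda>y. h (f y))"
  by (auto simp: smooth_on_def intro: Ck_on_compose)

lemma smooth_on_deriv: "smooth_on S f \<Longrightarrow> smooth_on S (\<lambda>y. frechet_derivative f (at y) v)"
  unfolding smooth_on_def by (metis Ck_on_deriv)

lemma smooth_on_has_derivative:
  "smooth_on S f \<Longrightarrow> y \<in> S \<Longrightarrow> (f has_derivative frechet_derivative f (at y)) (at y)"
  unfolding smooth_on_def by (meson Ck_on_has_derivative)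

lemma smooth_on_continuous: "smooth_on S f \<Longrightarrow> continuous_on S f"
  unfolding smooth_on_def by (metis Ck_on.simps(1))

lemma Ck_on_real_SucI:
  assumes "open S" "\<And>t. t \<in> S \<Longrightarrow> (f has_real_derivative f' t) (at t)" "Ck_on k S f'"
  shows "Ck_on (Suc k) S f"
  by (rule Ck_on_SucI[OF assms(1), where f'="\<lambda>t v. f' t * v"])
    (use assms in \<open>auto simp: has_field_derivative_def intro!: Ck_on_mult Ck_on_const\<close>)

lemma smooth_on_real_deriv:
  assumes "smooth_on UNIV (f :: real \<Rightarrow> real)"
  shows "smooth_on UNIV (deriv f)" "(f has_real_derivative deriv f t) (at t)"
proof -
  have D: "(f has_real_derivative frechet_derivative f (at t) 1) (at t)" for t
  proof -
    have 1: "(f has_derivative frechet_derivative f (at t)) (at t)"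
      using smooth_on_has_derivative[OF assms] by simp
    have "frechet_derivative f (at t) = (*) (frechet_derivative f (at t) 1)"
    proof
      show "frechet_derivative f (at t) v = frechet_derivative f (at t) 1 * v" for v
        using linear_cmul[OF has_derivative_linear[OF 1], of v 1] by (simp add: mult.commute)
    qed
    then show ?thesis using 1 by (metis has_field_derivative_def)
  qed
  have "deriv f = (\<lambda>t. frechet_derivative f (at t) 1)"
    using D DERIV_imp_deriv by blast
  then show "smooth_on UNIV (deriv f)" "(f has_real_derivative deriv f t) (at t)"
    using smooth_on_deriv[OF assms, of 1] D by auto
qed

lemma smooth_on_exp: "smooth_on UNIV (exp :: real \<Rightarrow> real)"
  unfolding smooth_on_def
proof
  show "Ck_on k UNIV (exp :: real \<Rightarrow> real)" for k
  proof (induction k)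
    case 0
    show ?case by (simp add: continuous_on_exp)
  next
    case (Suc k)
    show ?case by (rule Ck_on_real_SucI[OF open_UNIV DERIV_exp Suc])
  qed
qed

lemma smooth_on_inverse: "smooth_on (- {0}) (inverse :: real \<Rightarrow> real)"
  unfolding smooth_on_def
proof
  show "Ck_on k (- {0}) (inverse :: real \<Rightarrow> real)" for k
  proof (induction k)
    case (Suc k)
    have o: "open (- {0::real})" by auto
    show ?case
    proof (rule Ck_on_real_SucI[OF o])
      show "(inverse has_real_derivative (- 1) * (inverse t * inverse t)) (at t)"
        if "t \<in> - {0}" for t :: real
        using that by (auto intro!: derivative_eq_intros)
      show "Ck_on k (- {0}) (\<lambda>t::real. (- 1) * (inverse t * inverse t))"
        by (intro Ck_on_mult Ck_on_const Suc o)
    qed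
  qed (auto intro!: continuous_intros)
qed

section \<open>Flat functions, a convex function and a cutoff\<close>

text \<open>
  The powers of \<open>t\<close> in the denominator make the family closed under differentiation, up to
  linear combinations.
\<close>

definition flat_exp :: "nat \<Rightarrow> real \<Rightarrow> real" where
  "flat_exp k t = (if t > 0 then exp (- 1 / t) / t ^ k else 0)"

lemma flat_exp_tendsto_0: "(flat_exp k \<longlongrightarrow> 0) (at 0)"
proof -
  have "((\<lambda>t. exp (- 1 / t) / t ^ k) \<longlongrightarrow> 0) (at_right (0::real))"
  proof -
    have "((\<lambda>s::real. s ^ k / exp s) \<longlongrightarrow> 0) at_top" by (rule tendsto_power_div_exp_0)
    then have "((\<lambda>t::real. inverse t ^ k / exp (inverse t)) \<longlongrightarrow> 0) (at_right 0)"
      by (rule filterlim_compose[OF _ filterlim_inverse_at_top_right])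
    then show ?thesis
      by (rule Lim_transform_eventually)
        (auto simp: eventually_at_filter exp_minus field_simps power_inverse)
  qed
  then have "(flat_exp k \<longlongrightarrow> 0) (at_right 0)"
    by (rule Lim_transform_eventually) (auto simp: eventually_at_filter flat_exp_def)
  moreover have "(flat_exp k \<longlongrightarrow> 0) (at_left 0)"
    by (rule Lim_transform_eventually[OF tendsto_const]) (auto simp: eventually_at_filter flat_exp_def)
  ultimately show ?thesis by (simp add: filterlim_at_split)
qed

lemma flat_exp_deriv: "(flat_exp k has_real_derivative flat_exp (k + 2) t - real k * flat_exp (k + 1) t) (at t)"
proof (cases t "0::real" rule: linorder_cases)
  case less
  have "(flat_exp k has_real_derivative 0) (at t)"
    by (rule has_field_derivative_transform_within_open[where f="\<lambda>_. 0" and S="{..<0}"])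
      (use less in \<open>auto simp: flat_exp_def\<close>)
  then show ?thesis using less by (simp add: flat_exp_def)
next
  case equal
  \<comment> \<open>The difference quotient at \<open>0\<close> is \<open>flat_exp (k + 1)\<close>.\<close>
  have "((\<lambda>y. (flat_exp k y - flat_exp k 0) / (y - 0)) \<longlongrightarrow> 0) (at 0)"
    by (rule Lim_transform_eventually[OF flat_exp_tendsto_0[of "k+1"]])
      (auto simp: eventually_at_filter flat_exp_def)
  then show ?thesis using equal by (simp add: flat_exp_def has_field_derivative_iff)
next
  case greater
  have "((\<lambda>t. exp (- 1 / t) * inverse t ^ k) has_real_derivative
      flat_exp (k + 2) t - real k * flat_exp (k + 1) t) (at t)"
  proof (cases k)
    case 0
    then show ?thesis using greater
      by (auto intro!: derivative_eq_intros simp: flat_exp_def field_simps power2_eq_square)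
  next
    case (Suc m)
    have "((\<lambda>t. exp (- 1 / t) * inverse t ^ k) has_real_derivative
        exp (- 1 / t) * (1 / t\<^sup>2) * inverse t ^ k
        + (real k * inverse t ^ m * (- (inverse t * inverse t))) * exp (- 1 / t)) (at t)"
    proof -
      have "((\<lambda>t. exp (- 1 / t)) has_real_derivative exp (- 1 / t) * (1 / t\<^sup>2)) (at t)"
        using greater by (auto intro!: derivative_eq_intros simp: power2_eq_square)
      moreover have "((\<lambda>t. inverse t ^ k) has_real_derivative
          real k * inverse t ^ m * (- (inverse t * inverse t))) (at t)"
        using DERIV_power[OF DERIV_inverse, of t k UNIV] greater Suc
        by (simp add: power2_eq_square algebra_simps)
      ultimately show ?thesis by (rule DERIV_mult)
    qed
    moreover have "exp (- 1 / t) * (1 / t\<^sup>2) * inverse t ^ k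
        + (real k * inverse t ^ m * (- (inverse t * inverse t))) * exp (- 1 / t)
        = flat_exp (k + 2) t - real k * flat_exp (k + 1) t"
      using greater Suc by (simp add: flat_exp_def divide_inverse power2_eq_square power_inverse algebra_simps)
    ultimately show ?thesis by simp
  qed
  then show ?thesis
    by (rule has_field_derivative_transform_within_open[where S="{0<..}"])
      (use greater in \<open>auto simp: flat_exp_def power_inverse divide_inverse\<close>)
qed

lemma smooth_on_flat_exp: "smooth_on UNIV (flat_exp k)"
  unfolding smooth_on_def
proof
  show "Ck_on n UNIV (flat_exp k)" for n
  proof (induction n arbitrary: k)
    case 0
    show ?case using flat_exp_deriv[of k]
      by (auto intro!: continuous_at_imp_continuous_on DERIV_isCont)
  next
    case (Suc n)
    have "Ck_on n UNIV (\<lambda>t. flat_exp (k + 2) t + (- real k) * flat_exp (k + 1) t)"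
      by (intro Ck_on_add Ck_on_mult Suc Ck_on_const) auto
    then have "Ck_on n UNIV (\<lambda>t. flat_exp (k + 2) t - real k * flat_exp (k + 1) t)"
      by simp
    then show ?case by (rule Ck_on_real_SucI[OF open_UNIV flat_exp_deriv])
  qed
qed

text \<open>
  For \<open>t > 0\<close> this is \<open>exp (t - 1 / t)\<close>. It vanishes for \<open>t \<le> 0\<close>, is convex, and has slope at
  least \<open>1\<close> from \<open>t = 1\<close> on; composed with an exhaustion function it will give a
  plurisubharmonic function that vanishes on a prescribed sublevel set and is strictly
  plurisubharmonic far out.
\<close>

definition bend :: "real \<Rightarrow> real" where
  "bend t = flat_exp 0 t * exp t"

lemma flat_exp_nonneg: "flat_exp k t \<ge> 0"
  by (simp add: flat_exp_def)

lemma bend_deriv: "(bend has_real_derivative (flat_exp 2 t + flat_exp 0 t) * exp t) (at t)"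
  unfolding bend_def
  by (auto intro!: derivative_eq_intros flat_exp_deriv simp: algebra_simps numeral_2_eq_2)

lemma bend_deriv2:
  "((\<lambda>t. (flat_exp 2 t + flat_exp 0 t) * exp t) has_real_derivative
    (flat_exp 4 t - 2 * flat_exp 3 t + 2 * flat_exp 2 t + flat_exp 0 t) * exp t) (at t)"
proof -
  have "(flat_exp 2 has_real_derivative flat_exp 4 t - 2 * flat_exp 3 t) (at t)"
    using flat_exp_deriv[of 2 t] by simp
  moreover have "(flat_exp 0 has_real_derivative flat_exp 2 t) (at t)"
    using flat_exp_deriv[of 0 t] by (simp add: numeral_2_eq_2)
  ultimately show ?thesis
    by (auto intro!: derivative_eq_intros simp: algebra_simps)
qed

lemma bend_deriv2_nonneg: "(flat_exp 4 t - 2 * flat_exp 3 t + 2 * flat_exp 2 t + flat_exp 0 t) * exp t \<ge> 0"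
proof (cases "t > 0")
  case True
  define s where "s = 1 / t"
  have "flat_exp 4 t - 2 * flat_exp 3 t + 2 * flat_exp 2 t + flat_exp 0 t = exp (- 1 / t) * (s ^ 4 - 2 * s ^ 3 + 2 * s\<^sup>2 + 1)"
    using True by (simp add: flat_exp_def s_def power_divide algebra_simps)
  also have "s ^ 4 - 2 * s ^ 3 + 2 * s\<^sup>2 + 1 = (s * (s - 1))\<^sup>2 + s\<^sup>2 + 1"
    by (simp add: power2_eq_square power3_eq_cube power4_eq_xxxx algebra_simps)
  finally show ?thesis by simp
qed (simp add: flat_exp_def)

lemma bend_eq_0: "t \<le> 0 \<Longrightarrow> bend t = 0"
  by (simp add: bend_def flat_exp_def)

lemma bend_deriv_ge_1:
  assumes "t \<ge> 1" shows "(flat_exp 2 t + flat_exp 0 t) * exp t \<ge> 1"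
proof -
  have "1 \<le> exp (t - 1 / t)" using assms by (simp add: field_simps mult_ge1_I)
  also have "\<dots> = flat_exp 0 t * exp t"
    using assms by (simp add: flat_exp_def flip: exp_add)
  also have "\<dots> \<le> (flat_exp 2 t + flat_exp 0 t) * exp t"
    by (simp add: flat_exp_nonneg)
  finally show ?thesis .
qed

lemma bend_deriv_nonneg: "(flat_exp 2 t + flat_exp 0 t) * exp t \<ge> 0"
  by (simp add: flat_exp_nonneg)

lemma smooth_on_bend: "smooth_on UNIV bend"
  unfolding bend_def[abs_def] by (intro smooth_on_mult smooth_on_flat_exp smooth_on_exp open_UNIV)

definition cutoff :: "real \<Rightarrow> real" where
  "cutoff t = flat_exp 0 (2 - t) * inverse (flat_exp 0 (2 - t) + flat_exp 0 (t - 1))"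

lemma flat_exp_pos: "t > 0 \<Longrightarrow> flat_exp k t > 0"
  by (simp add: flat_exp_def)

lemma cutoff_denominator: "flat_exp 0 (2 - t) + flat_exp 0 (t - 1) > 0"
proof (cases "t < 2")
  case True
  then show ?thesis using flat_exp_pos[of "2 - t" 0] flat_exp_nonneg[of 0 "t - 1"] by linarith
next
  case False
  then show ?thesis using flat_exp_pos[of "t - 1" 0] flat_exp_nonneg[of 0 "2 - t"] by linarith
qed

lemma cutoff_eq_1: "t \<le> 1 \<Longrightarrow> cutoff t = 1"
  by (simp add: cutoff_def flat_exp_def)

lemma cutoff_eq_0: "t \<ge> 2 \<Longrightarrow> cutoff t = 0"
  by (simp add: cutoff_def flat_exp_def)

lemma cutoff_nonneg: "0 \<le> cutoff t"
  using cutoff_denominator[of t] flat_exp_nonneg[of 0 "2 - t"] flat_exp_nonneg[of 0 "t - 1"]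
  by (auto simp: cutoff_def field_simps)

lemma smooth_on_cutoff: "smooth_on UNIV cutoff"
proof -
  have lin: "smooth_on UNIV (\<lambda>t::real. 2 - t)" "smooth_on UNIV (\<lambda>t::real. t - 1)"
    using smooth_on_add[OF open_UNIV smooth_on_const[of UNIV 2] smooth_on_bounded_linear[of UNIV uminus]]
      smooth_on_add[OF open_UNIV smooth_on_bounded_linear[of UNIV "\<lambda>t. t"] smooth_on_const[of UNIV "-1"]]
    by (simp_all add: bounded_linear_minus bounded_linear_ident)
  have 1: "smooth_on UNIV (\<lambda>t. flat_exp 0 (2 - t))" "smooth_on UNIV (\<lambda>t. flat_exp 0 (t - 1))"
    using lin by (auto intro: smooth_on_compose[OF open_UNIV open_UNIV _ _ smooth_on_flat_exp])
  have "smooth_on UNIV (\<lambda>t. inverse (flat_exp 0 (2 - t) + flat_exp 0 (t - 1)))"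
    by (rule smooth_on_compose[OF open_UNIV _ _ _ smooth_on_inverse])
      (use 1 cutoff_denominator in \<open>auto intro!: smooth_on_add simp: less_le\<close>)
  then show ?thesis
    unfolding cutoff_def[abs_def] by (intro smooth_on_mult 1 open_UNIV)
qed

section \<open>Hadamard's lemma\<close>

lemma Ck_on_continuous: "Ck_on k S f \<Longrightarrow> continuous_on S f"
  by (induction k) (auto dest: Ck_on_SucD simp del: Ck_on.simps(2))

lemma segment_in_convex:
  fixes p :: "'e::real_vector"
  assumes "convex S" "p \<in> S" "y \<in> S" "0 \<le> t" "t \<le> 1"
  shows "p + t *\<^sub>R (y - p) \<in> S"
proof -
  have "(1 - t) *\<^sub>R p + t *\<^sub>R y \<in> S" using assms by (intro convexD) auto
  then show ?thesis by (simp add: algebra_simps)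
qed

text \<open>
  Differentiation under the integral sign produces a factor \<open>t\<close>, because \<open>G\<close> is evaluated at
  \<open>p + t (y - p)\<close>. With a power of \<open>t\<close> as a weight the derivatives are integrals of the same
  kind, and the induction on \<open>k\<close> closes.
\<close>

lemma Ck_on_segment_integral:
  fixes G :: "'e::euclidean_space \<Rightarrow> real"
  assumes S: "open S" "convex S" "p \<in> S" and G: "Ck_on k S G"
  shows "Ck_on k S (\<lambda>y. integral {0..1} (\<lambda>t. t ^ m * G (p + t *\<^sub>R (y - p))))"
  using G
proof (induction k arbitrary: G m)
  case 0
  have "continuous_on (S \<times> {0..1}) (\<lambda>z. G (p + snd z *\<^sub>R (fst z - p)))"
    by (rule continuous_on_compose2[of S G])
      (use 0 in \<open>auto intro!: continuous_intros segment_in_convex S\<close>)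
  then have "continuous_on (S \<times> {0..1}) (\<lambda>(y, t). t ^ m * G (p + t *\<^sub>R (y - p)))"
    by (auto simp: case_prod_unfold intro!: continuous_intros)
  then show ?case
    unfolding Ck_on.simps using integral_continuous_on_param[of S "0::real" 1] by simp
next
  case (Suc k)
  let ?D = "\<lambda>z. frechet_derivative G (at z)"
  define fx where "fx y t = t ^ Suc m *\<^sub>R Blinfun (?D (p + t *\<^sub>R (y - p)))" for y t
  have D: "(G has_derivative ?D z) (at z)" if "z \<in> S" for z
    by (rule Ck_on_has_derivative[OF Suc.prems that])
  have fx_apply: "blinfun_apply (fx y t) v = t ^ Suc m * ?D (p + t *\<^sub>R (y - p)) v"
    if "y \<in> S" "t \<in> {0..1}" for y t v
    using has_derivative_bounded_linear[OF D[OF segment_in_convex[OF S(2,3) that(1)]], of t] that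
    by (simp add: fx_def scaleR_blinfun.rep_eq bounded_linear_Blinfun_apply)
  have D_cont: "continuous_on (S \<times> {0..1}) (\<lambda>z. snd z ^ Suc m * ?D (p + snd z *\<^sub>R (fst z - p)) v)" for v
  proof -
    have "continuous_on S (\<lambda>z. ?D z v)"
      using Ck_on_continuous[OF Ck_on_deriv[OF Suc.prems]] .
    then have "continuous_on (S \<times> {0..1}) (\<lambda>z. ?D (p + snd z *\<^sub>R (fst z - p)) v)"
      by (rule continuous_on_compose2)
        (auto intro!: continuous_intros segment_in_convex S)
    then show ?thesis by (intro continuous_intros) auto
  qed
  have "continuous_on (S \<times> {0..1}) (\<lambda>(y, t). fx y t)"
  proof (rule continuous_on_blinfun_componentwise)
    show "continuous_on (S \<times> {0..1}) (\<lambda>z. blinfun_apply (case z of (y, t) \<Rightarrow> fx y t) i)" for i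
      by (rule continuous_on_eq[OF D_cont[of i]]) (auto simp: fx_apply)
  qed
  then have fx_cont: "continuous_on (S \<times> cbox 0 1) (\<lambda>(y, t). fx y t)"
    by (simp add: cbox_interval)
  have deriv: "((\<lambda>y. integral {0..1} (\<lambda>t. t ^ m * G (p + t *\<^sub>R (y - p)))) has_derivative
      (\<lambda>v. integral {0..1} (\<lambda>t. t ^ Suc m * ?D (p + t *\<^sub>R (y - p)) v))) (at y)"
    if y: "y \<in> S" for y
  proof -
    have "((\<lambda>y. integral (cbox 0 1) (\<lambda>t. t ^ m * G (p + t *\<^sub>R (y - p)))) has_derivative
        integral (cbox 0 1) (fx y)) (at y within S)"
    proof (rule leibniz_rule[OF _ _ fx_cont y S(2)])
      fix z t assume z: "z \<in> S" and t: "t \<in> cbox (0::real) 1"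
      have "p + t *\<^sub>R (z - p) \<in> S" using segment_in_convex[OF S(2,3) z] t by auto
      have "((\<lambda>z. p + t *\<^sub>R (z - p)) has_derivative (\<lambda>v. t *\<^sub>R v)) (at z within S)"
        by (auto intro!: derivative_eq_intros)
      then have "((\<lambda>z. G (p + t *\<^sub>R (z - p))) has_derivative (\<lambda>v. ?D (p + t *\<^sub>R (z - p)) (t *\<^sub>R v))) (at z within S)"
        by (rule has_derivative_compose) (rule D[OF \<open>p + t *\<^sub>R (z - p) \<in> S\<close>])
      then have "((\<lambda>z. t ^ m * G (p + t *\<^sub>R (z - p))) has_derivative
          (\<lambda>v. t ^ m * ?D (p + t *\<^sub>R (z - p)) (t *\<^sub>R v))) (at z within S)"
        by (rule has_derivative_mult_right)
      moreover have "(\<lambda>v. t ^ m * ?D (p + t *\<^sub>R (z - p)) (t *\<^sub>R v)) = blinfun_apply (fx z t)"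
      proof
        show "t ^ m * ?D (p + t *\<^sub>R (z - p)) (t *\<^sub>R v) = blinfun_apply (fx z t) v" for v
          using linear_cmul[OF has_derivative_linear[OF D[OF \<open>p + t *\<^sub>R (z - p) \<in> S\<close>]], of t v]
            fx_apply[OF z, of t v] t by simp
      qed
      ultimately show "((\<lambda>z. t ^ m * G (p + t *\<^sub>R (z - p))) has_derivative blinfun_apply (fx z t)) (at z within S)"
        by simp
    next
      fix z assume z: "z \<in> S"
      have "continuous_on {0..1} (\<lambda>t. G (p + t *\<^sub>R (z - p)))"
        by (rule continuous_on_compose2[OF Ck_on_continuous[OF Suc.prems]])
          (auto intro!: continuous_intros segment_in_convex S z)
      then show "(\<lambda>t. t ^ m * G (p + t *\<^sub>R (z - p))) integrable_on cbox 0 1"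
        by (intro integrable_continuous) (auto intro!: continuous_intros)
    qed
    moreover have "blinfun_apply (integral (cbox 0 1) (fx y)) v =
        integral {0..1} (\<lambda>t. t ^ Suc m * ?D (p + t *\<^sub>R (y - p)) v)" for v
    proof -
      have "fx y integrable_on cbox 0 1"
        by (intro integrable_continuous continuous_on_compose2[OF fx_cont, where f="\<lambda>t. (y, t)", simplified])
          (use y in \<open>auto intro!: continuous_intros\<close>)
      from blinfun_apply_integral[OF this, of v]
      have "blinfun_apply (integral (cbox 0 1) (fx y)) v = integral {0..1} (\<lambda>t. blinfun_apply (fx y t) v)"
        by (simp add: cbox_interval)
      also have "\<dots> = integral {0..1} (\<lambda>t. t ^ Suc m * ?D (p + t *\<^sub>R (y - p)) v)"
        by (rule integral_cong) (rule fx_apply[OF y])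
      finally show ?thesis .
    qed
    then have "blinfun_apply (integral (cbox 0 1) (fx y)) =
        (\<lambda>v. integral {0..1} (\<lambda>t. t ^ Suc m * ?D (p + t *\<^sub>R (y - p)) v))"
      by (rule ext)
    ultimately show ?thesis
      using at_within_open[OF y S(1)] by (simp add: cbox_interval)
  qed
  show ?case
    by (rule Ck_on_SucI[OF S(1) deriv]) (assumption, rule Suc.IH[OF Ck_on_deriv[OF Suc.prems]])
qed

text \<open>
  The fundamental theorem of calculus on the segment from \<open>p\<close> to \<open>y\<close>, where \<open>h b\<close> is the average
  of a partial derivative over the segment. That \<open>h b\<close> is smooth makes the remainder a sum of
  products of smooth functions, to which a derivation can be applied.
\<close>

lemma hadamard:
  fixes F :: "'e::euclidean_space \<Rightarrow> real"
  assumes S: "open S" "convex S" "p \<in> S" and F: "smooth_on S F"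
  obtains h where "\<And>b. smooth_on S (h b)" "\<And>b. h b p = frechet_derivative F (at p) b"
    "\<And>y. y \<in> S \<Longrightarrow> F y = F p + (\<Sum>b\<in>Basis. ((y - p) \<bullet> b) * h b y)"
proof
  let ?D = "\<lambda>z. frechet_derivative F (at z)"
  define h where "h b y = integral {0..1} (\<lambda>t. t ^ 0 * ?D (p + t *\<^sub>R (y - p)) b)" for b y
  show "smooth_on S (h b)" for b
    unfolding h_def[abs_def] smooth_on_def
    by (intro allI Ck_on_segment_integral S) (use smooth_on_deriv[OF F] in \<open>auto simp: smooth_on_def\<close>)
  show "h b p = ?D p b" for b by (simp add: h_def)
  show "F y = F p + (\<Sum>b\<in>Basis. ((y - p) \<bullet> b) * h b y)" if y: "y \<in> S" for y
  proof -
    have seg: "p + t *\<^sub>R (y - p) \<in> S" if "t \<in> {0..1}" for t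
      using segment_in_convex[OF S(2,3) y] that by auto
    have "((\<lambda>t. ?D (p + t *\<^sub>R (y - p)) (y - p)) has_integral
        (F (p + 1 *\<^sub>R (y - p)) - F (p + 0 *\<^sub>R (y - p)))) {0..1}"
    proof (rule fundamental_theorem_of_calculus)
      fix t :: real assume t: "t \<in> {0..1}"
      have 1: "((\<lambda>t. p + t *\<^sub>R (y - p)) has_derivative (\<lambda>s. s *\<^sub>R (y - p))) (at t within {0..1})"
        by (auto intro!: derivative_eq_intros)
      have D: "(F has_derivative ?D (p + t *\<^sub>R (y - p))) (at (p + t *\<^sub>R (y - p)))"
        by (rule smooth_on_has_derivative[OF F seg[OF t]])
      have "(\<lambda>s. ?D (p + t *\<^sub>R (y - p)) (s *\<^sub>R (y - p))) = (\<lambda>s. s *\<^sub>R ?D (p + t *\<^sub>R (y - p)) (y - p))"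
        using linear_cmul[OF has_derivative_linear[OF D]] by (intro ext)
      with has_derivative_compose[OF 1 D]
      show "((\<lambda>t. F (p + t *\<^sub>R (y - p))) has_vector_derivative ?D (p + t *\<^sub>R (y - p)) (y - p)) (at t within {0..1})"
        by (simp add: has_vector_derivative_def)
    qed simp
    then have 1: "integral {0..1} (\<lambda>t. ?D (p + t *\<^sub>R (y - p)) (y - p)) = F y - F p"
      by (simp add: integral_unique)
    have int: "(\<lambda>t. ?D (p + t *\<^sub>R (y - p)) b) integrable_on {0..1}" for b
      by (intro integrable_continuous_interval
          continuous_on_compose2[OF smooth_on_continuous[OF smooth_on_deriv[OF F]]])
        (use seg in \<open>auto intro!: continuous_intros\<close>)
    have "integral {0..1} (\<lambda>t. ?D (p + t *\<^sub>R (y - p)) (y - p)) =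
        integral {0..1} (\<lambda>t. \<Sum>b\<in>Basis. ((y - p) \<bullet> b) * ?D (p + t *\<^sub>R (y - p)) b)"
    proof (rule integral_cong)
      fix t :: real assume t: "t \<in> {0..1}"
      have lin: "linear (?D (p + t *\<^sub>R (y - p)))"
        using has_derivative_linear[OF smooth_on_has_derivative[OF F seg[OF t]]] .
      have "?D (p + t *\<^sub>R (y - p)) (y - p) =
          ?D (p + t *\<^sub>R (y - p)) (\<Sum>b\<in>Basis. ((y - p) \<bullet> b) *\<^sub>R b)"
        by (simp only: euclidean_representation)
      also have "\<dots> = (\<Sum>b\<in>Basis. ((y - p) \<bullet> b) * ?D (p + t *\<^sub>R (y - p)) b)"
        by (simp only: linear_sum[OF lin] linear_cmul[OF lin] real_scaleR_def)
      finally show "?D (p + t *\<^sub>R (y - p)) (y - p) =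
        (\<Sum>b\<in>Basis. ((y - p) \<bullet> b) * ?D (p + t *\<^sub>R (y - p)) b)" .
    qed
    also have "\<dots> = (\<Sum>b\<in>Basis. ((y - p) \<bullet> b) * h b y)"
      using int by (simp add: integral_sum integrable_on_mult_right h_def)
    finally show ?thesis using 1 by simp
  qed
qed

section \<open>Bump functions and smooth functions on the manifold\<close>

lemma smooth_on_diff_sq: "smooth_on UNIV (\<lambda>b::'e::euclidean_space. (b - a) \<bullet> (b - a) / s)"
proof -
  have c: "smooth_on UNIV (\<lambda>b. (b - a) \<bullet> i)" for i :: 'e
  proof -
    have "smooth_on UNIV (\<lambda>b. b \<bullet> i + - (a \<bullet> i))"
      by (intro smooth_on_add smooth_on_const smooth_on_bounded_linear bounded_linear_inner_left open_UNIV)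
    then show ?thesis by (simp add: inner_diff_left)
  qed
  have "smooth_on UNIV (\<lambda>b. (\<Sum>i\<in>Basis. ((b - a) \<bullet> i) * ((b - a) \<bullet> i)) * inverse s)"
    by (intro smooth_on_mult smooth_on_sum smooth_on_const c open_UNIV)
  moreover have "(\<Sum>i\<in>Basis. ((b - a) \<bullet> i) * ((b - a) \<bullet> i)) * inverse s = (b - a) \<bullet> (b - a) / s" for b
    by (subst euclidean_inner[of "b - a" "b - a"]) (simp only: divide_inverse)
  ultimately show ?thesis by (simp only:)
qed

definition ball_bump :: "'e::euclidean_space \<Rightarrow> real \<Rightarrow> 'e \<Rightarrow> real" where
  "ball_bump a r b = cutoff ((b - a) \<bullet> (b - a) / r\<^sup>2)"

lemma smooth_on_ball_bump: "smooth_on UNIV (ball_bump a r)"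
  unfolding ball_bump_def[abs_def]
  by (rule smooth_on_compose[OF open_UNIV open_UNIV _ smooth_on_diff_sq smooth_on_cutoff]) simp

lemma ball_bump_eq_1: "r > 0 \<Longrightarrow> b \<in> cball a r \<Longrightarrow> ball_bump a r b = 1"
  unfolding ball_bump_def
  by (rule cutoff_eq_1) (simp add: dot_square_norm dist_norm norm_minus_commute power_mono)

lemma ball_bump_eq_0:
  assumes "r > 0" "b \<notin> cball a (2 * r)" shows "ball_bump a r b = 0"
proof -
  have "2 * r \<le> norm (b - a)" using assms by (simp add: dist_norm norm_minus_commute)
  then have "(2 * r)\<^sup>2 \<le> (norm (b - a))\<^sup>2" using assms by (intro power_mono) auto
  moreover have "2 * r\<^sup>2 \<le> (2 * r)\<^sup>2" by (simp add: power_mult_distrib)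
  ultimately have "2 * r\<^sup>2 \<le> (norm (b - a))\<^sup>2" by linarith
  then show ?thesis
    using assms unfolding ball_bump_def by (intro cutoff_eq_0) (simp add: dot_square_norm field_simps)
qed

text \<open>
  \<open>F\<close> is smooth on \<open>S\<close> and zero on the part of \<open>T\<close> outside \<open>Q\<close>, and these two sets cover \<open>T\<close>.
\<close>

lemma smooth_on_extend_zero:
  assumes "open S" "open T" "closed Q" "smooth_on S F" "\<And>b. b \<in> T - Q \<Longrightarrow> F b = 0" "Q \<subseteq> S"
  shows "smooth_on T F"
proof (rule smooth_on_local[OF assms(2)])
  fix b assume b: "b \<in> T"
  show "\<exists>O'. open O' \<and> b \<in> O' \<and> smooth_on (T \<inter> O') F"
  proof (cases "b \<in> Q")
    case True
    then show ?thesis using assms by (intro exI[of _ S]) (auto intro: smooth_on_subset)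
  next
    case False
    have "smooth_on (T \<inter> - Q) F"
      by (rule smooth_on_cong[OF _ _ smooth_on_const[of _ 0]]) (use assms in \<open>auto simp: open_Compl\<close>)
    then show ?thesis using False assms(3) by (intro exI[of _ "- Q"]) (auto simp: open_Compl)
  qed
qed

lemma sum_Basis_vec: "(\<Sum>b\<in>(Basis :: (real^'n) set). f b) = (\<Sum>i\<in>UNIV. f (axis i (1::real)))"
proof -
  have "(Basis :: (real^'n) set) = range (\<lambda>i. axis i 1)" by (auto simp: Basis_vec_def)
  then have "(\<Sum>b\<in>(Basis :: (real^'n) set). f b) = sum f (range (\<lambda>i. axis i 1))"
    by (rule arg_cong)
  also have "\<dots> = (\<Sum>i\<in>UNIV. f (axis i 1))"
    by (subst sum.reindex) (auto simp: inj_on_def axis_eq_axis)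
  finally show ?thesis .
qed

lemma nth_in: "set xs \<subseteq> T \<Longrightarrow> k < length xs \<Longrightarrow> xs ! k \<in> T"
  by (meson nth_mem subsetD)

context smooth_manifold
begin

lemma chartD:
  assumes "(U, c) \<in> atlas"
  shows "open U" "open (c ` U)" "inj_on c U" "continuous_on U c" "continuous_on (c ` U) (inv_into U c)"
proof -
  from charts[OF assms] obtain c' where h: "open U" "open (c ` U)" "homeomorphism U (c ` U) c c'"
    by (auto simp: is_chart_def)
  show "open U" "open (c ` U)" by (fact h)+
  show i: "inj_on c U" using h(3) by (metis homeomorphism_apply1 inj_on_def)
  show "continuous_on U c" using h(3) by (simp add: homeomorphism_def)
  have "continuous_on (c ` U) c'" using h(3) by (simp add: homeomorphism_def)
  then show "continuous_on (c ` U) (inv_into U c)"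
    by (rule continuous_on_eq) (use h(3) i in \<open>auto simp: homeomorphism_def\<close>)
qed

lemma chart_at: obtains U c where "(U, c) \<in> atlas" "y \<in> U"
  using covering by fastforce

lemma chart_image_open:
  assumes "(U, c) \<in> atlas" "open N" shows "open (c ` (U \<inter> N))"
proof -
  have "open (c ` U \<inter> inv_into U c -` (U \<inter> N))"
    using chartD[OF assms(1)] assms(2) by (intro continuous_open_preimage) auto
  moreover have "c ` U \<inter> inv_into U c -` (U \<inter> N) = c ` (U \<inter> N)"
    using chartD(3)[OF assms(1)] by auto
  ultimately show ?thesis by simp
qed

lemma chart_preimage_open:
  assumes "(U, c) \<in> atlas" "open B" shows "open (U \<inter> c -` B)"
  using chartD[OF assms(1)] assms(2) by (intro continuous_open_preimage) auto

lemma smooth_functionsI: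
  "(\<And>U c. (U, c) \<in> atlas \<Longrightarrow> smooth_on (c ` U) (\<lambda>b. f (inv_into U c b))) \<Longrightarrow> f \<in> smooth_functions"
  by (auto simp: smooth_functions_def o_def)

lemma smooth_functionsD:
  "f \<in> smooth_functions \<Longrightarrow> (U, c) \<in> atlas \<Longrightarrow> smooth_on (c ` U) (\<lambda>b. f (inv_into U c b))"
  by (auto simp: smooth_functions_def o_def)

lemma smooth_const [simp]: "(\<lambda>_. a) \<in> smooth_functions"
  by (rule smooth_functionsI) (simp add: smooth_on_const chartD)

lemma smooth_add: "f \<in> smooth_functions \<Longrightarrow> h \<in> smooth_functions \<Longrightarrow> (\<lambda>y. f y + h y) \<in> smooth_functions"
  by (rule smooth_functionsI) (simp add: smooth_on_add smooth_functionsD chartD)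

lemma smooth_mult: "f \<in> smooth_functions \<Longrightarrow> h \<in> smooth_functions \<Longrightarrow> (\<lambda>y. f y * h y) \<in> smooth_functions"
  by (rule smooth_functionsI) (simp add: smooth_on_mult smooth_functionsD chartD)

lemma smooth_cmult: "f \<in> smooth_functions \<Longrightarrow> (\<lambda>y. a * f y) \<in> smooth_functions"
  using smooth_mult[OF smooth_const] .

lemma smooth_minus: "f \<in> smooth_functions \<Longrightarrow> (\<lambda>y. - f y) \<in> smooth_functions"
  using smooth_cmult[of f "-1"] by simp

lemma smooth_diff: "f \<in> smooth_functions \<Longrightarrow> h \<in> smooth_functions \<Longrightarrow> (\<lambda>y. f y - h y) \<in> smooth_functions"
  using smooth_add[OF _ smooth_minus, of f h] by simp

lemma smooth_sum: "(\<And>i. i \<in> I \<Longrightarrow> f i \<in> smooth_functions) \<Longrightarrow> (\<lambda>y. \<Sum>i\<in>I. f i y) \<in> smooth_functions"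
  by (induction I rule: infinite_finite_induct) (auto intro: smooth_add)

lemma smooth_prod: "(\<And>i. i \<in> I \<Longrightarrow> f i \<in> smooth_functions) \<Longrightarrow> (\<lambda>y. \<Prod>i\<in>I. f i y) \<in> smooth_functions"
  by (induction I rule: infinite_finite_induct) (auto intro: smooth_mult)

lemma smooth_comp_real:
  fixes h :: "real \<Rightarrow> real"
  assumes "f \<in> smooth_functions" "open T" "smooth_on T h" "\<And>y. f y \<in> T"
  shows "(\<lambda>y. h (f y)) \<in> smooth_functions"
  by (rule smooth_functionsI, rule smooth_on_compose[OF _ assms(2) _ smooth_functionsD[OF assms(1)] assms(3)])
    (use assms chartD in auto)

lemma smooth_local:
  assumes "\<And>y. \<exists>N h. open N \<and> y \<in> N \<and> h \<in> smooth_functions \<and> (\<forall>z\<in>N. f z = h z)"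
  shows "f \<in> smooth_functions"
proof (rule smooth_functionsI)
  fix U c assume C: "(U, c) \<in> atlas"
  show "smooth_on (c ` U) (\<lambda>b. f (inv_into U c b))"
  proof (rule smooth_on_local)
    fix b assume b: "b \<in> c ` U"
    let ?y = "inv_into U c b"
    obtain N h where N: "open N" "?y \<in> N" "h \<in> smooth_functions" "\<forall>z\<in>N. f z = h z"
      using assms by blast
    have U: "?y \<in> U" "c ?y = b" using b by (auto simp: inv_into_into f_inv_into_f)
    have O: "open (c ` (U \<inter> N))" by (rule chart_image_open[OF C N(1)])
    have "smooth_on (c ` (U \<inter> N)) (\<lambda>b. f (inv_into U c b))"
      by (rule smooth_on_cong[OF O _ smooth_on_subset[OF smooth_functionsD[OF N(3) C]]])
        (use N(4) chartD(3)[OF C] in auto)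
    then have "smooth_on (c ` U \<inter> c ` (U \<inter> N)) (\<lambda>b. f (inv_into U c b))"
      by (rule smooth_on_subset) auto
    moreover have "b \<in> c ` (U \<inter> N)" using U N(2) by (metis IntI imageI)
    ultimately show "\<exists>O'. open O' \<and> b \<in> O' \<and> smooth_on (c ` U \<inter> O') (\<lambda>b. f (inv_into U c b))"
      using O by blast
  qed (rule chartD(2)[OF C])
qed

lemma smooth_continuous:
  assumes "f \<in> smooth_functions" shows "continuous_on UNIV f"
proof (rule continuous_at_imp_continuous_on, rule ballI)
  fix y
  obtain U c where C: "(U, c) \<in> atlas" "y \<in> U" by (rule chart_at)
  have "continuous_on U (\<lambda>y. f (inv_into U c (c y)))"
    by (rule continuous_on_compose2[OF smooth_on_continuous[OF smooth_functionsD[OF assms C(1)]] chartD(4)[OF C(1)]]) auto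
  then have "continuous_on U f"
    by (rule continuous_on_eq) (use chartD(3)[OF C(1)] in auto)
  then show "isCont f y" using C chartD(1)[OF C(1)] by (simp add: continuous_on_eq_continuous_at)
qed

text \<open>
  Functions with compact support in a chart extend by zero. The set of points that correspond to
  \<open>Q\<close> is compact, hence closed in the Hausdorff space \<open>X\<close>, so the extension is zero on an open
  set which together with \<open>U\<close> covers \<open>X\<close>.
\<close>

lemma chart_push:
  assumes C: "(U, c) \<in> atlas" and S: "open S" "smooth_on S F" and Q: "compact Q" "Q \<subseteq> S" "Q \<subseteq> c ` U"
    and F0: "\<And>b. b \<in> c ` U - Q \<Longrightarrow> F b = 0"
  shows "(\<lambda>y. if y \<in> U then F (c y) else 0) \<in> smooth_functions" (is "?f \<in> _")
proof (rule smooth_functionsI)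
  have F: "smooth_on (c ` U) F"
    by (rule smooth_on_extend_zero[OF S(1) chartD(2)[OF C] compact_imp_closed[OF Q(1)] S(2) F0 Q(2)])
  have "compact (inv_into U c ` Q)"
    using chartD(5)[OF C] Q by (intro compact_continuous_image) (auto intro: continuous_on_subset)
  then have W: "open (- (inv_into U c ` Q))" by (simp add: compact_imp_closed open_Compl)
  fix V d assume D: "(V, d) \<in> atlas"
  show "smooth_on (d ` V) (\<lambda>b. ?f (inv_into V d b))"
  proof (rule smooth_on_local)
    fix b assume b: "b \<in> d ` V"
    let ?y = "inv_into V d b"
    have V: "?y \<in> V" "d ?y = b" using b by (auto simp: inv_into_into f_inv_into_f)
    show "\<exists>O'. open O' \<and> b \<in> O' \<and> smooth_on (d ` V \<inter> O') (\<lambda>b. ?f (inv_into V d b))"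
    proof (cases "?y \<in> U")
      case True
      have O: "open (d ` (V \<inter> U))" by (rule chart_image_open[OF D chartD(1)[OF C]])
      have cd: "smooth_on (d ` (V \<inter> U)) (\<lambda>b. c (inv_into V d b))"
        using compatible[OF D C] by (simp add: transition_def o_def)
      have "smooth_on (d ` (V \<inter> U)) (\<lambda>b. F (c (inv_into V d b)))"
        by (rule smooth_on_compose[OF O chartD(2)[OF C] _ cd F]) (use chartD(3)[OF D] in auto)
      then have "smooth_on (d ` (V \<inter> U)) (\<lambda>b. ?f (inv_into V d b))"
        by (rule smooth_on_cong[OF O, rotated]) (use chartD(3)[OF D] in auto)
      then have "smooth_on (d ` V \<inter> d ` (V \<inter> U)) (\<lambda>b. ?f (inv_into V d b))"
        by (rule smooth_on_subset) auto
      moreover have "b \<in> d ` (V \<inter> U)" using V True by (metis IntI imageI)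
      ultimately show ?thesis using O by blast
    next
      case False
      let ?W = "- (inv_into U c ` Q)"
      have "?y \<in> ?W" using False Q(3) by (auto simp: inv_into_into subset_iff)
      have O: "open (d ` (V \<inter> ?W))" by (rule chart_image_open[OF D W])
      have z: "?f z = 0" if "z \<in> ?W" for z
        using that F0 chartD(3)[OF C] by (auto simp: image_iff) (metis inv_into_f_f)
      have "smooth_on (d ` (V \<inter> ?W)) (\<lambda>b. ?f (inv_into V d b))"
      proof (rule smooth_on_cong[OF O _ smooth_on_const[OF O, of 0]])
        fix b' assume "b' \<in> d ` (V \<inter> ?W)"
        then have "inv_into V d b' \<in> ?W" using chartD(3)[OF D] by auto
        from z[OF this] show "0 = ?f (inv_into V d b')" by simp
      qed
      then have "smooth_on (d ` V \<inter> d ` (V \<inter> ?W)) (\<lambda>b. ?f (inv_into V d b))"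
        by (rule smooth_on_subset) auto
      moreover have "b \<in> d ` (V \<inter> ?W)" using V \<open>?y \<in> ?W\<close> by (metis IntI imageI)
      ultimately show ?thesis using O by blast
    qed
  qed (rule chartD(2)[OF D])
qed

lemma bump_exists:
  assumes "open N" "y \<in> N"
  obtains \<kappa> where "\<kappa> \<in> smooth_functions" "\<kappa> y = 1" "\<And>z. z \<notin> N \<Longrightarrow> \<kappa> z = 0" "\<And>z. 0 \<le> \<kappa> z"
proof -
  obtain U c where C: "(U, c) \<in> atlas" "y \<in> U" by (rule chart_at)
  have "open (c ` (U \<inter> N))" "c y \<in> c ` (U \<inter> N)"
    using chart_image_open[OF C(1) assms(1)] C(2) assms(2) by auto
  then obtain e where e: "e > 0" "cball (c y) e \<subseteq> c ` (U \<inter> N)"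
    by (meson open_contains_cball)
  define r where "r = e / 2"
  have r: "r > 0" "cball (c y) (2 * r) \<subseteq> c ` (U \<inter> N)" using e by (auto simp: r_def)
  define \<kappa> where "\<kappa> = (\<lambda>z. if z \<in> U then ball_bump (c y) r (c z) else 0)"
  show thesis
  proof
    show "\<kappa> \<in> smooth_functions" unfolding \<kappa>_def
      by (rule chart_push[OF C(1) open_UNIV smooth_on_ball_bump compact_cball[of "c y" "2 * r"]])
        (use r ball_bump_eq_0 in auto)
    show "\<kappa> y = 1" using C r by (simp add: \<kappa>_def ball_bump_eq_1)
    show "\<kappa> z = 0" if "z \<notin> N" for z
    proof (cases "z \<in> U")
      case True
      have "c z \<notin> c ` (U \<inter> N)" using chartD(3)[OF C(1)] True that by (auto simp: inj_on_def)
      then have "c z \<notin> cball (c y) (2 * r)" using r by blast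
      from ball_bump_eq_0[OF r(1) this] show ?thesis by (simp add: \<kappa>_def)
    qed (simp add: \<kappa>_def)
    show "0 \<le> \<kappa> z" for z by (simp add: \<kappa>_def ball_bump_def cutoff_nonneg)
  qed
qed

section \<open>Tangent vectors and local frames\<close>

lemma tangent_linear:
  "v \<in> tangent x \<Longrightarrow> f \<in> smooth_functions \<Longrightarrow> h \<in> smooth_functions \<Longrightarrow>
    v (\<lambda>y. a * f y + b * h y) = a * v f + b * v h"
  by (simp add: tangent_def)

lemma tangent_mult:
  "v \<in> tangent x \<Longrightarrow> f \<in> smooth_functions \<Longrightarrow> h \<in> smooth_functions \<Longrightarrow>
    v (\<lambda>y. f y * h y) = v f * h x + f x * v h"
  by (simp add: tangent_def)

lemma tangent_nonsmooth: "v \<in> tangent x \<Longrightarrow> f \<notin> smooth_functions \<Longrightarrow> v f = 0"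
  by (simp add: tangent_def)

lemma tangent_add:
  "v \<in> tangent x \<Longrightarrow> f \<in> smooth_functions \<Longrightarrow> h \<in> smooth_functions \<Longrightarrow> v (\<lambda>y. f y + h y) = v f + v h"
  using tangent_linear[of v x f h 1 1] by simp

lemma tangent_cmult: "v \<in> tangent x \<Longrightarrow> f \<in> smooth_functions \<Longrightarrow> v (\<lambda>y. a * f y) = a * v f"
  using tangent_linear[of v x f f a 0] by simp

lemma tangent_diff:
  "v \<in> tangent x \<Longrightarrow> f \<in> smooth_functions \<Longrightarrow> h \<in> smooth_functions \<Longrightarrow> v (\<lambda>y. f y - h y) = v f - v h"
  using tangent_linear[of v x f h 1 "-1"] by simp

lemma tangent_const: assumes "v \<in> tangent x" shows "v (\<lambda>_. a) = 0"
proof -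
  have "v (\<lambda>_. 1) = 0" using tangent_mult[OF assms, of "\<lambda>_. 1" "\<lambda>_. 1"] by simp
  then show ?thesis using tangent_cmult[OF assms, of "\<lambda>_. 1" a] by simp
qed

lemma tangent_sum:
  assumes "v \<in> tangent x" "finite I" "\<And>i. i \<in> I \<Longrightarrow> f i \<in> smooth_functions"
  shows "v (\<lambda>y. \<Sum>i\<in>I. f i y) = (\<Sum>i\<in>I. v (f i))"
  using assms(2,3)
  by (induction I rule: finite_induct)
    (simp_all add: tangent_const[OF assms(1)] tangent_add[OF assms(1)] smooth_sum)

text \<open>
  Derivations are defined on global functions but see only germs: with a bump function \<open>\<kappa>\<close> at
  \<open>x\<close> supported in \<open>N\<close>, \<open>\<kappa> f = 0\<close>, and the product rule gives \<open>v f = 0\<close>.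
\<close>

lemma tangent_local_zero:
  assumes "v \<in> tangent x" "open N" "x \<in> N" "\<And>z. z \<in> N \<Longrightarrow> f z = 0"
  shows "v f = 0"
proof (cases "f \<in> smooth_functions")
  case True
  obtain \<kappa> where \<kappa>: "\<kappa> \<in> smooth_functions" "\<kappa> x = 1" "\<And>z. z \<notin> N \<Longrightarrow> \<kappa> z = 0"
    by (rule bump_exists[OF assms(2,3)]) blast
  have "(\<lambda>y. \<kappa> y * f y) = (\<lambda>_. 0)" using \<kappa>(3) assms(4) by fastforce
  then have "v (\<lambda>y. \<kappa> y * f y) = 0" using tangent_const[OF assms(1)] by simp
  then show ?thesis using tangent_mult[OF assms(1) \<kappa>(1) True] \<kappa>(2) assms(3,4) by simp
qed (simp add: tangent_nonsmooth[OF assms(1)])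

text \<open>
  Hadamard's lemma in one variable writes \<open>\<psi> (u y) - \<psi> (u x)\<close> as \<open>(u y - u x) h (u y)\<close>, where
  \<open>h (u x) = d\<close>, and the product rule evaluates \<open>v\<close> on this.
\<close>

lemma tangent_comp_real:
  assumes "v \<in> tangent x" "u \<in> smooth_functions" "smooth_on UNIV \<psi>" "(\<psi> has_real_derivative d) (at (u x))"
  shows "v (\<lambda>y. \<psi> (u y)) = d * v u"
proof -
  obtain h where h: "\<And>b. smooth_on UNIV (h b)" "\<And>b. h b (u x) = frechet_derivative \<psi> (at (u x)) b"
    "\<And>t. \<psi> t = \<psi> (u x) + (\<Sum>b\<in>Basis. ((t - u x) \<bullet> b) * h b t)"
    by (rule hadamard[OF open_UNIV convex_UNIV UNIV_I assms(3), of "u x"]) blast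
  have hu: "(\<lambda>y. h 1 (u y)) \<in> smooth_functions"
    by (rule smooth_comp_real[OF assms(2) open_UNIV h(1)]) auto
  have u': "(\<lambda>y. u y - u x) \<in> smooth_functions" by (intro smooth_diff assms smooth_const)
  have "(\<lambda>y. \<psi> (u y)) = (\<lambda>y. \<psi> (u x) + (u y - u x) * h 1 (u y))"
    by (rule ext, rule trans[OF h(3)]) simp
  then have "v (\<lambda>y. \<psi> (u y)) = v (\<lambda>y. (u y - u x) * h 1 (u y))"
    using tangent_add[OF assms(1) smooth_const smooth_mult[OF u' hu]] tangent_const[OF assms(1)] by simp
  also have "\<dots> = v u * h 1 (u x)"
    using tangent_mult[OF assms(1) u' hu] tangent_diff[OF assms(1,2) smooth_const] tangent_const[OF assms(1)]
    by simp
  also have "h 1 (u x) = d"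
    unfolding h(2) frechet_derivative_at[OF assms(4)[unfolded has_field_derivative_def], symmetric] by simp
  finally show ?thesis by simp
qed

lemma lincomb_tangent:
  assumes "v \<in> tangent x" "w \<in> tangent x" shows "lincomb a v b w \<in> tangent x"
  unfolding tangent_def lincomb_def using assms
  by (auto simp: tangent_linear tangent_mult tangent_nonsmooth algebra_simps)

lemma zero_tangent: "(\<lambda>f. 0) \<in> tangent x"
  by (simp add: tangent_def)

text \<open>
  The functions \<open>x j\<close> are chart coordinates and the fields \<open>E j\<close> are coordinate derivatives,
  both multiplied by a bump function so that they are globally defined.

  That every derivation is a combination of the coordinate derivatives is Hadamard's lemma: near
  \<open>z\<close>, \<open>f - f z = (\<Sum>j. (x j - x j z) h j)\<close>, and a derivation at \<open>z\<close> sees only the values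
  \<open>h j z = E j z f\<close> of the factors \<open>h j\<close>. Multiplying this identity by the square of a bump
  function \<open>\<kappa>\<close> at \<open>z\<close> makes all functions in it global.

  In the chart, the bump function of the frame is \<open>1\<close> on the ball of radius \<open>r\<close> and supported in
  that of radius \<open>2 * r\<close>, Hadamard's lemma is applied on the ball of radius \<open>3 * r\<close>, and \<open>Q\<close> is
  the ball of radius \<open>r / 2\<close>. Compactness of \<open>Q\<close> is what later gives uniform bounds.
\<close>

lemma local_frame:
  fixes y0 :: 'a
  obtains N Q and x :: "'n \<Rightarrow> 'a \<Rightarrow> real" and E :: "'n \<Rightarrow> 'a vfield" where
    "open N" "y0 \<in> N" "N \<subseteq> Q" "compact Q"
    "\<And>j. x j \<in> smooth_functions" "\<And>j. E j \<in> vector_fields"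
    "\<And>z j k. z \<in> Q \<Longrightarrow> E j z (x k) = (if j = k then 1 else 0)"
    "\<And>z v f. z \<in> Q \<Longrightarrow> v \<in> tangent z \<Longrightarrow> f \<in> smooth_functions \<Longrightarrow> v f = (\<Sum>j\<in>UNIV. v (x j) * E j z f)"
proof -
  obtain U c where C: "(U, c) \<in> atlas" "y0 \<in> U" by (rule chart_at)
  note Ch = chartD[OF C(1)]
  define a where "a = c y0"
  let ?inv = "inv_into U c"
  have "a \<in> c ` U" using C by (simp add: a_def)
  then obtain e where e: "e > 0" "cball a e \<subseteq> c ` U" using Ch(2) by (meson open_contains_cball)
  define r where "r = e / 3"
  have r: "r > 0" "cball a (3 * r) \<subseteq> c ` U" using e by (auto simp: r_def)
  let ?\<beta> = "ball_bump a r"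
  let ?e = "\<lambda>j::'n. axis j (1::real)"
  let ?D = "\<lambda>f b. frechet_derivative (\<lambda>b. f (?inv b)) (at b)"
  define x where "x = (\<lambda>j y. if y \<in> U then ?\<beta> (c y) * (c y $ j) else 0)"
  define E where "E = (\<lambda>j z f. if z \<in> U \<and> f \<in> smooth_functions then ?\<beta> (c z) * ?D f (c z) (?e j) else 0)"
  define N where "N = U \<inter> c -` ball a (r / 2)"
  define Q where "Q = ?inv ` cball a (r / 2)"
  have sub2: "cball a (2 * r) \<subseteq> c ` U" using r by (force simp: subset_iff)
  have x: "x j \<in> smooth_functions" for j unfolding x_def
  proof (rule chart_push[OF C(1) open_UNIV _ compact_cball[of a "2 * r"]])
    show "smooth_on UNIV (\<lambda>b. ?\<beta> b * (b $ j))"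
      by (intro smooth_on_mult smooth_on_ball_bump smooth_on_bounded_linear bounded_linear_vec_nth open_UNIV)
  qed (use r sub2 ball_bump_eq_0 in auto)
  have D: "((\<lambda>b. f (?inv b)) has_derivative ?D f b) (at b)" if "f \<in> smooth_functions" "b \<in> c ` U" for f b
    using smooth_on_has_derivative[OF smooth_functionsD[OF that(1) C(1)] that(2)] .
  have E_tangent: "E j z \<in> tangent z" for j z
  proof (cases "z \<in> U")
    case True
    have inv: "?inv (c z) = z" using True Ch(3) by simp
    have "?D (\<lambda>y. s * f y + t * h y) (c z) w = s * ?D f (c z) w + t * ?D h (c z) w"
      if "f \<in> smooth_functions" "h \<in> smooth_functions" for f h s t w
    proof -
      have HD: "((\<lambda>b. s * f (?inv b) + t * h (?inv b)) has_derivative (\<lambda>w. s * ?D f (c z) w + t * ?D h (c z) w)) (at (c z))"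
        by (intro has_derivative_add has_derivative_mult_right D that) (use True in auto)
      show ?thesis by (simp only: frechet_derivative_at[OF HD, symmetric])
    qed
    moreover have "?D (\<lambda>y. f y * h y) (c z) w = ?D f (c z) w * h z + f z * ?D h (c z) w"
      if "f \<in> smooth_functions" "h \<in> smooth_functions" for f h w
    proof -
      have HD: "((\<lambda>b. f (?inv b) * h (?inv b)) has_derivative
          (\<lambda>w. f (?inv (c z)) * ?D h (c z) w + ?D f (c z) w * h (?inv (c z)))) (at (c z))"
        by (intro has_derivative_mult D that) (use True in auto)
      show ?thesis by (simp only: frechet_derivative_at[OF HD, symmetric] inv)
    qed
    ultimately show ?thesis
      unfolding tangent_def E_def using True by (auto simp: smooth_add smooth_cmult smooth_mult algebra_simps)
  qed (simp add: E_def tangent_def)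
  have E: "E j \<in> vector_fields" for j
    unfolding vector_fields_def
  proof (intro CollectI conjI allI ballI)
    fix f assume f: "f \<in> smooth_functions"
    have "(\<lambda>z. if z \<in> U then ?\<beta> (c z) * ?D f (c z) (?e j) else 0) \<in> smooth_functions"
    proof (rule chart_push[OF C(1) Ch(2) _ compact_cball[of a "2 * r"]])
      show "smooth_on (c ` U) (\<lambda>b. ?\<beta> b * ?D f b (?e j))"
        by (intro smooth_on_mult smooth_on_deriv smooth_functionsD f C(1) Ch(2)
            smooth_on_subset[OF smooth_on_ball_bump]) auto
    qed (use r sub2 ball_bump_eq_0 in auto)
    moreover have "(\<lambda>z. E j z f) = (\<lambda>z. if z \<in> U then ?\<beta> (c z) * ?D f (c z) (?e j) else 0)"
      using f by (auto simp: E_def)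
    ultimately show "(\<lambda>z. E j z f) \<in> smooth_functions" by simp
  qed (rule E_tangent)
  have Q: "z \<in> U" "c z \<in> cball a (r / 2)" "?\<beta> (c z) = 1" if "z \<in> Q" for z
  proof -
    from that obtain b where b: "b \<in> cball a (r / 2)" "z = ?inv b" by (auto simp: Q_def)
    have "b \<in> c ` U" using b(1) r by (auto simp: subset_iff)
    then have *: "c z = b" "z \<in> U" using b(2) by (auto simp: f_inv_into_f inv_into_into)
    then show "z \<in> U" "c z \<in> cball a (r / 2)" using b by auto
    show "?\<beta> (c z) = 1" by (rule ball_bump_eq_1) (use * b r in auto)
  qed
  show thesis
  proof
    show "open N" unfolding N_def by (rule chart_preimage_open[OF C(1)]) simp
    show "y0 \<in> N" using C r by (simp add: N_def a_def)
    show "N \<subseteq> Q"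
    proof
      fix z assume "z \<in> N"
      then have "z = ?inv (c z)" "c z \<in> cball a (r / 2)" using Ch(3) by (auto simp: N_def)
      then show "z \<in> Q" unfolding Q_def by blast
    qed
    have "cball a (r / 2) \<subseteq> c ` U" using r by (auto simp: subset_iff)
    then show "compact Q" unfolding Q_def
      by (intro compact_continuous_image compact_cball continuous_on_subset[OF Ch(5)])
    show "x j \<in> smooth_functions" "E j \<in> vector_fields" for j by (fact x E)+
    show "E j z (x k) = (if j = k then 1 else 0)" if z: "z \<in> Q" for z j k
    proof -
      have "((\<lambda>b. b $ k) has_derivative (\<lambda>w. w $ k)) (at (c z))"
        by (rule bounded_linear_imp_has_derivative) (rule bounded_linear_vec_nth)
      then have "((\<lambda>b. x k (?inv b)) has_derivative (\<lambda>w. w $ k)) (at (c z))"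
      proof (rule has_derivative_transform_within_open[where s="ball a r"])
        show "c z \<in> ball a r" using Q(2)[OF z] r by auto
        show "b $ k = x k (?inv b)" if "b \<in> ball a r" for b
        proof -
          have "b \<in> c ` U" using that r by (auto simp: subset_iff)
          then show ?thesis using that r by (simp add: x_def inv_into_into f_inv_into_f ball_bump_eq_1)
        qed
      qed simp
      then have "?D (x k) (c z) = (\<lambda>w. w $ k)" by (rule frechet_derivative_at[symmetric])
      then show ?thesis using Q[OF z] x by (simp add: E_def axis_def)
    qed
    show "v f = (\<Sum>j\<in>UNIV. v (x j) * E j z f)"
      if z: "z \<in> Q" and v: "v \<in> tangent z" and f: "f \<in> smooth_functions" for z v f
    proof -
      let ?S = "ball a (3 * r)"
      have S: "?S \<subseteq> c ` U" using r(2) ball_subset_cball by blast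
      have cz: "c z \<in> ?S" "c z \<in> ball a r" using Q(2)[OF z] r by auto
      obtain h where h: "\<And>b. smooth_on ?S (h b)" "\<And>b. h b (c z) = ?D f (c z) b"
        "\<And>y. y \<in> ?S \<Longrightarrow> f (?inv y) = f (?inv (c z)) + (\<Sum>b\<in>Basis. ((y - c z) \<bullet> b) * h b y)"
        by (rule hadamard[OF open_ball convex_ball cz(1) smooth_on_subset[OF smooth_functionsD[OF f C(1)] S]]) blast
      have "open (U \<inter> c -` ball a r)" "z \<in> U \<inter> c -` ball a r"
        using chart_preimage_open[OF C(1) open_ball] Q[OF z] cz by auto
      then obtain \<kappa> where \<kappa>: "\<kappa> \<in> smooth_functions" "\<kappa> z = 1" "\<And>y. y \<notin> U \<inter> c -` ball a r \<Longrightarrow> \<kappa> y = 0"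
        by (rule bump_exists) blast
      \<comment> \<open>One of the two factors \<open>\<kappa>\<close> goes with the coefficients, the other with the coordinate
        differences.\<close>
      define A where "A j = (\<lambda>y. if y \<in> U then \<kappa> (?inv (c y)) * h (?e j) (c y) else 0)" for j
      have A: "A j \<in> smooth_functions" for j unfolding A_def
      proof (rule chart_push[OF C(1) open_ball _ compact_cball[of a r]])
        show "smooth_on ?S (\<lambda>b. \<kappa> (?inv b) * h (?e j) b)"
          by (intro smooth_on_mult open_ball h(1) smooth_on_subset[OF smooth_functionsD[OF \<kappa>(1) C(1)] S])
        show "cball a r \<subseteq> ?S" using r by auto
        show "cball a r \<subseteq> c ` U" using r by (auto simp: subset_iff)
        show "\<kappa> (?inv b) * h (?e j) b = 0" if "b \<in> c ` U - cball a r" for b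
          using \<kappa>(3)[of "?inv b"] that by (auto simp: f_inv_into_f)
      qed
      let ?R = "\<lambda>j y. \<kappa> y * (x j y - x j z)"
      have R: "?R j \<in> smooth_functions" for j by (intro smooth_mult smooth_diff \<kappa>(1) x smooth_const)
      have AR: "(\<lambda>y. A j y * ?R j y) \<in> smooth_functions" for j by (intro smooth_mult A R)
      have eq: "\<kappa> y * \<kappa> y * (f y - f z) = (\<Sum>j\<in>UNIV. A j y * ?R j y)" for y
      proof (cases "y \<in> U \<inter> c -` ball a r")
        case True
        have inv: "?inv (c y) = y" "?inv (c z) = z" using True Q[OF z] Ch(3) by auto
        have b1: "?\<beta> (c y) = 1" using True r by (intro ball_bump_eq_1) auto
        have "c y \<in> ?S" using True r by auto
        from h(3)[OF this] have "f y - f z = (\<Sum>j\<in>UNIV. (c y $ j - c z $ j) * h (?e j) (c y))"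
          by (simp add: inv sum_Basis_vec inner_axis)
        also have "\<dots> = (\<Sum>j\<in>UNIV. (x j y - x j z) * h (?e j) (c y))"
          using True Q[OF z] b1 by (simp add: x_def)
        finally show ?thesis using True by (simp add: A_def inv sum_distrib_left mult_ac)
      next
        case False
        then show ?thesis using \<kappa>(3)[OF False] by simp
      qed
      have "v (\<lambda>y. \<kappa> y * \<kappa> y * (f y - f z)) = v f"
        using tangent_mult[OF v smooth_mult[OF \<kappa>(1) \<kappa>(1)] smooth_diff[OF f smooth_const]]
          tangent_diff[OF v f smooth_const] tangent_const[OF v] \<kappa>(2) by simp
      moreover have "v (\<lambda>y. \<Sum>j\<in>UNIV. A j y * ?R j y) = (\<Sum>j\<in>UNIV. v (x j) * E j z f)"
      proof -
        have "v (\<lambda>y. A j y * ?R j y) = v (x j) * E j z f" for j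
        proof -
          have "v (?R j) = v (x j)"
            using tangent_mult[OF v \<kappa>(1) smooth_diff[OF x smooth_const]]
              tangent_diff[OF v x smooth_const] tangent_const[OF v] \<kappa>(2) by simp
          moreover have "A j z = E j z f"
            using Q[OF z] Ch(3) \<kappa>(2) f h(2) by (simp add: A_def E_def)
          ultimately show ?thesis using tangent_mult[OF v A R] by simp
        qed
        then show ?thesis using tangent_sum[OF v finite AR] by simp
      qed
      ultimately show ?thesis using eq by simp
    qed
  qed
qed

section \<open>Vector fields and alternating forms\<close>

lemma vf_tangent: "V \<in> vector_fields \<Longrightarrow> V x \<in> tangent x"
  by (simp add: vector_fields_def)

lemma vf_smooth: "V \<in> vector_fields \<Longrightarrow> f \<in> smooth_functions \<Longrightarrow> (\<lambda>x. V x f) \<in> smooth_functions"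
  by (simp add: vector_fields_def)

lemma lincomb_vf:
  assumes "f \<in> smooth_functions" "h \<in> smooth_functions" "V \<in> vector_fields" "W \<in> vector_fields"
  shows "(\<lambda>x. lincomb (f x) (V x) (h x) (W x)) \<in> vector_fields"
  unfolding vector_fields_def
proof (intro CollectI conjI allI ballI)
  show "lincomb (f x) (V x) (h x) (W x) \<in> tangent x" for x
    by (intro lincomb_tangent vf_tangent assms)
  show "(\<lambda>x. lincomb (f x) (V x) (h x) (W x) k) \<in> smooth_functions" if "k \<in> smooth_functions" for k
    unfolding lincomb_def by (intro smooth_add smooth_mult vf_smooth[OF assms(3)] vf_smooth[OF assms(4)] assms that)
qed

lemma zero_vf: "(\<lambda>x f. 0) \<in> vector_fields"
  by (simp add: vector_fields_def zero_tangent)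

lemma sum_vf:
  assumes "finite I" "\<And>i. i \<in> I \<Longrightarrow> c i \<in> smooth_functions" "\<And>i. i \<in> I \<Longrightarrow> E i \<in> vector_fields"
  shows "(\<lambda>x f. \<Sum>i\<in>I. c i x * E i x f) \<in> vector_fields"
  using assms
proof (induction I rule: finite_induct)
  case empty
  then show ?case by (simp add: zero_vf)
next
  case (insert a I)
  have "(\<lambda>x. lincomb (c a x) (E a x) 1 (\<lambda>f. \<Sum>i\<in>I. c i x * E i x f)) \<in> vector_fields"
    using insert by (intro lincomb_vf[where h="\<lambda>_. 1"]) auto
  then show ?case using insert.hyps by (simp add: lincomb_def)
qed

text \<open>
  The combination of the frame fields with the constant coefficients \<open>v (x j)\<close> takes the value
  \<open>v\<close> at \<open>y\<close>.
\<close>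

lemma vf_extension:
  assumes "v \<in> tangent y" obtains V where "V \<in> vector_fields" "V y = v"
proof -
  obtain N Q and x :: "'n \<Rightarrow> 'a \<Rightarrow> real" and E :: "'n \<Rightarrow> 'a vfield" where F: "y \<in> N" "N \<subseteq> Q" "\<And>j. E j \<in> vector_fields"
    "\<And>z v f. z \<in> Q \<Longrightarrow> v \<in> tangent z \<Longrightarrow> f \<in> smooth_functions \<Longrightarrow> v f = (\<Sum>j\<in>UNIV. v (x j) * E j z f)"
    by (rule local_frame[of y]) blast
  let ?V = "\<lambda>z f. \<Sum>j\<in>UNIV. v (x j) * E j z f"
  have "?V \<in> vector_fields"
    using sum_vf[of UNIV "\<lambda>j _. v (x j)" E] F(3) by simp
  moreover have "?V y f = v f" for f
  proof (cases "f \<in> smooth_functions")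
    case True
    then show ?thesis using F(1,2) F(4)[OF _ assms True] by auto
  next
    case False
    have "E j y f = 0" for j by (rule tangent_nonsmooth[OF vf_tangent[OF F(3)] False])
    then show ?thesis using tangent_nonsmooth[OF assms False] by simp
  qed
  ultimately show thesis using that[of ?V] by (auto simp: fun_eq_iff)
qed

lemma bracket_vf:
  assumes V: "V \<in> vector_fields" and W: "W \<in> vector_fields"
  shows "bracket V W \<in> vector_fields"
  unfolding vector_fields_def
proof (intro CollectI conjI allI ballI)
  fix x
  have T: "V x \<in> tangent x" "W x \<in> tangent x" by (intro vf_tangent V W)+
  note [simp] = vf_smooth[OF V] vf_smooth[OF W]
  show "bracket V W x \<in> tangent x"
    unfolding tangent_def
  proof (intro CollectI conjI ballI allI impI)
    fix f h a b assume fh: "f \<in> smooth_functions" "h \<in> smooth_functions"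
    have "(\<lambda>y. W y (\<lambda>y. a * f y + b * h y)) = (\<lambda>y. a * W y f + b * W y h)"
      "(\<lambda>y. V y (\<lambda>y. a * f y + b * h y)) = (\<lambda>y. a * V y f + b * V y h)"
      using tangent_linear[OF vf_tangent[OF V] fh] tangent_linear[OF vf_tangent[OF W] fh] by auto
    then show "bracket V W x (\<lambda>y. a * f y + b * h y) = a * bracket V W x f + b * bracket V W x h"
      unfolding bracket_def
      using fh by (simp add: tangent_linear[OF T(1)] tangent_linear[OF T(2)] algebra_simps)
  next
    fix f h assume fh: "f \<in> smooth_functions" "h \<in> smooth_functions"
    have "(\<lambda>y. W y (\<lambda>y. f y * h y)) = (\<lambda>y. W y f * h y + f y * W y h)"
      "(\<lambda>y. V y (\<lambda>y. f y * h y)) = (\<lambda>y. V y f * h y + f y * V y h)"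
      using tangent_mult[OF vf_tangent[OF V] fh] tangent_mult[OF vf_tangent[OF W] fh] by auto
    then show "bracket V W x (\<lambda>y. f y * h y) = bracket V W x f * h x + f x * bracket V W x h"
      unfolding bracket_def
      using fh by (simp add: tangent_add[OF T(1)] tangent_add[OF T(2)] smooth_mult
          tangent_mult[OF T(1)] tangent_mult[OF T(2)] algebra_simps)
  next
    fix f assume f: "f \<notin> smooth_functions"
    have "(\<lambda>y. V y f) = (\<lambda>_. 0)" "(\<lambda>y. W y f) = (\<lambda>_. 0)"
      using tangent_nonsmooth[OF vf_tangent[OF V] f] tangent_nonsmooth[OF vf_tangent[OF W] f] by auto
    then show "bracket V W x f = 0"
      by (simp add: bracket_def tangent_const[OF T(1)] tangent_const[OF T(2)])
  qed
next
  show "(\<lambda>x. bracket V W x f) \<in> smooth_functions" if "f \<in> smooth_functions" for f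
    unfolding bracket_def by (intro smooth_diff vf_smooth[OF V] vf_smooth[OF W] that)
qed

lemma alt_lin:
  "alternating_form_at q x \<omega> \<Longrightarrow> length vs = q \<Longrightarrow> set vs \<subseteq> tangent x \<Longrightarrow> i < q \<Longrightarrow>
    v \<in> tangent x \<Longrightarrow> w \<in> tangent x \<Longrightarrow>
    \<omega> (vs[i := lincomb a v b w]) = a * \<omega> (vs[i := v]) + b * \<omega> (vs[i := w])"
  unfolding alternating_form_at_def by blast

lemma alt_eq:
  "alternating_form_at q x \<omega> \<Longrightarrow> length vs = q \<Longrightarrow> set vs \<subseteq> tangent x \<Longrightarrow> i < q \<Longrightarrow> j < q \<Longrightarrow> i \<noteq> j \<Longrightarrow>
    vs ! i = vs ! j \<Longrightarrow> \<omega> vs = 0"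
  unfolding alternating_form_at_def by (metis nat_neq_iff)

lemma alt_out:
  "alternating_form_at q x \<omega> \<Longrightarrow> \<not> (length vs = q \<and> set vs \<subseteq> tangent x) \<Longrightarrow> \<omega> vs = 0"
  unfolding alternating_form_at_def by blast

text \<open>
  The form vanishes on every list with \<open>v + w\<close> in both slots; expand.
\<close>

lemma alt_swap:
  assumes \<omega>: "alternating_form_at q x \<omega>" and vs: "length vs = q" "set vs \<subseteq> tangent x"
    and ij: "i < q" "j < q" "i \<noteq> j" and vw: "v \<in> tangent x" "w \<in> tangent x"
  shows "\<omega> (vs[i := v, j := w]) = - \<omega> (vs[i := w, j := v])"
proof -
  let ?u = "lincomb 1 v 1 w"
  have u: "?u \<in> tangent x" by (rule lincomb_tangent[OF vw])
  have exp: "\<omega> (vs[i := s, j := ?u]) = \<omega> (vs[i := s, j := v]) + \<omega> (vs[i := s, j := w])"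
    if "s \<in> tangent x" for s
    using alt_lin[OF \<omega> _ set_update_subsetI[OF vs(2) that] ij(2) vw, of i 1 1] vs by simp
  have exp': "\<omega> (vs[i := ?u, j := s]) = \<omega> (vs[i := v, j := s]) + \<omega> (vs[i := w, j := s])"
    if "s \<in> tangent x" for s
    using alt_lin[OF \<omega> _ set_update_subsetI[OF vs(2) that] ij(1) vw, of j 1 1] vs
    by (simp add: list_update_swap[OF ij(3)])
  have z: "\<omega> (vs[i := s, j := s]) = 0" if "s \<in> tangent x" for s
  proof (rule alt_eq[OF \<omega> _ _ ij])
    show "set (vs[i := s, j := s]) \<subseteq> tangent x" by (intro set_update_subsetI vs that)
  qed (use vs ij in auto)
  show ?thesis using exp[OF u] exp'[OF vw(1)] exp'[OF vw(2)] z[OF u] z[OF vw(1)] z[OF vw(2)] by simp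
qed

lemma alt_Cons:
  assumes \<omega>: "alternating_form_at (Suc q) x \<omega>" and u: "u \<in> tangent x"
  shows "alternating_form_at q x (\<lambda>vs. \<omega> (u # vs))"
  unfolding alternating_form_at_def
proof (intro conjI allI impI)
  fix vs i v w a b
  assume "length vs = q" "set vs \<subseteq> tangent x" "i < q" "v \<in> tangent x" "w \<in> tangent x"
  then show "\<omega> (u # vs[i := lincomb a v b w]) = a * \<omega> (u # vs[i := v]) + b * \<omega> (u # vs[i := w])"
    using alt_lin[OF \<omega>, of "u # vs" "Suc i" v w a b] u by simp
next
  fix vs i j
  assume "length vs = q" "set vs \<subseteq> tangent x" "i < j" "j < q" "vs ! i = vs ! j"
  then show "\<omega> (u # vs) = 0"
    using alt_eq[OF \<omega>, of "u # vs" "Suc i" "Suc j"] u by simp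
next
  fix vs assume "\<not> (length vs = q \<and> set vs \<subseteq> tangent x)"
  then show "\<omega> (u # vs) = 0"
    using alt_out[OF \<omega>, of "u # vs"] by auto
qed

lemma remove_nth_0 [simp]: "remove_nth 0 (v # vs) = vs"
  and remove_nth_Suc [simp]: "remove_nth (Suc i) (v # vs) = v # remove_nth i vs"
  by (simp_all add: remove_nth_def)

lemma length_remove_nth: "i < length vs \<Longrightarrow> length (remove_nth i vs) = length vs - 1"
  by (simp add: remove_nth_def)

lemma set_remove_nth: "set (remove_nth i vs) \<subseteq> set vs"
  by (auto simp: remove_nth_def dest: in_set_takeD in_set_dropD)

lemma map_remove_nth: "map f (remove_nth i vs) = remove_nth i (map f vs)"
  by (simp add: remove_nth_def take_map drop_map)

text \<open>
  The new first entry is moved past \<open>k\<close> others.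
\<close>

lemma alt_move:
  assumes "alternating_form_at q x \<omega>" "length vs = q" "set vs \<subseteq> tangent x" "k < q" "v \<in> tangent x"
  shows "\<omega> (v # remove_nth k vs) = (-1) ^ k * \<omega> (vs[k := v])"
  using assms
proof (induction k arbitrary: q \<omega> vs)
  case 0
  then show ?case by (cases vs) auto
next
  case (Suc k)
  then obtain w ws where vs: "vs = w # ws" by (cases vs) auto
  then obtain m where q: "q = Suc m" using Suc.prems(2) by auto
  have w: "w \<in> tangent x" and ws: "length ws = m" "set ws \<subseteq> tangent x" "k < m" using Suc.prems vs q by auto
  have alt: "alternating_form_at m x (\<lambda>us. \<omega> (w # us))" using alt_Cons Suc.prems(1) w q by blast
  have rem: "length (remove_nth k ws) = m - 1" "set (remove_nth k ws) \<subseteq> tangent x"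
    using ws length_remove_nth set_remove_nth[of k ws] by auto
  have "\<omega> (v # w # remove_nth k ws) = - \<omega> (w # v # remove_nth k ws)"
    using alt_swap[OF Suc.prems(1), of "v # w # remove_nth k ws" 0 1 v w] rem ws w Suc.prems(5) q by simp
  also have "\<dots> = - ((-1) ^ k * \<omega> (w # ws[k := v]))"
    using Suc.IH[OF alt ws Suc.prems(5)] by simp
  finally show ?case by (simp add: vs)
qed

lemma form_alt: "\<omega> \<in> smooth_forms q \<Longrightarrow> alternating_form_at q x (\<omega> x)"
  by (simp add: smooth_forms_def)

lemma form_smooth:
  "\<omega> \<in> smooth_forms q \<Longrightarrow> length Vs = q \<Longrightarrow> set Vs \<subseteq> vector_fields \<Longrightarrow> apply_form \<omega> Vs \<in> smooth_functions"
  by (simp add: smooth_forms_def)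

lemma map_vf_tangent: "set Vs \<subseteq> vector_fields \<Longrightarrow> set (map (\<lambda>V. V x) Vs) \<subseteq> tangent x"
  by (auto simp: vf_tangent)

lemma map_tangent_ext:
  assumes "set vs \<subseteq> tangent x"
  obtains Vs where "set Vs \<subseteq> vector_fields" "length Vs = length vs" "map (\<lambda>V. V x) Vs = vs"
proof -
  have "\<exists>Vs. set Vs \<subseteq> vector_fields \<and> length Vs = length vs \<and> map (\<lambda>V. V x) Vs = vs"
    using assms
  proof (induction vs)
    case (Cons v vs)
    obtain V where "V \<in> vector_fields" "V x = v" using vf_extension[of v x] Cons.prems by auto
    moreover obtain Vs where "set Vs \<subseteq> vector_fields" "length Vs = length vs" "map (\<lambda>V. V x) Vs = vs"
      using Cons by auto
    ultimately show ?case by (intro exI[of _ "V # Vs"]) auto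
  qed auto
  then show thesis using that by blast
qed

lemma form_eqI:
  assumes "\<And>x. alternating_form_at q x (\<omega> x)" "\<And>x. alternating_form_at q x (\<eta> x)"
    "\<And>Vs. length Vs = q \<Longrightarrow> set Vs \<subseteq> vector_fields \<Longrightarrow> apply_form \<omega> Vs = apply_form \<eta> Vs"
  shows "\<omega> = \<eta>"
proof (intro ext)
  fix x vs
  show "\<omega> x vs = \<eta> x vs"
  proof (cases "length vs = q \<and> set vs \<subseteq> tangent x")
    case True
    then obtain Vs where Vs: "set Vs \<subseteq> vector_fields" "length Vs = q" "map (\<lambda>V. V x) Vs = vs"
      by (metis map_tangent_ext)
    then show ?thesis using assms(3)[of Vs] by (metis apply_form_def)
  next
    case False
    then show ?thesis using alt_out assms(1,2) by metis
  qed
qed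

definition interior_product :: "'a vfield \<Rightarrow> 'a form \<Rightarrow> 'a form" where
  "interior_product V \<omega> = (\<lambda>x vs. \<omega> x (V x # vs))"

lemma apply_interior_product: "apply_form (interior_product V \<omega>) Vs = apply_form \<omega> (V # Vs)"
  by (simp add: apply_form_def interior_product_def fun_eq_iff)

lemma interior_product_form:
  assumes "\<omega> \<in> smooth_forms (Suc q)" "V \<in> vector_fields" shows "interior_product V \<omega> \<in> smooth_forms q"
  unfolding smooth_forms_def
proof (intro CollectI conjI allI impI)
  show "alternating_form_at q x (interior_product V \<omega> x)" for x
    unfolding interior_product_def by (rule alt_Cons[OF form_alt[OF assms(1)] vf_tangent[OF assms(2)]])
  show "apply_form (interior_product V \<omega>) Vs \<in> smooth_functions" if "length Vs = q" "set Vs \<subseteq> vector_fields" for Vs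
    unfolding apply_interior_product using form_smooth[OF assms(1), of "V # Vs"] assms(2) that by simp
qed

lemma form_lincomb:
  assumes "\<omega> \<in> smooth_forms q" "\<eta> \<in> smooth_forms q" "f \<in> smooth_functions" "h \<in> smooth_functions"
  shows "(\<lambda>x vs. f x * \<omega> x vs + h x * \<eta> x vs) \<in> smooth_forms q"
  unfolding smooth_forms_def
proof (intro CollectI conjI allI impI)
  fix x
  note A = form_alt[OF assms(1), of x] and B = form_alt[OF assms(2), of x]
  show "alternating_form_at q x (\<lambda>vs. f x * \<omega> x vs + h x * \<eta> x vs)"
    unfolding alternating_form_at_def
  proof (intro conjI allI impI)
    fix vs i j
    assume "length vs = q" "set vs \<subseteq> tangent x" "i < j" "j < q" "vs ! i = vs ! j"
    then show "f x * \<omega> x vs + h x * \<eta> x vs = 0"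
      using alt_eq[OF A, of vs i j] alt_eq[OF B, of vs i j] by simp
  qed (simp_all add: alt_lin[OF A] alt_lin[OF B] alt_out[OF A] alt_out[OF B] algebra_simps)
next
  fix Vs :: "'a vfield list" assume "length Vs = q" "set Vs \<subseteq> vector_fields"
  then have "(\<lambda>x. f x * apply_form \<omega> Vs x + h x * apply_form \<eta> Vs x) \<in> smooth_functions"
    by (intro smooth_add smooth_mult form_smooth[OF assms(1)] form_smooth[OF assms(2)] assms)
  then show "apply_form (\<lambda>x vs. f x * \<omega> x vs + h x * \<eta> x vs) Vs \<in> smooth_functions"
    by (simp add: apply_form_def[abs_def])
qed

lemma form_mult:
  assumes "\<omega> \<in> smooth_forms q" "f \<in> smooth_functions"
  shows "(\<lambda>x vs. f x * \<omega> x vs) \<in> smooth_forms q"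
  using form_lincomb[OF assms(1) assms(1) assms(2) smooth_const[of 0]] by simp

lemma apply_form_lincomb:
  assumes "\<omega> \<in> smooth_forms q" "length Vs = q" "set Vs \<subseteq> vector_fields" "i < q"
    "A x \<in> tangent x" "B x \<in> tangent x" "X x = lincomb a (A x) b (B x)"
  shows "apply_form \<omega> (Vs[i := X]) x = a * apply_form \<omega> (Vs[i := A]) x + b * apply_form \<omega> (Vs[i := B]) x"
  using alt_lin[OF form_alt[OF assms(1), of x], of "map (\<lambda>V. V x) Vs" i "A x" "B x" a b] map_vf_tangent[OF assms(3)] assms
  by (simp add: apply_form_def map_update)

lemma apply_form_eq_0:
  assumes "\<omega> \<in> smooth_forms q" "length Vs = q" "set Vs \<subseteq> vector_fields" "i < q" "j < q" "i \<noteq> j"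
    "(Vs ! i) x = (Vs ! j) x"
  shows "apply_form \<omega> Vs x = 0"
  unfolding apply_form_def
  by (rule alt_eq[OF form_alt[OF assms(1), of x], where i=i and j=j]) (use assms map_vf_tangent in auto)

lemma apply_form_swap:
  assumes "\<omega> \<in> smooth_forms q" "length Vs = q" "set Vs \<subseteq> vector_fields" "i < q" "j < q" "i \<noteq> j"
    "V \<in> vector_fields" "W \<in> vector_fields"
  shows "apply_form \<omega> (Vs[i := V, j := W]) x = - apply_form \<omega> (Vs[i := W, j := V]) x"
  using alt_swap[OF form_alt[OF assms(1), of x] _ map_vf_tangent[OF assms(3)] assms(4-6), of "V x" "W x"] assms vf_tangent
  by (simp add: apply_form_def map_update)

lemma apply_form_move:
  assumes "\<omega> \<in> smooth_forms q" "length Vs = q" "set Vs \<subseteq> vector_fields" "k < q" "V \<in> vector_fields"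
  shows "apply_form \<omega> (V # remove_nth k Vs) x = (-1) ^ k * apply_form \<omega> (Vs[k := V]) x"
  using alt_move[OF form_alt[OF assms(1), of x] _ map_vf_tangent[OF assms(3)] assms(4), of "V x"] assms vf_tangent
  by (simp add: apply_form_def map_update map_remove_nth)

section \<open>Tensoriality\<close>

text \<open>
  The algebraic properties of \<open>Vs \<mapsto> apply_form \<omega> Vs\<close> for a smooth form \<open>\<omega>\<close>; they characterise
  such operations by \<open>tensorial_form\<close>.
\<close>

definition tensorial :: "nat \<Rightarrow> ('a vfield list \<Rightarrow> 'a \<Rightarrow> real) \<Rightarrow> bool" where
  "tensorial q \<Phi> \<longleftrightarrow>
    (\<forall>Vs. length Vs = q \<longrightarrow> set Vs \<subseteq> vector_fields \<longrightarrow> \<Phi> Vs \<in> smooth_functions) \<and>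
    (\<forall>Vs i V W f h x. length Vs = q \<longrightarrow> set Vs \<subseteq> vector_fields \<longrightarrow> i < q \<longrightarrow>
      V \<in> vector_fields \<longrightarrow> W \<in> vector_fields \<longrightarrow> f \<in> smooth_functions \<longrightarrow> h \<in> smooth_functions \<longrightarrow>
      \<Phi> (Vs[i := (\<lambda>y. lincomb (f y) (V y) (h y) (W y))]) x = f x * \<Phi> (Vs[i := V]) x + h x * \<Phi> (Vs[i := W]) x) \<and>
    (\<forall>Vs i j x. length Vs = q \<longrightarrow> set Vs \<subseteq> vector_fields \<longrightarrow> i < j \<longrightarrow> j < q \<longrightarrow> Vs ! i = Vs ! j \<longrightarrow> \<Phi> Vs x = 0)"

lemma tensorial_smooth:
  "tensorial q \<Phi> \<Longrightarrow> length Vs = q \<Longrightarrow> set Vs \<subseteq> vector_fields \<Longrightarrow> \<Phi> Vs \<in> smooth_functions"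
  unfolding tensorial_def by blast

lemma tensorial_lin:
  "tensorial q \<Phi> \<Longrightarrow> length Vs = q \<Longrightarrow> set Vs \<subseteq> vector_fields \<Longrightarrow> i < q \<Longrightarrow>
    V \<in> vector_fields \<Longrightarrow> W \<in> vector_fields \<Longrightarrow> f \<in> smooth_functions \<Longrightarrow> h \<in> smooth_functions \<Longrightarrow>
    \<Phi> (Vs[i := (\<lambda>y. lincomb (f y) (V y) (h y) (W y))]) x = f x * \<Phi> (Vs[i := V]) x + h x * \<Phi> (Vs[i := W]) x"
  unfolding tensorial_def by blast

lemma tensorial_eq_0:
  "tensorial q \<Phi> \<Longrightarrow> length Vs = q \<Longrightarrow> set Vs \<subseteq> vector_fields \<Longrightarrow> i < j \<Longrightarrow> j < q \<Longrightarrow> Vs ! i = Vs ! j \<Longrightarrow> \<Phi> Vs x = 0"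
  unfolding tensorial_def by blast

lemma tensorial_sum:
  assumes \<Phi>: "tensorial q \<Phi>" "length Vs = q" "set Vs \<subseteq> vector_fields" "i < q"
    and "finite I" "\<And>j. j \<in> I \<Longrightarrow> c j \<in> smooth_functions" "\<And>j. j \<in> I \<Longrightarrow> E j \<in> vector_fields"
  shows "\<Phi> (Vs[i := (\<lambda>y f. \<Sum>j\<in>I. c j y * E j y f)]) x = (\<Sum>j\<in>I. c j x * \<Phi> (Vs[i := E j]) x)"
  using assms(5-)
proof (induction I rule: finite_induct)
  case empty
  have "(\<lambda>y. lincomb 0 (\<lambda>f. 0) 0 (\<lambda>f. 0)) = ((\<lambda>y f. 0) :: 'a vfield)" by (simp add: lincomb_def)
  then show ?case
    using tensorial_lin[OF \<Phi> zero_vf zero_vf smooth_const[of 0] smooth_const[of 0], of x] by simp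
next
  case (insert a I)
  let ?S = "\<lambda>y f. \<Sum>j\<in>I. c j y * E j y f"
  have eq: "(\<lambda>y f. \<Sum>j\<in>insert a I. c j y * E j y f) = (\<lambda>y. lincomb (c a y) (E a y) 1 (?S y))"
    using insert.hyps by (simp add: lincomb_def)
  have S: "?S \<in> vector_fields" using insert by (intro sum_vf) auto
  show ?case unfolding eq
    using tensorial_lin[OF \<Phi> _ S _ smooth_const[of 1], of "E a" "c a" x] insert by simp
qed

text \<open>
  Multiplied by a bump function, \<open>W\<close> is a combination of the frame fields with smooth
  coefficients that vanish at \<open>y\<close>, and linearity over the smooth functions takes the
  coefficients out.
\<close>

lemma tensorial_vanish:
  assumes \<Phi>: "tensorial q \<Phi>" "length Vs = q" "set Vs \<subseteq> vector_fields" "i < q"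
    and W: "W \<in> vector_fields" "W y = (\<lambda>f. 0)"
  shows "\<Phi> (Vs[i := W]) y = 0"
proof -
  obtain N Q and x :: "'n \<Rightarrow> 'a \<Rightarrow> real" and E :: "'n \<Rightarrow> 'a vfield" where
    F: "open N" "y \<in> N" "N \<subseteq> Q" "\<And>j. x j \<in> smooth_functions" "\<And>j. E j \<in> vector_fields"
    "\<And>z v f. z \<in> Q \<Longrightarrow> v \<in> tangent z \<Longrightarrow> f \<in> smooth_functions \<Longrightarrow> v f = (\<Sum>j\<in>UNIV. v (x j) * E j z f)"
    by (rule local_frame[of y]) blast
  obtain \<kappa> where \<kappa>: "\<kappa> \<in> smooth_functions" "\<kappa> y = 1" "\<And>z. z \<notin> N \<Longrightarrow> \<kappa> z = 0"
    by (rule bump_exists[OF F(1,2)]) blast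
  let ?c = "\<lambda>j z. \<kappa> z * W z (x j)"
  have eq: "(\<lambda>z. lincomb (\<kappa> z) (W z) 0 (W z)) = (\<lambda>z f. \<Sum>j\<in>UNIV. ?c j z * E j z f)"
  proof (intro ext)
    fix z f
    show "lincomb (\<kappa> z) (W z) 0 (W z) f = (\<Sum>j\<in>UNIV. ?c j z * E j z f)"
    proof (cases "z \<in> N \<and> f \<in> smooth_functions")
      case True
      then have "W z f = (\<Sum>j\<in>UNIV. W z (x j) * E j z f)"
        using F(3) F(6)[OF _ vf_tangent[OF W(1)]] by blast
      then show ?thesis by (simp add: lincomb_def sum_distrib_left mult.assoc)
    next
      case False
      then show ?thesis
        using \<kappa>(3) tangent_nonsmooth[OF vf_tangent[OF W(1)]] tangent_nonsmooth[OF vf_tangent[OF F(5)]]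
        by (cases "z \<in> N") (auto simp: lincomb_def)
    qed
  qed
  have c: "?c j \<in> smooth_functions" for j by (intro smooth_mult vf_smooth[OF W(1)] \<kappa>(1) F)
  have "\<Phi> (Vs[i := W]) y = \<Phi> (Vs[i := (\<lambda>z. lincomb (\<kappa> z) (W z) 0 (W z))]) y"
    using tensorial_lin[OF \<Phi> W(1) W(1) \<kappa>(1) smooth_const[of 0], of y] \<kappa>(2) by simp
  also have "\<dots> = 0"
    unfolding eq using tensorial_sum[OF \<Phi> finite_class.finite_UNIV c F(5), where x=y] W(2) by simp
  finally show ?thesis .
qed

lemma tensorial_pointwise1:
  assumes \<Phi>: "tensorial q \<Phi>" "length Vs = q" "set Vs \<subseteq> vector_fields" "i < q"
    and VW: "V \<in> vector_fields" "W \<in> vector_fields" "V y = W y"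
  shows "\<Phi> (Vs[i := V]) y = \<Phi> (Vs[i := W]) y"
proof -
  have "(\<lambda>z. lincomb 1 (V z) (-1) (W z)) \<in> vector_fields"
    by (intro lincomb_vf[of "\<lambda>_. 1" "\<lambda>_. -1"] smooth_const VW)
  from tensorial_vanish[OF \<Phi> this] have "\<Phi> (Vs[i := (\<lambda>z. lincomb 1 (V z) (-1) (W z))]) y = 0"
    using VW(3) by (simp add: lincomb_def)
  then show ?thesis
    using tensorial_lin[OF \<Phi> VW(1,2) smooth_const[of 1] smooth_const[of "-1"], of y] by simp
qed

lemma tensorial_pointwise:
  assumes \<Phi>: "tensorial q \<Phi>" and Vs: "length Vs = q" "set Vs \<subseteq> vector_fields"
    and Ws: "length Ws = q" "set Ws \<subseteq> vector_fields" and eq: "map (\<lambda>V. V y) Vs = map (\<lambda>V. V y) Ws"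
  shows "\<Phi> Vs y = \<Phi> Ws y"
proof -
  have "\<Phi> (take k Ws @ drop k Vs) y = \<Phi> Vs y" if "k \<le> q" for k
    using that
  proof (induction k)
    case (Suc k)
    then have k: "k < q" by simp
    let ?L = "take k Ws @ drop k Vs"
    have L: "length ?L = q" "set ?L \<subseteq> vector_fields"
      using k Vs Ws by (auto dest: in_set_takeD in_set_dropD)
    have "Vs ! k \<in> vector_fields" "Ws ! k \<in> vector_fields"
      using k Vs Ws by (metis nth_mem subsetD)+
    moreover have "(Ws ! k) y = (Vs ! k) y"
      using arg_cong[OF eq, of "\<lambda>l. l ! k"] k Vs Ws by simp
    ultimately have "\<Phi> (?L[k := Ws ! k]) y = \<Phi> (?L[k := Vs ! k]) y"
      using tensorial_pointwise1[OF \<Phi> L k] by blast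
    moreover have "?L[k := Vs ! k] = ?L" using k Vs Ws by (intro list_update_same_conv[THEN iffD2]) (auto simp: nth_append)
    moreover have "?L[k := Ws ! k] = take (Suc k) Ws @ drop (Suc k) Vs"
      using k Vs Ws by (simp add: list_update_append take_Suc_conv_app_nth upd_conv_take_nth_drop)
    ultimately show ?case using Suc k by simp
  qed simp
  from this[of q] show ?thesis using Vs Ws by simp
qed

text \<open>
  By \<open>tensorial_pointwise\<close> the value of \<open>\<Phi>\<close> at a point depends only on the values of the vector
  fields there, and every list of tangent vectors is the list of values of some vector fields.
\<close>

theorem tensorial_form:
  assumes \<Phi>: "tensorial q \<Phi>"
  obtains \<omega> where "\<omega> \<in> smooth_forms q"
    "\<And>Vs. length Vs = q \<Longrightarrow> set Vs \<subseteq> vector_fields \<Longrightarrow> apply_form \<omega> Vs = \<Phi> Vs"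
proof -
  define ext where "ext x v = (SOME V. V \<in> vector_fields \<and> V x = v)" for x v
  have ext: "ext x v \<in> vector_fields" "ext x v x = v" if "v \<in> tangent x" for x v
    using someI_ex[of "\<lambda>V. V \<in> vector_fields \<and> V x = v"] vf_extension[OF that] unfolding ext_def by metis+
  have exts: "set (map (ext x) vs) \<subseteq> vector_fields" "map (\<lambda>V. V x) (map (ext x) vs) = vs"
    if "set vs \<subseteq> tangent x" for x vs
    using ext that by (auto intro!: map_idI)
  define \<omega> where "\<omega> x vs = (if length vs = q \<and> set vs \<subseteq> tangent x then \<Phi> (map (ext x) vs) x else 0)" for x vs
  have \<omega>: "\<omega> x (map (\<lambda>V. V x) Vs) = \<Phi> Vs x" if "length Vs = q" "set Vs \<subseteq> vector_fields" for x Vs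
  proof -
    have T: "set (map (\<lambda>V. V x) Vs) \<subseteq> tangent x" by (rule map_vf_tangent[OF that(2)])
    have "\<Phi> (map (ext x) (map (\<lambda>V. V x) Vs)) x = \<Phi> Vs x"
      by (rule tensorial_pointwise[OF \<Phi>]) (use exts[OF T] that in auto)
    then show ?thesis using T that by (simp add: \<omega>_def)
  qed
  have "alternating_form_at q x (\<omega> x)" for x
    unfolding alternating_form_at_def
  proof (intro conjI allI impI)
    fix vs i v w a b
    assume vs: "length vs = q" "set vs \<subseteq> tangent x" "i < q" and vw: "v \<in> tangent x" "w \<in> tangent x"
    obtain Vs where Vs: "set Vs \<subseteq> vector_fields" "length Vs = q" "map (\<lambda>V. V x) Vs = vs"
      using map_tangent_ext[OF vs(2)] vs(1) by metis
    obtain V W where VW: "V \<in> vector_fields" "V x = v" "W \<in> vector_fields" "W x = w"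
      using vf_extension vw by metis
    have upd: "\<omega> x (vs[i := X x]) = \<Phi> (Vs[i := X]) x" if "X \<in> vector_fields" for X
      using \<omega>[of "Vs[i := X]" x] Vs set_update_subsetI[OF Vs(1) that] by (simp add: map_update)
    have "(\<lambda>y. lincomb a (V y) b (W y)) \<in> vector_fields"
      by (intro lincomb_vf[of "\<lambda>_. a" "\<lambda>_. b"] smooth_const VW)
    from upd[OF this] upd[OF VW(1)] upd[OF VW(3)]
    show "\<omega> x (vs[i := lincomb a v b w]) = a * \<omega> x (vs[i := v]) + b * \<omega> x (vs[i := w])"
      using tensorial_lin[OF \<Phi> Vs(2,1) vs(3) VW(1,3) smooth_const smooth_const, of a b x] VW by simp
  next
    fix vs i j assume vs: "length vs = q" "set vs \<subseteq> tangent x" "i < j" "j < q" "vs ! i = vs ! j"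
    have "\<Phi> (map (ext x) vs) x = 0"
      by (rule tensorial_eq_0[OF \<Phi>, of _ i j]) (use vs exts[OF vs(2)] in auto)
    then show "\<omega> x vs = 0" by (simp add: \<omega>_def)
  qed (auto simp: \<omega>_def)
  moreover have app: "apply_form \<omega> Vs = \<Phi> Vs" if "length Vs = q" "set Vs \<subseteq> vector_fields" for Vs
    using \<omega>[OF that] by (auto simp: apply_form_def)
  ultimately have "\<omega> \<in> smooth_forms q"
    using tensorial_smooth[OF \<Phi>] by (simp add: smooth_forms_def)
  then show thesis using app that by blast
qed

lemma tensorial_cong:
  assumes "tensorial q \<Phi>" "\<And>Vs x. length Vs = q \<Longrightarrow> set Vs \<subseteq> vector_fields \<Longrightarrow> \<Phi> Vs x = \<Psi> Vs x"
  shows "tensorial q \<Psi>"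
  unfolding tensorial_def
proof (intro conjI allI impI)
  fix Vs :: "'a vfield list" assume Vs: "length Vs = q" "set Vs \<subseteq> vector_fields"
  have "\<Psi> Vs = \<Phi> Vs" using assms(2)[OF Vs] by auto
  then show "\<Psi> Vs \<in> smooth_functions" using tensorial_smooth[OF assms(1) Vs] by simp
next
  fix Vs :: "'a vfield list" and i V W f h x
  assume Vs: "length Vs = q" "set Vs \<subseteq> vector_fields" "i < q" "V \<in> vector_fields" "W \<in> vector_fields"
    "f \<in> smooth_functions" "h \<in> smooth_functions"
  have "\<Psi> (Vs[i := X]) x = \<Phi> (Vs[i := X]) x" if "X \<in> vector_fields" for X
    using assms(2)[of "Vs[i := X]" x] Vs(1) set_update_subsetI[OF Vs(2) that] by simp
  with tensorial_lin[OF assms(1) Vs, of x] lincomb_vf[OF Vs(6,7,4,5)] Vs(4,5)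
  show "\<Psi> (Vs[i := (\<lambda>y. lincomb (f y) (V y) (h y) (W y))]) x = f x * \<Psi> (Vs[i := V]) x + h x * \<Psi> (Vs[i := W]) x"
    by simp
next
  fix Vs :: "'a vfield list" and i j x
  assume Vs: "length Vs = q" "set Vs \<subseteq> vector_fields" "i < j" "j < q" "Vs ! i = Vs ! j"
  show "\<Psi> Vs x = 0" using tensorial_eq_0[OF assms(1) Vs, of x] assms(2)[OF Vs(1,2)] by simp
qed

lemma tensorial_diff:
  assumes "tensorial q \<Phi>" "tensorial q \<Psi>"
  shows "tensorial q (\<lambda>Vs x. \<Phi> Vs x - \<Psi> Vs x)"
  unfolding tensorial_def
proof (intro conjI allI impI)
  fix Vs :: "'a vfield list" assume Vs: "length Vs = q" "set Vs \<subseteq> vector_fields"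
  show "(\<lambda>x. \<Phi> Vs x - \<Psi> Vs x) \<in> smooth_functions"
    by (intro smooth_diff tensorial_smooth[OF assms(1) Vs] tensorial_smooth[OF assms(2) Vs])
qed (simp_all add: tensorial_lin[OF assms(1)] tensorial_lin[OF assms(2)] tensorial_eq_0[OF assms(1)]
    tensorial_eq_0[OF assms(2)] algebra_simps)

text \<open>
  Antisymmetry is inherited from the form that represents \<open>\<Phi>\<close>.
\<close>

lemma tensorial_swap:
  assumes \<Phi>: "tensorial q \<Phi>" and Vs: "length Vs = q" "set Vs \<subseteq> vector_fields"
    and ij: "i < q" "j < q" "i \<noteq> j" and VW: "V \<in> vector_fields" "W \<in> vector_fields"
  shows "\<Phi> (Vs[i := V, j := W]) x = - \<Phi> (Vs[i := W, j := V]) x"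
proof -
  obtain \<omega> where \<omega>: "\<omega> \<in> smooth_forms q"
    "\<And>Vs. length Vs = q \<Longrightarrow> set Vs \<subseteq> vector_fields \<Longrightarrow> apply_form \<omega> Vs = \<Phi> Vs"
    by (rule tensorial_form[OF \<Phi>]) blast
  have "set (Vs[i := V, j := W]) \<subseteq> vector_fields" "set (Vs[i := W, j := V]) \<subseteq> vector_fields"
    by (intro set_update_subsetI Vs VW)+
  then show ?thesis
    using apply_form_swap[OF \<omega>(1) Vs ij VW, of x] \<omega>(2) Vs(1) by simp
qed

section \<open>The exterior derivative\<close>

definition lie_derivative :: "'a vfield \<Rightarrow> 'a form \<Rightarrow> 'a vfield list \<Rightarrow> 'a \<Rightarrow> real" where
  "lie_derivative V \<omega> Vs x = V x (apply_form \<omega> Vs) -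
    (\<Sum>k<length Vs. apply_form \<omega> (Vs[k := bracket V (Vs ! k)]) x)"

text \<open>
  The terms with a derivative of a coefficient \<open>f\<close> cancel: one comes from differentiating
  \<open>f * apply_form \<omega> Vs\<close> along \<open>V\<close>, the other from the bracket of \<open>V\<close> with a product \<open>f A\<close>, which
  is \<open>f\<close> times the bracket of \<open>V\<close> with \<open>A\<close> plus \<open>(V f) A\<close>.
\<close>

lemma tensorial_lie_derivative:
  assumes \<omega>: "\<omega> \<in> smooth_forms q" and V: "V \<in> vector_fields"
  shows "tensorial q (lie_derivative V \<omega>)"
  unfolding tensorial_def
proof (intro conjI allI impI)
  fix Vs :: "'a vfield list" assume Vs: "length Vs = q" "set Vs \<subseteq> vector_fields"
  have 1: "(\<lambda>x. V x (apply_form \<omega> Vs)) \<in> smooth_functions"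
    by (intro vf_smooth[OF V] form_smooth[OF \<omega>] Vs)
  have 2: "(\<lambda>x. apply_form \<omega> (Vs[k := bracket V (Vs ! k)]) x) \<in> smooth_functions" if "k < q" for k
  proof (rule form_smooth[OF \<omega>])
    show "set (Vs[k := bracket V (Vs ! k)]) \<subseteq> vector_fields"
      by (intro set_update_subsetI Vs bracket_vf V nth_in) (use Vs that in auto)
  qed (use Vs in simp)
  show "lie_derivative V \<omega> Vs \<in> smooth_functions"
    unfolding lie_derivative_def[abs_def] by (intro smooth_diff 1 smooth_sum 2) (use Vs in auto)
next
  fix Vs :: "'a vfield list" and i A B f h x
  assume Vs: "length Vs = q" "set Vs \<subseteq> vector_fields" "i < q" and A: "A \<in> vector_fields" and B: "B \<in> vector_fields"
    and f: "f \<in> smooth_functions" and h: "h \<in> smooth_functions"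
  let ?X = "\<lambda>y. lincomb (f y) (A y) (h y) (B y)"
  let ?a = "apply_form \<omega>"
  note [simp] = form_smooth[OF \<omega>] vf_smooth[OF A] vf_smooth[OF B] vf_smooth[OF V]
  have setA: "set (Vs[i := A]) \<subseteq> vector_fields" and setB: "set (Vs[i := B]) \<subseteq> vector_fields"
    by (intro set_update_subsetI Vs A B)+
  have "?a (Vs[i := ?X]) = (\<lambda>y. f y * ?a (Vs[i := A]) y + h y * ?a (Vs[i := B]) y)"
    using apply_form_lincomb[where Vs=Vs and X="?X", OF \<omega> Vs] vf_tangent A B by blast
  then have "V x (?a (Vs[i := ?X])) = V x f * ?a (Vs[i := A]) x + f x * V x (?a (Vs[i := A]))
      + (V x h * ?a (Vs[i := B]) x + h x * V x (?a (Vs[i := B])))"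
    using Vs setA setB f h
    by (simp add: tangent_add[OF vf_tangent[OF V]] tangent_mult[OF vf_tangent[OF V]] smooth_mult)
  moreover
  let ?t = "\<lambda>X k. ?a ((Vs[i := X])[k := bracket V ((Vs[i := X]) ! k)]) x"
  have other: "?t ?X k = f x * ?t A k + h x * ?t B k" if k: "k < q" "k \<noteq> i" for k
  proof -
    let ?Vs = "Vs[k := bracket V (Vs ! k)]"
    have "set ?Vs \<subseteq> vector_fields" by (intro set_update_subsetI Vs bracket_vf V nth_in) (use k Vs in auto)
    then have "?a (?Vs[i := ?X]) x = f x * ?a (?Vs[i := A]) x + h x * ?a (?Vs[i := B]) x"
      by (intro apply_form_lincomb[OF \<omega>]) (use Vs vf_tangent A B in auto)
    then show ?thesis using k by (simp add: list_update_swap)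
  qed
  have same: "?t ?X i = f x * ?t A i + h x * ?t B i + V x f * ?a (Vs[i := A]) x + V x h * ?a (Vs[i := B]) x"
  proof -
    let ?P = "\<lambda>y. lincomb (f y) (bracket V A y) (h y) (bracket V B y)"
    let ?Q = "\<lambda>y. lincomb (V y f) (A y) (V y h) (B y)"
    have P: "?P \<in> vector_fields" by (intro lincomb_vf f h bracket_vf V A B)
    have Q: "?Q \<in> vector_fields" by (intro lincomb_vf vf_smooth[OF V] f h A B)
    have "bracket V ?X x = lincomb 1 (?P x) 1 (?Q x)"
    proof
      fix k
      show "bracket V ?X x k = lincomb 1 (?P x) 1 (?Q x) k"
      proof (cases "k \<in> smooth_functions")
        case True
        show ?thesis using True f h
          by (simp add: bracket_def lincomb_def tangent_add[OF vf_tangent[OF V]]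
              tangent_mult[OF vf_tangent[OF V]] smooth_mult algebra_simps)
      next
        case False
        have z: "U x k = 0" if "U \<in> vector_fields" for U
          using tangent_nonsmooth[OF vf_tangent[OF that] False] .
        show ?thesis using z[OF P] z[OF Q] z[OF bracket_vf[OF V lincomb_vf[OF f h A B]]]
          by (simp add: lincomb_def[of 1])
      qed
    qed
    then have "?a (Vs[i := bracket V ?X]) x = 1 * ?a (Vs[i := ?P]) x + 1 * ?a (Vs[i := ?Q]) x"
      by (intro apply_form_lincomb[OF \<omega> Vs] vf_tangent P Q)
    also have "?a (Vs[i := ?P]) x = f x * ?a (Vs[i := bracket V A]) x + h x * ?a (Vs[i := bracket V B]) x"
      by (intro apply_form_lincomb[OF \<omega> Vs] vf_tangent bracket_vf V A B refl)
    also have "?a (Vs[i := ?Q]) x = V x f * ?a (Vs[i := A]) x + V x h * ?a (Vs[i := B]) x"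
      by (intro apply_form_lincomb[OF \<omega> Vs] vf_tangent A B refl)
    finally show ?thesis using Vs by simp
  qed
  have split: "(\<Sum>k<q. ?t X k) = ?t X i + (\<Sum>k\<in>{..<q} - {i}. ?t X k)" for X
    using Vs by (simp add: sum.remove)
  have "(\<Sum>k<q. ?t ?X k) = f x * (\<Sum>k<q. ?t A k) + h x * (\<Sum>k<q. ?t B k)
      + V x f * ?a (Vs[i := A]) x + V x h * ?a (Vs[i := B]) x"
  proof -
    have "(\<Sum>k\<in>{..<q} - {i}. ?t ?X k) = (\<Sum>k\<in>{..<q} - {i}. f x * ?t A k + h x * ?t B k)"
      by (rule sum.cong[OF refl], rule other) auto
    then show ?thesis unfolding split same by (simp add: sum.distrib sum_distrib_left algebra_simps)
  qed
  ultimately show "lie_derivative V \<omega> (Vs[i := ?X]) x = f x * lie_derivative V \<omega> (Vs[i := A]) x + h x * lie_derivative V \<omega> (Vs[i := B]) x"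
    using Vs by (simp add: lie_derivative_def algebra_simps)
next
  fix Vs :: "'a vfield list" and i j x
  assume Vs: "length Vs = q" "set Vs \<subseteq> vector_fields" and ij: "i < j" "j < q" and eq: "Vs ! i = Vs ! j"
  let ?a = "apply_form \<omega>"
  let ?b = "bracket V (Vs ! j)"
  have V': "Vs ! j \<in> vector_fields" "?b \<in> vector_fields" using Vs ij by (auto intro!: nth_in bracket_vf V)
  have "?a Vs = (\<lambda>_. 0)"
    by (rule ext, rule apply_form_eq_0[OF \<omega> Vs, of i j]) (use ij eq in auto)
  then have 1: "V x (?a Vs) = 0" using tangent_const[OF vf_tangent[OF V]] by simp
  have "?a (Vs[k := bracket V (Vs ! k)]) x = 0" if "k < q" "k \<noteq> i" "k \<noteq> j" for k
  proof (rule apply_form_eq_0[OF \<omega>, of _ i j])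
    show "set (Vs[k := bracket V (Vs ! k)]) \<subseteq> vector_fields"
      by (intro set_update_subsetI Vs bracket_vf V nth_in) (use Vs that in auto)
  qed (use ij eq that Vs in auto)
  then have "(\<Sum>k\<in>{..<q} - {i, j}. ?a (Vs[k := bracket V (Vs ! k)]) x) = 0" by (intro sum.neutral) auto
  moreover have "(\<Sum>k<q. ?a (Vs[k := bracket V (Vs ! k)]) x) =
      (\<Sum>k\<in>{..<q} - {i, j}. ?a (Vs[k := bracket V (Vs ! k)]) x) + (\<Sum>k\<in>{i, j}. ?a (Vs[k := bracket V (Vs ! k)]) x)"
    by (rule sum.subset_diff) (use ij in auto)
  moreover have "?a (Vs[i := ?b]) x = - ?a (Vs[j := ?b]) x"
  proof -
    have "Vs[i := ?b] = Vs[i := ?b, j := Vs ! j]"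
      using list_update_id[of "Vs[i := ?b]" j] ij by simp
    moreover have "Vs[j := ?b] = Vs[i := Vs ! j, j := ?b]"
      using list_update_id[of Vs i] eq by simp
    ultimately show ?thesis using apply_form_swap[OF \<omega> Vs _ _ _ V'(2,1), of i j x] ij by simp
  qed
  ultimately show "lie_derivative V \<omega> Vs x = 0" using 1 ij eq Vs by (simp add: lie_derivative_def)
qed

text \<open>
  In the formula for the exterior derivative, the terms in which \<open>V\<close> differentiates or stands in
  a bracket make up the Lie derivative. In the others \<open>V\<close> is an argument of \<open>\<omega>\<close>; they make up
  the formula for the interior product, with the opposite sign because the remaining arguments
  are shifted by one place.
\<close>

lemma cartan:
  assumes \<omega>: "\<omega> \<in> smooth_forms (Suc q)" and V: "V \<in> vector_fields"
    and Vs: "length Vs = Suc q" "set Vs \<subseteq> vector_fields"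
  shows "d_formula (Suc q) \<omega> (V # Vs) x = lie_derivative V \<omega> Vs x - d_formula q (interior_product V \<omega>) Vs x"
proof -
  let ?a = "apply_form \<omega>"
  have Vk: "Vs ! k \<in> vector_fields" if "k \<le> q" for k using nth_in[OF Vs(2)] Vs(1) that by auto
  have "(\<Sum>i\<le>Suc q. (-1) ^ i * ((V # Vs) ! i) x (?a (remove_nth i (V # Vs)))) =
      V x (?a Vs) - (\<Sum>i\<le>q. (-1) ^ i * (Vs ! i) x (apply_form (interior_product V \<omega>) (remove_nth i Vs)))"
    by (subst sum.atMost_Suc_shift) (simp add: apply_interior_product sum_negf)
  moreover
  let ?g = "\<lambda>i j. (-1) ^ (i + j) * ?a (bracket ((V # Vs) ! i) ((V # Vs) ! j) # remove_nth i (remove_nth j (V # Vs))) x"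
  have "(\<Sum>j\<le>Suc q. \<Sum>i<j. ?g i j) = (\<Sum>j\<le>q. ?g 0 (Suc j)) + (\<Sum>j\<le>q. \<Sum>i<j. ?g (Suc i) (Suc j))"
    by (subst sum.atMost_Suc_shift) (simp add: sum.lessThan_Suc_shift sum.distrib sum_subtractf sum_negf del: sum.lessThan_Suc)
  moreover have "?g 0 (Suc j) = - ?a (Vs[j := bracket V (Vs ! j)]) x" if "j \<le> q" for j
  proof -
    have "?a (bracket V (Vs ! j) # remove_nth j Vs) x = (-1) ^ j * ?a (Vs[j := bracket V (Vs ! j)]) x"
      by (rule apply_form_move[OF \<omega> Vs]) (use that in \<open>auto intro!: bracket_vf V Vk\<close>)
    then show ?thesis by (simp flip: mult.assoc power_mult_distrib)
  qed
  moreover have "?g (Suc i) (Suc j) =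
      - ((-1) ^ (i + j) * apply_form (interior_product V \<omega>) (bracket (Vs ! i) (Vs ! j) # remove_nth i (remove_nth j Vs)) x)"
    if "i < j" "j \<le> q" for i j
  proof -
    let ?R = "remove_nth i (remove_nth j Vs)" and ?b = "bracket (Vs ! i) (Vs ! j)"
    have len: "length (remove_nth j Vs) = q" using Vs that length_remove_nth[of j Vs] by simp
    have R: "set ?R \<subseteq> vector_fields" "length ?R = q - 1"
      using Vs set_remove_nth[of i "remove_nth j Vs"] set_remove_nth[of j Vs]
        length_remove_nth[of i "remove_nth j Vs"] len that by auto
    have b: "?b \<in> vector_fields" using that by (intro bracket_vf Vk) auto
    have "?a (?b # V # ?R) x = - ?a (V # ?b # ?R) x"
      using apply_form_swap[OF \<omega>, of "?b # V # ?R" 0 1 ?b V x] R b V that by simp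
    then show ?thesis by (simp add: apply_interior_product)
  qed
  ultimately show ?thesis
    using Vs by (simp add: d_formula_def lie_derivative_def sum_negf lessThan_Suc_atMost del: sum.atMost_Suc sum.lessThan_Suc)
qed

text \<open>
  The Leibniz rule; the last sum is \<open>(df \<and> \<omega> + dh \<and> \<eta>)\<close> evaluated on \<open>Vs\<close>.
\<close>

lemma d_formula_lincomb:
  assumes \<omega>: "\<omega> \<in> smooth_forms q" and \<eta>: "\<eta> \<in> smooth_forms q"
    and f: "f \<in> smooth_functions" and h: "h \<in> smooth_functions"
    and Vs: "length Vs = Suc q" "set Vs \<subseteq> vector_fields"
  shows "d_formula q (\<lambda>x vs. f x * \<omega> x vs + h x * \<eta> x vs) Vs x =
    f x * d_formula q \<omega> Vs x + h x * d_formula q \<eta> Vs x +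
    (\<Sum>i\<le>q. (-1) ^ i * ((Vs ! i) x f * apply_form \<omega> (remove_nth i Vs) x +
      (Vs ! i) x h * apply_form \<eta> (remove_nth i Vs) x))"
proof -
  let ?\<theta> = "\<lambda>x vs. f x * \<omega> x vs + h x * \<eta> x vs"
  have app: "apply_form ?\<theta> Ws = (\<lambda>x. f x * apply_form \<omega> Ws x + h x * apply_form \<eta> Ws x)" for Ws
    by (simp add: apply_form_def[abs_def])
  have D: "(Vs ! i) x (apply_form ?\<theta> (remove_nth i Vs)) =
      f x * (Vs ! i) x (apply_form \<omega> (remove_nth i Vs)) + h x * (Vs ! i) x (apply_form \<eta> (remove_nth i Vs)) +
      ((Vs ! i) x f * apply_form \<omega> (remove_nth i Vs) x + (Vs ! i) x h * apply_form \<eta> (remove_nth i Vs) x)"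
    if "i \<le> q" for i
  proof -
    have T: "(Vs ! i) x \<in> tangent x" using nth_in[OF Vs(2), of i] Vs that by (intro vf_tangent) auto
    have S: "apply_form \<omega> (remove_nth i Vs) \<in> smooth_functions" "apply_form \<eta> (remove_nth i Vs) \<in> smooth_functions"
      using form_smooth[OF \<omega>, of "remove_nth i Vs"] form_smooth[OF \<eta>, of "remove_nth i Vs"]
        length_remove_nth[of i Vs] set_remove_nth[of i Vs] Vs that by auto
    show ?thesis unfolding app
      using S f h by (simp add: tangent_add[OF T] tangent_mult[OF T] smooth_mult algebra_simps)
  qed
  have "(\<Sum>i\<le>q. (-1) ^ i * (Vs ! i) x (apply_form ?\<theta> (remove_nth i Vs))) =
      (\<Sum>i\<le>q. (-1) ^ i * (f x * (Vs ! i) x (apply_form \<omega> (remove_nth i Vs)) + h x * (Vs ! i) x (apply_form \<eta> (remove_nth i Vs)) +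
      ((Vs ! i) x f * apply_form \<omega> (remove_nth i Vs) x + (Vs ! i) x h * apply_form \<eta> (remove_nth i Vs) x)))"
    by (rule sum.cong[OF refl]) (use D in auto)
  also have "\<dots> = f x * (\<Sum>i\<le>q. (-1) ^ i * (Vs ! i) x (apply_form \<omega> (remove_nth i Vs))) +
      h x * (\<Sum>i\<le>q. (-1) ^ i * (Vs ! i) x (apply_form \<eta> (remove_nth i Vs))) +
      (\<Sum>i\<le>q. (-1) ^ i * ((Vs ! i) x f * apply_form \<omega> (remove_nth i Vs) x + (Vs ! i) x h * apply_form \<eta> (remove_nth i Vs) x))"
    by (simp add: algebra_simps sum.distrib sum_distrib_left)
  finally show ?thesis
    unfolding d_formula_def app by (simp add: algebra_simps sum.distrib sum_distrib_left)
qed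

lemma d_formula_smooth:
  assumes \<omega>: "\<omega> \<in> smooth_forms q" and Vs: "length Vs = Suc q" "set Vs \<subseteq> vector_fields"
  shows "d_formula q \<omega> Vs \<in> smooth_functions"
proof -
  have Vk: "Vs ! k \<in> vector_fields" if "k \<le> q" for k using nth_in[OF Vs(2)] Vs(1) that by auto
  have rem: "set (remove_nth i Vs) \<subseteq> vector_fields" "length (remove_nth i Vs) = q" if "i \<le> q" for i
    using length_remove_nth[of i Vs] set_remove_nth[of i Vs] Vs that by auto
  have 1: "(\<lambda>x. (Vs ! i) x (apply_form \<omega> (remove_nth i Vs))) \<in> smooth_functions" if "i \<le> q" for i
    by (intro vf_smooth[OF Vk[OF that]] form_smooth[OF \<omega>] rem that)
  have 2: "apply_form \<omega> (bracket (Vs ! i) (Vs ! j) # remove_nth i (remove_nth j Vs)) \<in> smooth_functions"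
    if "i < j" "j \<le> q" for i j
  proof (rule form_smooth[OF \<omega>])
    show "length (bracket (Vs ! i) (Vs ! j) # remove_nth i (remove_nth j Vs)) = q"
      using length_remove_nth[of i "remove_nth j Vs"] rem[OF that(2)] that by simp
    show "set (bracket (Vs ! i) (Vs ! j) # remove_nth i (remove_nth j Vs)) \<subseteq> vector_fields"
      using set_remove_nth[of i "remove_nth j Vs"] rem[OF that(2)] that bracket_vf Vk by auto
  qed
  show ?thesis unfolding d_formula_def[abs_def]
    by (intro smooth_add smooth_sum smooth_cmult 1 2) auto
qed

text \<open>
  Two applications of Cartan's formula express the value on \<open>V, W, Us\<close> by the Lie derivative
  along \<open>V\<close> of the interior product with \<open>W\<close>, minus the same with \<open>V\<close> and \<open>W\<close> exchanged, minus
  \<open>\<omega>\<close> on the bracket of \<open>V\<close> and \<open>W\<close> and \<open>Us\<close>, plus the formula for the double interior product.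
  Altogether this is antisymmetric in \<open>V\<close> and \<open>W\<close>.
\<close>

lemma d_formula_swap_first:
  assumes \<omega>: "\<omega> \<in> smooth_forms (Suc q)" and V: "V \<in> vector_fields" and W: "W \<in> vector_fields"
    and Us: "length Us = q" "set Us \<subseteq> vector_fields"
  shows "d_formula (Suc q) \<omega> (V # W # Us) x = - d_formula (Suc q) \<omega> (W # V # Us) x"
proof -
  have lie_derivative_Cons: "lie_derivative A \<omega> (B # Us) x = lie_derivative A (interior_product B \<omega>) Us x - apply_form \<omega> (bracket A B # Us) x" for A B
    by (simp add: lie_derivative_def apply_interior_product sum.lessThan_Suc_shift del: sum.lessThan_Suc)
  have br: "apply_form \<omega> (bracket V W # Us) x = - apply_form \<omega> (bracket W V # Us) x"
  proof -
    have "bracket V W x = lincomb (-1) (bracket W V x) 0 (bracket W V x)"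
      by (auto simp: bracket_def lincomb_def)
    then show ?thesis
      using apply_form_lincomb[OF \<omega>, where Vs="V # Us" and i=0 and A="bracket W V" and B="bracket W V"
          and X="bracket V W" and a="-1" and b=0] Us V W vf_tangent bracket_vf by simp
  qed
  show ?thesis
  proof (cases q)
    case 0
    \<comment> \<open>The interior products are functions here, and Cartan's formula cannot be applied a second
      time.\<close>
    have i0: "d_formula 0 \<eta> [U] x = U x (apply_form \<eta> [])" for \<eta> U
      by (simp add: d_formula_def)
    have "Us = []" using Us 0 by simp
    then show ?thesis
      using cartan[OF \<omega> V, of "[W]" x] cartan[OF \<omega> W, of "[V]" x] V W br lie_derivative_Cons[of V W] lie_derivative_Cons[of W V] 0
      by (simp add: i0) (simp add: lie_derivative_def apply_interior_product)
  next
    case (Suc m)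
    have \<omega>': "\<omega> \<in> smooth_forms (Suc (Suc m))" using \<omega> Suc by simp
    have i: "interior_product V \<omega> \<in> smooth_forms (Suc m)" "interior_product W \<omega> \<in> smooth_forms (Suc m)"
      using interior_product_form[OF \<omega>'] V W by auto
    have neg: "interior_product W (interior_product V \<omega>) = (\<lambda>x vs. (-1) * interior_product V (interior_product W \<omega>) x vs + 0 * interior_product V (interior_product W \<omega>) x vs)"
    proof (intro ext)
      fix x vs
      have T: "V x \<in> tangent x" "W x \<in> tangent x" using vf_tangent V W by auto
      have "\<omega> x (V x # W x # vs) = - \<omega> x (W x # V x # vs)"
      proof (cases "length vs = m \<and> set vs \<subseteq> tangent x")
        case True
        then show ?thesis
          using alt_swap[OF form_alt[OF \<omega>'], of "V x # W x # vs" x 0 1 "V x" "W x"] T by simp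
      next
        case False
        then show ?thesis
          using alt_out[OF form_alt[OF \<omega>'], of "V x # W x # vs" x] alt_out[OF form_alt[OF \<omega>'], of "W x # V x # vs" x]
          by auto
      qed
      then show "interior_product W (interior_product V \<omega>) x vs = (-1) * interior_product V (interior_product W \<omega>) x vs + 0 * interior_product V (interior_product W \<omega>) x vs"
        by (simp add: interior_product_def)
    qed
    have ii: "interior_product V (interior_product W \<omega>) \<in> smooth_forms m" by (rule interior_product_form[OF i(2) V])
    have Us': "length Us = Suc m" using Us Suc by simp
    have "(Us ! k) x (\<lambda>_. c) = 0" if "k \<le> m" for k c
      using tangent_const[OF vf_tangent[OF nth_in[OF Us(2)]]] Us' that by simp
    then have "d_formula m (interior_product W (interior_product V \<omega>)) Us x = - d_formula m (interior_product V (interior_product W \<omega>)) Us x"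
      unfolding neg
      using d_formula_lincomb[OF ii ii smooth_const[of "-1"] smooth_const[of 0] Us' Us(2), of x] by simp
    then show ?thesis
      using cartan[OF \<omega> V, of "W # Us" x] cartan[OF \<omega> W, of "V # Us" x]
        cartan[OF i(1) W Us' Us(2), of x] cartan[OF i(2) V Us' Us(2), of x] V W Us br lie_derivative_Cons Suc
      by simp
  qed
qed

text \<open>
  Induction on the degree. For a fixed first argument, Cartan's formula gives a difference of
  two tensorial operations, which settles all arguments but the first; that one is exchanged
  with the second by \<open>d_formula_swap_first\<close>.
\<close>

lemma tensorial_d_formula:
  assumes "\<omega> \<in> smooth_forms q" shows "tensorial (Suc q) (d_formula q \<omega>)"
  using assms
proof (induction q arbitrary: \<omega>)
  case 0
  have "d_formula 0 \<omega> [U] x = U x (apply_form \<omega> [])" for U x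
    by (simp add: d_formula_def)
  moreover have "(Vs :: 'a vfield list) = [Vs ! 0]" if "length Vs = Suc 0" for Vs
    using that by (cases Vs) auto
  ultimately have d: "d_formula 0 \<omega> Vs x = (Vs ! 0) x (apply_form \<omega> [])" if "length Vs = Suc 0" for Vs x
    using that by metis
  show ?case
    unfolding tensorial_def using d_formula_smooth[OF 0] by (auto simp: d lincomb_def)
next
  case (Suc q)
  have tail: "tensorial (Suc q) (\<lambda>Vs. d_formula (Suc q) \<omega> (V # Vs))" if V: "V \<in> vector_fields" for V
    by (rule tensorial_cong[OF tensorial_diff[OF tensorial_lie_derivative[OF Suc.prems V] Suc.IH[OF interior_product_form[OF Suc.prems V]]]])
      (simp add: cartan[OF Suc.prems V])
  show ?case unfolding tensorial_def
  proof (intro conjI allI impI)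
    fix Vs :: "'a vfield list" assume Vs: "length Vs = Suc (Suc q)" "set Vs \<subseteq> vector_fields"
    show "d_formula (Suc q) \<omega> Vs \<in> smooth_functions" by (rule d_formula_smooth[OF Suc.prems Vs])
  next
    fix Vs :: "'a vfield list" and i A B f h x
    assume Vs: "length Vs = Suc (Suc q)" "set Vs \<subseteq> vector_fields" "i < Suc (Suc q)"
      and AB: "A \<in> vector_fields" "B \<in> vector_fields" and fh: "f \<in> smooth_functions" "h \<in> smooth_functions"
    let ?X = "\<lambda>y. lincomb (f y) (A y) (h y) (B y)"
    have X: "?X \<in> vector_fields" by (rule lincomb_vf[OF fh AB])
    obtain V Ws where VW: "Vs = V # Ws" using Vs(1) by (cases Vs) auto
    have V: "V \<in> vector_fields" and Ws: "length Ws = Suc q" "set Ws \<subseteq> vector_fields" using Vs VW by auto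
    show "d_formula (Suc q) \<omega> (Vs[i := ?X]) x = f x * d_formula (Suc q) \<omega> (Vs[i := A]) x + h x * d_formula (Suc q) \<omega> (Vs[i := B]) x"
    proof (cases i)
      case 0
      obtain W Us where WU: "Ws = W # Us" using Ws(1) by (cases Ws) auto
      have W: "W \<in> vector_fields" and Us: "length Us = q" "set Us \<subseteq> vector_fields" using Ws WU by auto
      have sw: "d_formula (Suc q) \<omega> (Y # Ws) x = - d_formula (Suc q) \<omega> (W # Ws[0 := Y]) x"
        if "Y \<in> vector_fields" for Y
        using d_formula_swap_first[OF Suc.prems that W Us, of x] WU by simp
      show ?thesis
        using tensorial_lin[OF tail[OF W] Ws _ AB fh, of 0 x] sw[OF X] sw[OF AB(1)] sw[OF AB(2)] 0 VW
        by (simp add: algebra_simps)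
    next
      case (Suc k)
      then show ?thesis using tensorial_lin[OF tail[OF V] Ws _ AB fh, of k x] Vs VW by simp
    qed
  next
    fix Vs :: "'a vfield list" and i j x
    assume Vs: "length Vs = Suc (Suc q)" "set Vs \<subseteq> vector_fields" "i < j" "j < Suc (Suc q)" "Vs ! i = Vs ! j"
    obtain V Ws where VW: "Vs = V # Ws" using Vs(1) by (cases Vs) auto
    have V: "V \<in> vector_fields" and Ws: "length Ws = Suc q" "set Ws \<subseteq> vector_fields" using Vs VW by auto
    obtain k where k: "j = Suc k" "k < Suc q" using Vs by (cases j) auto
    show "d_formula (Suc q) \<omega> Vs x = 0"
    proof (cases i)
      case (Suc l)
      then show ?thesis using tensorial_eq_0[OF tail[OF V] Ws, of l k x] Vs VW k by simp
    next
      case 0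
      then have Wk: "Ws ! k = V" using Vs(5) VW k by simp
      have z: "d_formula (Suc q) \<omega> (V # V # Us) x = 0" if "length Us = q" "set Us \<subseteq> vector_fields" for Us
        using d_formula_swap_first[OF Suc.prems V V that, of x] by simp
      obtain W Us where WU: "Ws = W # Us" using Ws(1) by (cases Ws) auto
      have W: "W \<in> vector_fields" and Us: "length Us = q" "set Us \<subseteq> vector_fields" using Ws WU by auto
      show ?thesis
      proof (cases k)
        case 0
        then show ?thesis using z[OF Us] Wk WU VW by simp
      next
        case (Suc m)
        have "d_formula (Suc q) \<omega> (V # Ws[0 := W, k := V]) x = - d_formula (Suc q) \<omega> (V # Ws[0 := V, k := W]) x"
          by (rule tensorial_swap[OF tail[OF V] Ws _ _ _ W V]) (use k Suc in auto)
        moreover have "Ws[0 := W, k := V] = Ws"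
        proof -
          have "Ws[0 := W] = Ws" using WU by simp
          then show ?thesis using Wk list_update_id[of Ws k] by simp
        qed
        moreover have "Ws[0 := V, k := W] = V # Us[m := W]" using WU Suc by simp
        moreover have "d_formula (Suc q) \<omega> (V # V # Us[m := W]) x = 0"
        proof (rule z)
          show "set (Us[m := W]) \<subseteq> vector_fields" by (intro set_update_subsetI Us W)
        qed (use Us in simp)
        ultimately show ?thesis using VW by simp
      qed
    qed
  qed
qed

text \<open>
  The form described in the definition of \<open>ext_deriv\<close> exists by tensoriality, and it is unique
  because tangent vectors extend to vector fields.
\<close>

theorem ext_deriv:
  assumes "\<omega> \<in> smooth_forms q"
  shows ext_deriv_form: "ext_deriv q \<omega> \<in> smooth_forms (Suc q)"
    and apply_ext_deriv: "length Vs = Suc q \<Longrightarrow> set Vs \<subseteq> vector_fields \<Longrightarrow>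
      apply_form (ext_deriv q \<omega>) Vs = d_formula q \<omega> Vs"
proof -
  obtain \<eta> where \<eta>: "\<eta> \<in> smooth_forms (Suc q)"
    "\<And>Vs. length Vs = Suc q \<Longrightarrow> set Vs \<subseteq> vector_fields \<Longrightarrow> apply_form \<eta> Vs = d_formula q \<omega> Vs"
    by (rule tensorial_form[OF tensorial_d_formula[OF assms]]) blast
  have "ext_deriv q \<omega> = \<eta>" unfolding ext_deriv_def
  proof (rule the_equality)
    show "\<eta> \<in> smooth_forms (Suc q) \<and>
        (\<forall>Vs. length Vs = Suc q \<longrightarrow> set Vs \<subseteq> vector_fields \<longrightarrow> apply_form \<eta> Vs = d_formula q \<omega> Vs)"
      using \<eta> by blast
    show "\<theta> = \<eta>" if "\<theta> \<in> smooth_forms (Suc q) \<and>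
        (\<forall>Vs. length Vs = Suc q \<longrightarrow> set Vs \<subseteq> vector_fields \<longrightarrow> apply_form \<theta> Vs = d_formula q \<omega> Vs)" for \<theta>
      by (rule form_eqI[OF form_alt[of \<theta> "Suc q"] form_alt[OF \<eta>(1)]]) (use that \<eta>(2) in auto)
  qed
  then show "ext_deriv q \<omega> \<in> smooth_forms (Suc q)"
    "length Vs = Suc q \<Longrightarrow> set Vs \<subseteq> vector_fields \<Longrightarrow> apply_form (ext_deriv q \<omega>) Vs = d_formula q \<omega> Vs"
    using \<eta> by auto
qed

section \<open>Gradients\<close>

text \<open>
  The inverse is taken of \<open>d\<^sup>2 + flat_exp 0 (c - d\<^sup>2)\<close>, which is positive everywhere and equal
  to \<open>d\<^sup>2\<close> where \<open>d\<^sup>2 > c\<close>, and multiplied by \<open>d\<close>.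
\<close>

lemma local_inverse:
  assumes d: "d \<in> smooth_functions" and y: "d y \<noteq> 0"
  obtains h N where "h \<in> smooth_functions" "open N" "y \<in> N" "\<And>z. z \<in> N \<Longrightarrow> h z = inverse (d z)"
proof -
  define c where "c = (d y)\<^sup>2 / 2"
  have c: "c > 0" using y by (simp add: c_def)
  let ?q = "\<lambda>z. d z * d z"
  let ?s = "\<lambda>z. ?q z + flat_exp 0 (c - ?q z)"
  have q: "?q \<in> smooth_functions" by (intro smooth_mult d)
  have "(\<lambda>z. flat_exp 0 (c - ?q z)) \<in> smooth_functions"
    by (rule smooth_comp_real[OF smooth_diff[OF smooth_const q] open_UNIV smooth_on_flat_exp]) simp
  then have s: "?s \<in> smooth_functions" by (intro smooth_add q)
  have pos: "?s z > 0" for z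
  proof (cases "?q z < c")
    case True
    then show ?thesis using flat_exp_pos[of "c - ?q z" 0] by (simp add: add_nonneg_pos)
  next
    case False
    then show ?thesis using c flat_exp_nonneg[of 0 "c - ?q z"] by linarith
  qed
  have "(\<lambda>z. inverse (?s z)) \<in> smooth_functions"
    by (rule smooth_comp_real[OF s _ smooth_on_inverse]) (use pos in \<open>auto simp: less_le\<close>)
  then have h: "(\<lambda>z. d z * inverse (?s z)) \<in> smooth_functions" by (intro smooth_mult d)
  have "open {z. c < ?q z}"
    by (intro open_Collect_less continuous_on_const smooth_continuous[OF q])
  moreover have "y \<in> {z. c < ?q z}" using y by (simp add: c_def power2_eq_square[symmetric])
  moreover have "d z * inverse (?s z) = inverse (d z)" if "z \<in> {z. c < ?q z}" for z
  proof -
    have "flat_exp 0 (c - ?q z) = 0" using that by (simp add: flat_exp_def)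
    moreover have "d z \<noteq> 0" using that c by auto
    ultimately show ?thesis by (simp add: field_simps)
  qed
  ultimately show thesis using that h by blast
qed

lemma smooth_det:
  fixes A :: "'a \<Rightarrow> real^'m^'m"
  assumes "\<And>i j. (\<lambda>z. A z $ i $ j) \<in> smooth_functions"
  shows "(\<lambda>z. det (A z)) \<in> smooth_functions"
  unfolding det_def by (intro smooth_sum smooth_mult smooth_const smooth_prod assms)

lemma sum_tangent:
  assumes "finite I" "\<And>i. i \<in> I \<Longrightarrow> e i \<in> tangent x"
  shows "(\<lambda>f. \<Sum>i\<in>I. c i * e i f) \<in> tangent x"
  using assms
proof (induction I rule: finite_induct)
  case (insert a I)
  have "lincomb (c a) (e a) 1 (\<lambda>f. \<Sum>i\<in>I. c i * e i f) \<in> tangent x"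
    using insert by (intro lincomb_tangent) auto
  then show ?case using insert.hyps by (simp add: lincomb_def)
qed (simp add: zero_tangent)

lemma alt_zero:
  assumes "alternating_form_at q x \<omega>" "length vs = q" "set vs \<subseteq> tangent x" "i < q"
  shows "\<omega> (vs[i := (\<lambda>f. 0)]) = 0"
proof -
  have "(\<lambda>f. 0) = lincomb 0 (\<lambda>f. 0) 0 ((\<lambda>f. 0) :: 'a tvec)" by (simp add: lincomb_def)
  then show ?thesis
    using alt_lin[OF assms zero_tangent zero_tangent, of 0 0] by (metis add.right_neutral mult_zero_left)
qed

lemma alt_sum:
  assumes \<omega>: "alternating_form_at q x \<omega>" "length vs = q" "set vs \<subseteq> tangent x" "i < q"
    and "finite I" "\<And>j. j \<in> I \<Longrightarrow> e j \<in> tangent x"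
  shows "\<omega> (vs[i := (\<lambda>f. \<Sum>j\<in>I. c j * e j f)]) = (\<Sum>j\<in>I. c j * \<omega> (vs[i := e j]))"
  using assms(5-)
proof (induction I rule: finite_induct)
  case empty
  then show ?case using alt_zero[OF \<omega>] by simp
next
  case (insert a I)
  let ?S = "\<lambda>f. \<Sum>j\<in>I. c j * e j f"
  have "(\<lambda>f. \<Sum>j\<in>insert a I. c j * e j f) = lincomb (c a) (e a) 1 ?S"
    using insert.hyps by (simp add: lincomb_def)
  then show ?case
    using alt_lin[OF \<omega> _ sum_tangent[of I e x c], of "e a" "c a" 1] insert by simp
qed

lemma alt_add:
  assumes \<omega>: "alternating_form_at q x \<omega>" "length vs = q" "set vs \<subseteq> tangent x" "i < q" "j < q" "i \<noteq> j"
  shows "\<omega> (vs[i := lincomb 1 (vs ! i) c (vs ! j)]) = \<omega> vs"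
proof -
  have T: "vs ! i \<in> tangent x" "vs ! j \<in> tangent x" using nth_in[OF \<omega>(3)] \<omega>(2,4,5) by simp_all
  have "\<omega> (vs[i := vs ! j]) = 0"
    by (rule alt_eq[OF \<omega>(1), of _ i j]) (use \<omega> set_update_subsetI[OF \<omega>(3) T(2)] in auto)
  then show ?thesis using alt_lin[OF \<omega>(1-4) T, of 1 c] by simp
qed

lemma alt_scale:
  assumes \<omega>: "alternating_form_at q x \<omega>" "length vs = q" "set vs \<subseteq> tangent x" "k \<le> q"
  shows "\<omega> (map (\<lambda>i. if i < k then lincomb (a i) (vs ! i) 0 (vs ! i) else vs ! i) [0..<q]) = (\<Prod>i<k. a i) * \<omega> vs"
  using assms(4)
proof (induction k)
  case 0
  have "map ((!) vs) [0..<q] = vs" using \<omega>(2) map_nth by blast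
  then show ?case by simp
next
  case (Suc k)
  let ?l = "\<lambda>k. map (\<lambda>i. if i < k then lincomb (a i) (vs ! i) 0 (vs ! i) else vs ! i) [0..<q]"
  have T: "vs ! i \<in> tangent x" if "i < q" for i using nth_in[OF \<omega>(3)] \<omega>(2) that by simp
  have l: "set (?l k) \<subseteq> tangent x" by (auto intro!: lincomb_tangent T)
  have "?l (Suc k) = (?l k)[k := lincomb (a k) (vs ! k) 0 (vs ! k)]"
    by (rule nth_equalityI) (use Suc.prems in \<open>auto simp: nth_list_update\<close>)
  moreover have "(?l k)[k := vs ! k] = ?l k"
    by (rule nth_equalityI) (use Suc.prems in \<open>auto simp: nth_list_update\<close>)
  ultimately show ?case
    using alt_lin[OF \<omega>(1) _ l, of k "vs ! k" "vs ! k" "a k" 0] Suc T[of k] by simp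
qed

end

context oriented_riemannian_manifold
begin

lemma metric_linear_right:
  "u \<in> tangent x \<Longrightarrow> v \<in> tangent x \<Longrightarrow> w \<in> tangent x \<Longrightarrow>
    g x w (lincomb a u b v) = a * g x w u + b * g x w v"
  using metric_linear[of u x v w a b] metric_sym lincomb_tangent by metis

lemma metric_zero: "w \<in> tangent x \<Longrightarrow> g x w (\<lambda>f. 0) = 0"
proof -
  assume w: "w \<in> tangent x"
  have "lincomb 0 w 0 w = (\<lambda>f. 0)" by (simp add: lincomb_def)
  with metric_linear_right[OF w w w, of 0 0] show ?thesis by simp
qed

lemma metric_nonneg: "v \<in> tangent x \<Longrightarrow> g x v v \<ge> 0"
  using metric_pos[of v x] metric_zero[of v x] by (cases "v = (\<lambda>f. 0)") (auto intro: less_imp_le)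

lemma metric_eq_0: "v \<in> tangent x \<Longrightarrow> g x v v = 0 \<Longrightarrow> v = (\<lambda>f. 0)"
  using metric_pos[of v x] by force

lemma metric_sum:
  assumes "w \<in> tangent x" "finite I" "\<And>i. i \<in> I \<Longrightarrow> e i \<in> tangent x"
  shows "g x w (\<lambda>f. \<Sum>i\<in>I. c i * e i f) = (\<Sum>i\<in>I. c i * g x w (e i))"
  using assms(2,3)
proof (induction I rule: finite_induct)
  case empty
  then show ?case using metric_zero[OF assms(1)] by simp
next
  case (insert a I)
  have "(\<lambda>f. \<Sum>i\<in>insert a I. c i * e i f) = lincomb (c a) (e a) 1 (\<lambda>f. \<Sum>i\<in>I. c i * e i f)"
    using insert.hyps by (simp add: lincomb_def)
  then show ?case
    using metric_linear_right[OF _ sum_tangent[of I e x c] assms(1), of "e a" "c a" 1] insert by simp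
qed

lemma metric_nondegenerate:
  assumes "v \<in> tangent x" "v' \<in> tangent x" "\<And>w. w \<in> tangent x \<Longrightarrow> g x v w = g x v' w"
  shows "v = v'"
proof -
  let ?u = "lincomb 1 v (-1) v'"
  have u: "?u \<in> tangent x" by (intro lincomb_tangent assms)
  have "g x ?u ?u = 0" using metric_linear[OF assms(1,2) u, of 1 "-1"] assms(3)[OF u] by simp
  then have "?u = (\<lambda>f. 0)" by (rule metric_eq_0[OF u])
  then show ?thesis by (auto simp: lincomb_def fun_eq_iff)
qed

text \<open>
  In a frame, the equations that describe the gradient are a linear system with the Gram matrix
  \<open>G\<close> of the frame, which is invertible because the metric is definite. Cramer's rule proves
  existence and displays the coefficients as quotients of smooth functions.
\<close>

lemma grad_in_frame:
  fixes x :: "'n \<Rightarrow> 'a \<Rightarrow> real"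
  assumes E: "\<And>j::'n. E j \<in> vector_fields"
    and dual: "\<And>j k. E j z (x k) = (if j = k then 1 else 0)"
    and frame: "\<And>v f. v \<in> tangent z \<Longrightarrow> f \<in> smooth_functions \<Longrightarrow> v f = (\<Sum>j\<in>UNIV. v (x j) * E j z f)"
    and f: "f \<in> smooth_functions"
  defines "G \<equiv> (\<chi> i j. g z (E i z) (E j z)) :: real^'n^'n"
  shows "det G \<noteq> 0"
    and "grad f z = (\<lambda>h. \<Sum>k\<in>UNIV. (det (\<chi> i j. if j = k then E i z f else G $ i $ j) / det G) * E k z h)"
    and "grad f z \<in> tangent z \<and> (\<forall>w\<in>tangent z. g z (grad f z) w = w f)"
proof -
  have T: "E j z \<in> tangent z" for j by (rule vf_tangent[OF E])
  have sumT: "(\<lambda>h. \<Sum>k\<in>UNIV. c k * E k z h) \<in> tangent z" for c by (rule sum_tangent) (auto simp: T)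
  have gsum: "g z (E i z) (\<lambda>h. \<Sum>k\<in>UNIV. c $ k * E k z h) = (G *v c) $ i" for i and c :: "real^'n"
    by (simp add: metric_sum[OF T finite T] matrix_vector_mult_def G_def mult.commute)
  have "c = 0" if "G *v c = 0" for c
  proof -
    let ?v = "\<lambda>h. \<Sum>k\<in>UNIV. c $ k * E k z h"
    have "g z ?v ?v = (\<Sum>k\<in>UNIV. c $ k * g z ?v (E k z))"
      by (rule metric_sum[OF sumT]) (auto simp: T)
    also have "\<dots> = 0" using gsum[of _ c] that metric_sym[OF sumT T] by simp
    finally have "?v = (\<lambda>f. 0)" by (rule metric_eq_0[OF sumT])
    then have "?v (x k) = 0" for k by meson
    then have "c $ k = 0" for k by (simp add: dual if_distrib sum.delta cong: if_cong)
    then show "c = 0" by (simp add: vec_eq_iff)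
  qed
  then have "invertible G" using matrix_left_invertible_ker invertible_left_inverse by blast
  then show det: "det G \<noteq> 0" by (simp add: invertible_det_nz)
  define c where "c = ((\<chi> k. det (\<chi> i j. if j = k then (\<chi> i. E i z f) $ i else G $ i $ j) / det G) :: real^'n)"
  define V where "V = (\<lambda>h. \<Sum>k\<in>UNIV. c $ k * E k z h)"
  have c: "G *v c = (\<chi> i. E i z f)" using cramer[OF det] unfolding c_def by metis
  have VT: "V \<in> tangent z" unfolding V_def by (rule sumT)
  have v: "g z V w = w f" if w: "w \<in> tangent z" for w
  proof -
    have weq: "w = (\<lambda>h. \<Sum>k\<in>UNIV. w (x k) * E k z h)"
    proof
      fix h show "w h = (\<Sum>k\<in>UNIV. w (x k) * E k z h)"
        using frame[OF w, of h] tangent_nonsmooth[OF w, of h] tangent_nonsmooth[OF T, of h]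
        by (cases "h \<in> smooth_functions") auto
    qed
    have "g z V w = (\<Sum>k\<in>UNIV. w (x k) * g z V (E k z))"
      by (subst weq, rule metric_sum[OF VT]) (auto simp: T)
    also have "\<dots> = (\<Sum>k\<in>UNIV. w (x k) * E k z f)"
    proof (rule sum.cong[OF refl])
      fix k
      have "g z V (E k z) = g z (E k z) V" by (rule metric_sym[OF VT T])
      also have "\<dots> = (G *v c) $ k" unfolding V_def by (rule gsum)
      also have "\<dots> = E k z f" unfolding c by simp
      finally show "w (x k) * g z V (E k z) = w (x k) * E k z f" by (simp only:)
    qed
    also have "\<dots> = w f" by (rule frame[OF w f, symmetric])
    finally show ?thesis .
  qed
  have uniq: "u = V" if "u \<in> tangent z \<and> (\<forall>w\<in>tangent z. g z u w = w f)" for u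
    by (rule metric_nondegenerate[OF _ VT]) (use that v in auto)
  have gr: "grad f z = V" unfolding grad_def
    by (rule the_equality) (use v VT uniq in auto)
  show "grad f z = (\<lambda>h. \<Sum>k\<in>UNIV. (det (\<chi> i j. if j = k then E i z f else G $ i $ j) / det G) * E k z h)"
    unfolding gr V_def c_def by (simp cong: if_cong)
  show "grad f z \<in> tangent z \<and> (\<forall>w\<in>tangent z. g z (grad f z) w = w f)"
    unfolding gr using v VT by auto
qed

lemma grad:
  assumes "f \<in> smooth_functions"
  shows grad_tangent: "grad f y \<in> tangent y" and metric_grad: "w \<in> tangent y \<Longrightarrow> g y (grad f y) w = w f"
proof -
  obtain N Q and x :: "'n \<Rightarrow> 'a \<Rightarrow> real" and E :: "'n \<Rightarrow> 'a vfield" where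
    F: "y \<in> N" "N \<subseteq> Q" "\<And>j. E j \<in> vector_fields"
    "\<And>z j k. z \<in> Q \<Longrightarrow> E j z (x k) = (if j = k then 1 else 0)"
    "\<And>z v f. z \<in> Q \<Longrightarrow> v \<in> tangent z \<Longrightarrow> f \<in> smooth_functions \<Longrightarrow> v f = (\<Sum>j\<in>UNIV. v (x j) * E j z f)"
    by (rule local_frame[of y]) blast
  have y: "y \<in> Q" using F by auto
  have "grad f y \<in> tangent y \<and> (\<forall>w\<in>tangent y. g y (grad f y) w = w f)"
    by (rule grad_in_frame(3)[OF F(3) F(4)[OF y] F(5)[OF y] assms])
  then show "grad f y \<in> tangent y" "w \<in> tangent y \<Longrightarrow> g y (grad f y) w = w f" by blast+
qed

lemma grad_eqI:
  "f \<in> smooth_functions \<Longrightarrow> v \<in> tangent y \<Longrightarrow> (\<And>w. w \<in> tangent y \<Longrightarrow> g y v w = w f) \<Longrightarrow> grad f y = v"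
  by (rule metric_nondegenerate) (auto simp: grad_tangent metric_grad)

lemma grad_vf:
  assumes f: "f \<in> smooth_functions" shows "grad f \<in> vector_fields"
  unfolding vector_fields_def
proof (intro CollectI conjI allI ballI)
  fix h assume h: "h \<in> smooth_functions"
  show "(\<lambda>z. grad f z h) \<in> smooth_functions"
  proof (rule smooth_local)
    fix y
    obtain N Q and x :: "'n \<Rightarrow> 'a \<Rightarrow> real" and E :: "'n \<Rightarrow> 'a vfield" where
      F: "open N" "y \<in> N" "N \<subseteq> Q" "\<And>j. E j \<in> vector_fields"
      "\<And>z j k. z \<in> Q \<Longrightarrow> E j z (x k) = (if j = k then 1 else 0)"
      "\<And>z v f. z \<in> Q \<Longrightarrow> v \<in> tangent z \<Longrightarrow> f \<in> smooth_functions \<Longrightarrow> v f = (\<Sum>j\<in>UNIV. v (x j) * E j z f)"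
      by (rule local_frame[of y]) blast
    define G where "G z = (\<chi> i j. g z (E i z) (E j z) :: real^'n^'n)" for z
    have gf1: "det (G z) \<noteq> 0" if z: "z \<in> Q" for z
      unfolding G_def by (rule grad_in_frame(1)[OF F(4) F(5)[OF z] F(6)[OF z] f])
    have gf2: "grad f z = (\<lambda>h. \<Sum>k\<in>UNIV. (det (\<chi> i j. if j = k then E i z f else G z $ i $ j) / det (G z)) * E k z h)"
      if z: "z \<in> Q" for z
      unfolding G_def by (rule grad_in_frame(2)[OF F(4) F(5)[OF z] F(6)[OF z] f])
    have y: "y \<in> Q" using F by auto
    have Gs: "(\<lambda>z. G z $ i $ j) \<in> smooth_functions" for i j
      using metric_smooth[OF F(4) F(4)] by (simp add: G_def)
    have dG: "(\<lambda>z. det (G z)) \<in> smooth_functions" by (rule smooth_det[OF Gs])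
    have dk: "(\<lambda>z. det (\<chi> i j. if j = k then E i z f else G z $ i $ j)) \<in> smooth_functions" for k
    proof (rule smooth_det)
      show "(\<lambda>z. (\<chi> i j. if j = k then E i z f else G z $ i $ j) $ i $ j) \<in> smooth_functions" for i j
        using Gs vf_smooth[OF F(4) f] by (cases "j = k") auto
    qed
    obtain H M where H: "H \<in> smooth_functions" "open M" "y \<in> M" "\<And>z. z \<in> M \<Longrightarrow> H z = inverse (det (G z))"
      using local_inverse[OF dG gf1[OF y]] by blast
    let ?F = "\<lambda>z. \<Sum>k\<in>UNIV. (det (\<chi> i j. if j = k then E i z f else G z $ i $ j) * H z) * E k z h"
    have "?F \<in> smooth_functions"
      by (intro smooth_sum smooth_mult dk H(1) vf_smooth[OF F(4) h])
    moreover have "grad f z h = ?F z" if "z \<in> N \<inter> M" for z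
      using gf2[of z] F(3) that H(4)[of z] by (auto simp: divide_inverse)
    ultimately show "\<exists>N h'. open N \<and> y \<in> N \<and> h' \<in> smooth_functions \<and> (\<forall>z\<in>N. grad f z h = h' z)"
      using F(1,2) H(2,3) by (intro exI[of _ "N \<inter> M"] exI[of _ ?F]) auto
  qed
qed (rule grad_tangent[OF f])

section \<open>Gram determinants and orthonormal lists\<close>

text \<open>
  The Gram determinant is not linear in the entries of its list. Polarised to two lists it is
  alternating in each of them.
\<close>

definition gram2 :: "nat \<Rightarrow> 'a \<Rightarrow> 'a tvec list \<Rightarrow> 'a tvec list \<Rightarrow> real" where
  "gram2 q x vs ws = (\<Sum>\<sigma> | \<sigma> permutes {..<q}. of_int (sign \<sigma>) * (\<Prod>i<q. g x (vs ! i) (ws ! \<sigma> i)))"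

lemma gram2_same: "gram2 q x vs vs = gram_det q x vs"
  by (simp add: gram2_def gram_det_def)

lemma gram2_sym:
  assumes "length vs = q" "set vs \<subseteq> tangent x" "length ws = q" "set ws \<subseteq> tangent x"
  shows "gram2 q x vs ws = gram2 q x ws vs"
proof -
  have "gram2 q x vs ws = (\<Sum>\<sigma> | \<sigma> permutes {..<q}. of_int (sign (inv \<sigma>)) * (\<Prod>i<q. g x (vs ! i) (ws ! inv \<sigma> i)))"
    unfolding gram2_def by (rule sum_permutations_inverse)
  also have "\<dots> = gram2 q x ws vs"
    unfolding gram2_def
  proof (rule sum.cong[OF refl])
    fix \<sigma> assume "\<sigma> \<in> {\<sigma>. \<sigma> permutes {..<q}}"
    then have \<sigma>: "\<sigma> permutes {..<q}" by simp
    have "(\<Prod>i<q. g x (vs ! i) (ws ! inv \<sigma> i)) = (\<Prod>i<q. g x (vs ! \<sigma> i) (ws ! inv \<sigma> (\<sigma> i)))"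
      using prod.permute[OF \<sigma>, of "\<lambda>i. g x (vs ! i) (ws ! inv \<sigma> i)"] by (simp add: o_def)
    also have "\<dots> = (\<Prod>i<q. g x (ws ! i) (vs ! \<sigma> i))"
    proof (rule prod.cong[OF refl])
      fix i assume "i \<in> {..<q}"
      then have "i < q" "\<sigma> i < q" using permutes_in_image[OF \<sigma>, of i] by auto
      then have "vs ! \<sigma> i \<in> tangent x" "ws ! i \<in> tangent x"
        using assms by (simp_all add: nth_in)
      then have "g x (vs ! \<sigma> i) (ws ! i) = g x (ws ! i) (vs ! \<sigma> i)" by (rule metric_sym)
      then show "g x (vs ! \<sigma> i) (ws ! inv \<sigma> (\<sigma> i)) = g x (ws ! i) (vs ! \<sigma> i)"
        by (simp only: permutes_inverses(2)[OF \<sigma>])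
    qed
    finally show "of_int (sign (inv \<sigma>)) * (\<Prod>i<q. g x (vs ! i) (ws ! inv \<sigma> i)) =
        of_int (sign \<sigma>) * (\<Prod>i<q. g x (ws ! i) (vs ! \<sigma> i))"
      using sign_inverse[OF permutes_imp_permutation[OF finite_lessThan \<sigma>]] by simp
  qed
  finally show ?thesis .
qed

lemma gram2_alternating:
  assumes ws: "length ws = q" "set ws \<subseteq> tangent x"
  shows "alternating_form_at q x (\<lambda>vs. if length vs = q \<and> set vs \<subseteq> tangent x then gram2 q x vs ws else 0)"
  unfolding alternating_form_at_def
proof (intro conjI allI impI)
  have wT: "ws ! k \<in> tangent x" if "k < q" for k using nth_in[OF ws(2)] ws(1) that by simp
  {
    fix vs i v w a b
    assume vs: "length vs = q" "set vs \<subseteq> tangent x" "i < q" and vw: "v \<in> tangent x" "w \<in> tangent x"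
    have pr: "(\<Prod>k<q. g x (vs[i := u] ! k) (ws ! \<sigma> k)) = g x u (ws ! \<sigma> i) * (\<Prod>k\<in>{..<q} - {i}. g x (vs ! k) (ws ! \<sigma> k))"
      for u \<sigma>
    proof -
      have "(\<Prod>k<q. g x (vs[i := u] ! k) (ws ! \<sigma> k)) =
          g x u (ws ! \<sigma> i) * (\<Prod>k\<in>{..<q} - {i}. g x (vs[i := u] ! k) (ws ! \<sigma> k))"
        using vs by (subst prod.remove[of _ i]) auto
      also have "(\<Prod>k\<in>{..<q} - {i}. g x (vs[i := u] ! k) (ws ! \<sigma> k)) = (\<Prod>k\<in>{..<q} - {i}. g x (vs ! k) (ws ! \<sigma> k))"
        by (rule prod.cong) auto
      finally show ?thesis .
    qed
    have lin: "g x (lincomb a v b w) (ws ! \<sigma> i) = a * g x v (ws ! \<sigma> i) + b * g x w (ws ! \<sigma> i)"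
      if "\<sigma> permutes {..<q}" for \<sigma>
      using metric_linear[OF vw wT] permutes_in_image[OF that, of i] vs(3) by auto
    have "gram2 q x (vs[i := lincomb a v b w]) ws = a * gram2 q x (vs[i := v]) ws + b * gram2 q x (vs[i := w]) ws"
      unfolding gram2_def pr sum_distrib_left sum.distrib[symmetric]
      by (rule sum.cong[OF refl]) (simp add: lin algebra_simps)
    then show "(if length (vs[i := lincomb a v b w]) = q \<and> set (vs[i := lincomb a v b w]) \<subseteq> tangent x
          then gram2 q x (vs[i := lincomb a v b w]) ws else 0) =
        a * (if length (vs[i := v]) = q \<and> set (vs[i := v]) \<subseteq> tangent x then gram2 q x (vs[i := v]) ws else 0) +
        b * (if length (vs[i := w]) = q \<and> set (vs[i := w]) \<subseteq> tangent x then gram2 q x (vs[i := w]) ws else 0)"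
      using vs set_update_subsetI[OF vs(2) vw(1), of i] set_update_subsetI[OF vs(2) vw(2), of i]
        set_update_subsetI[OF vs(2) lincomb_tangent[OF vw], of i] by simp
  next
    fix vs i j assume vs: "length vs = q" "set vs \<subseteq> tangent x" "i < j" "j < q" "vs ! i = vs ! j"
    let ?\<tau> = "Transposition.transpose i j"
    have \<tau>: "?\<tau> permutes {..<q}" using vs by (intro permutes_swap_id) auto
    have "gram2 q x vs ws = (\<Sum>\<sigma> | \<sigma> permutes {..<q}. of_int (sign (\<sigma> \<circ> ?\<tau>)) * (\<Prod>k<q. g x (vs ! k) (ws ! (\<sigma> \<circ> ?\<tau>) k)))"
      unfolding gram2_def by (rule sum_permutations_compose_right[OF \<tau>])
    also have "\<dots> = (\<Sum>\<sigma> | \<sigma> permutes {..<q}. - (of_int (sign \<sigma>) * (\<Prod>k<q. g x (vs ! k) (ws ! \<sigma> k))))"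
    proof (rule sum.cong[OF refl])
      fix \<sigma> assume "\<sigma> \<in> {\<sigma>. \<sigma> permutes {..<q}}"
      then have \<sigma>: "\<sigma> permutes {..<q}" by simp
      have "vs ! ?\<tau> k = vs ! k" for k using vs(5) by (simp add: Transposition.transpose_def)
      then have "(\<Prod>k<q. g x (vs ! k) (ws ! (\<sigma> \<circ> ?\<tau>) k)) = (\<Prod>k<q. g x (vs ! k) (ws ! \<sigma> k))"
        using prod.permute[OF \<tau>, of "\<lambda>k. g x (vs ! k) (ws ! (\<sigma> \<circ> ?\<tau>) k)"] by (simp add: o_def)
      moreover have "sign (\<sigma> \<circ> ?\<tau>) = - sign \<sigma>"
        using sign_compose[OF permutes_imp_permutation[OF finite_lessThan \<sigma>] permutation_swap_id[of i j]] vs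
        by (simp add: sign_swap_id)
      ultimately show "of_int (sign (\<sigma> \<circ> ?\<tau>)) * (\<Prod>k<q. g x (vs ! k) (ws ! (\<sigma> \<circ> ?\<tau>) k)) =
          - (of_int (sign \<sigma>) * (\<Prod>k<q. g x (vs ! k) (ws ! \<sigma> k)))" by simp
    qed
    also have "\<dots> = - gram2 q x vs ws" by (simp add: gram2_def sum_negf)
    finally show "(if length vs = q \<and> set vs \<subseteq> tangent x then gram2 q x vs ws else 0) = 0" by simp
  }
qed auto

text \<open>
  Alternating forms separate simple vectors, so this says that the two lists represent the same
  one.
\<close>

definition same_plane :: "nat \<Rightarrow> 'a \<Rightarrow> 'a tvec list \<Rightarrow> 'a tvec list \<Rightarrow> bool" where
  "same_plane q x vs ws \<longleftrightarrow> length vs = q \<and> set vs \<subseteq> tangent x \<and> length ws = q \<and> set ws \<subseteq> tangent x \<and>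
    (\<forall>\<omega>. alternating_form_at q x \<omega> \<longrightarrow> \<omega> vs = \<omega> ws)"

lemma same_plane_trans: "same_plane q x us vs \<Longrightarrow> same_plane q x vs ws \<Longrightarrow> same_plane q x us ws"
  by (auto simp: same_plane_def)

text \<open>
  With one list fixed, \<open>gram2\<close> is an alternating form in the other and does not distinguish \<open>vs\<close>
  from \<open>ws\<close>; replace one list after the other.
\<close>

lemma same_plane_gram:
  assumes "same_plane q x vs ws" shows "gram_det q x vs = gram_det q x ws"
proof -
  have l: "length vs = q" "set vs \<subseteq> tangent x" "length ws = q" "set ws \<subseteq> tangent x"
    and eq: "\<And>\<omega>. alternating_form_at q x \<omega> \<Longrightarrow> \<omega> vs = \<omega> ws"
    using assms by (auto simp: same_plane_def)
  have "gram2 q x vs us = gram2 q x ws us" if "length us = q" "set us \<subseteq> tangent x" for us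
    using eq[OF gram2_alternating[OF that]] l by simp
  note eq2 = this
  have "gram2 q x vs vs = gram2 q x ws vs" by (rule eq2[OF l(1,2)])
  also have "\<dots> = gram2 q x vs ws" by (rule gram2_sym[OF l, symmetric])
  also have "\<dots> = gram2 q x ws ws" by (rule eq2[OF l(3,4)])
  finally show ?thesis by (simp only: gram2_same)
qed

definition orthonormal :: "nat \<Rightarrow> 'a \<Rightarrow> 'a tvec list \<Rightarrow> bool" where
  "orthonormal q x vs \<longleftrightarrow> length vs = q \<and> set vs \<subseteq> tangent x \<and>
    (\<forall>i<q. \<forall>j<q. g x (vs ! i) (vs ! j) = (if i = j then 1 else 0))"

lemma gram_det_orthogonal:
  assumes "\<And>i j. i < q \<Longrightarrow> j < q \<Longrightarrow> i \<noteq> j \<Longrightarrow> g x (vs ! i) (vs ! j) = 0"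
  shows "gram_det q x vs = (\<Prod>i<q. g x (vs ! i) (vs ! i))"
proof -
  have "gram_det q x vs = (\<Sum>\<sigma>\<in>{id}. of_int (sign \<sigma>) * (\<Prod>i<q. g x (vs ! i) (vs ! \<sigma> i)))"
    unfolding gram_det_def
  proof (rule sum.mono_neutral_right)
    show "\<forall>\<sigma>\<in>{\<sigma>. \<sigma> permutes {..<q}} - {id}. of_int (sign \<sigma>) * (\<Prod>i<q. g x (vs ! i) (vs ! \<sigma> i)) = 0"
    proof
      fix \<sigma> assume "\<sigma> \<in> {\<sigma>. \<sigma> permutes {..<q}} - {id}"
      then have \<sigma>: "\<sigma> permutes {..<q}" "\<sigma> \<noteq> id" by auto
      then obtain i where i: "\<sigma> i \<noteq> i" by (auto simp: fun_eq_iff)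
      then have "i < q" using \<sigma>(1) permutes_not_in by fastforce
      moreover have "\<sigma> i < q" using permutes_in_image[OF \<sigma>(1), of i] \<open>i < q\<close> by simp
      ultimately have "g x (vs ! i) (vs ! \<sigma> i) = 0" using assms i by metis
      then have "(\<Prod>i<q. g x (vs ! i) (vs ! \<sigma> i)) = 0" using \<open>i < q\<close> by auto
      then show "of_int (sign \<sigma>) * (\<Prod>i<q. g x (vs ! i) (vs ! \<sigma> i)) = 0" by simp
    qed
  qed (auto simp: finite_permutations permutes_id)
  then show ?thesis by simp
qed

lemma orthonormal_unit_simple: "orthonormal q x vs \<Longrightarrow> vs \<in> unit_simple q x"
  using gram_det_orthogonal[of q x vs] by (simp add: orthonormal_def unit_simple_def)

text \<open>
  The Gram-Schmidt process without normalisation: adding a multiple of one entry to another does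
  not change the value of any alternating form.
\<close>

lemma orthogonalize:
  assumes "length vs = q" "set vs \<subseteq> tangent x" "k \<le> q"
  shows "\<exists>ws. same_plane q x ws vs \<and> (\<forall>i<k. \<forall>j<i. g x (ws ! i) (ws ! j) = 0)"
  using assms(3)
proof (induction k)
  case 0
  then show ?case using assms by (auto simp: same_plane_def)
next
  case (Suc k)
  then obtain us where us: "same_plane q x us vs" "\<And>i j. i < k \<Longrightarrow> j < i \<Longrightarrow> g x (us ! i) (us ! j) = 0" by auto
  have "\<exists>ws. same_plane q x ws vs \<and> (\<forall>i<k. \<forall>j<i. g x (ws ! i) (ws ! j) = 0) \<and> (\<forall>j<m. g x (ws ! k) (ws ! j) = 0)"
    if "m \<le> k" for m
    using that
  proof (induction m)
    case 0
    then show ?case using us by auto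
  next
    case (Suc m)
    then obtain ws where ws: "same_plane q x ws vs" "\<And>i j. i < k \<Longrightarrow> j < i \<Longrightarrow> g x (ws ! i) (ws ! j) = 0"
      "\<And>j. j < m \<Longrightarrow> g x (ws ! k) (ws ! j) = 0" by auto
    have l: "length ws = q" "set ws \<subseteq> tangent x" using ws(1) by (auto simp: same_plane_def)
    have kq: "k < q" "m < k" using \<open>Suc k \<le> q\<close> Suc.prems by auto
    have T: "ws ! i \<in> tangent x" if "i < q" for i using nth_in[OF l(2)] l(1) that by simp
    \<comment> \<open>If \<open>ws ! m\<close> is zero, then \<open>c = 0\<close> by the convention for division, and there is nothing to
      remove.\<close>
    define c where "c = - g x (ws ! k) (ws ! m) / g x (ws ! m) (ws ! m)"
    let ?v = "lincomb 1 (ws ! k) c (ws ! m)"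
    let ?ws = "ws[k := ?v]"
    have v: "?v \<in> tangent x" by (intro lincomb_tangent T) (use kq in auto)
    have "same_plane q x ?ws ws"
      unfolding same_plane_def using l set_update_subsetI[OF l(2) v] alt_add[OF _ l kq(1), of _ m c] kq by auto
    then have "same_plane q x ?ws vs" using ws(1) same_plane_trans by blast
    moreover have "g x (?ws ! i) (?ws ! j) = 0" if "i < k" "j < i" for i j
      using ws(2)[OF that] that by simp
    moreover have "g x (?ws ! k) (?ws ! j) = 0" if "j < Suc m" for j
    proof -
      have j: "j < k" "j < q" using that kq by auto
      have "g x ?v (ws ! j) = g x (ws ! k) (ws ! j) + c * g x (ws ! m) (ws ! j)"
        using metric_linear[OF T[OF kq(1)] T T, of m j 1 c] kq j by simp
      also have "\<dots> = 0"
      proof (cases "j = m")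
        case True
        show ?thesis
        proof (cases "g x (ws ! m) (ws ! m) = 0")
          case True
          have "ws ! m = (\<lambda>f. 0)" using metric_eq_0[OF T True] kq by simp
          then show ?thesis using \<open>j = m\<close> True metric_zero[OF T[OF kq(1)]] by simp
        qed (simp add: True c_def)
      next
        case False
        then show ?thesis using ws(2)[of m j] ws(3)[of j] that kq by simp
      qed
      finally show ?thesis using j kq l by simp
    qed
    ultimately show ?case by blast
  qed
  from this[of k] obtain ws where "same_plane q x ws vs" "\<And>i j. i < k \<Longrightarrow> j < i \<Longrightarrow> g x (ws ! i) (ws ! j) = 0"
      "\<And>j. j < k \<Longrightarrow> g x (ws ! k) (ws ! j) = 0" by auto
  then show ?case by (intro exI[of _ ws]) (auto simp: less_Suc_eq)
qed

text \<open>
  The squared lengths of the orthogonalised list have the product \<open>1\<close>, the Gram determinant. So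
  dividing each entry by its length multiplies the value of every alternating form by \<open>1\<close>.
\<close>

lemma orthonormalize:
  assumes "vs \<in> unit_simple q x"
  obtains es where "orthonormal q x es" "same_plane q x es vs"
proof -
  have vs: "length vs = q" "set vs \<subseteq> tangent x" "gram_det q x vs = 1"
    using assms by (auto simp: unit_simple_def)
  obtain ws where ws: "same_plane q x ws vs" "\<And>i j. i < q \<Longrightarrow> j < i \<Longrightarrow> g x (ws ! i) (ws ! j) = 0"
    using orthogonalize[OF vs(1,2) order_refl] by blast
  have l: "length ws = q" "set ws \<subseteq> tangent x" using ws(1) by (auto simp: same_plane_def)
  have T: "ws ! i \<in> tangent x" if "i < q" for i using nth_in[OF l(2)] l(1) that by simp
  have orth: "g x (ws ! i) (ws ! j) = 0" if "i < q" "j < q" "i \<noteq> j" for i j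
    using ws(2)[of i j] ws(2)[of j i] that metric_sym[OF T T, of i j] by (cases "i < j") auto
  have prod1: "(\<Prod>i<q. g x (ws ! i) (ws ! i)) = 1"
    using gram_det_orthogonal[of q x ws] orth same_plane_gram[OF ws(1)] vs(3) by simp
  have pos: "g x (ws ! i) (ws ! i) > 0" if "i < q" for i
  proof -
    have "g x (ws ! i) (ws ! i) \<noteq> 0"
      using prod1 that by (metis finite_lessThan lessThan_iff prod_zero zero_neq_one)
    then show ?thesis using metric_nonneg[OF T[OF that]] by simp
  qed
  define a where "a i = 1 / sqrt (g x (ws ! i) (ws ! i))" for i
  have "(\<Prod>i<m. a i) = 1 / sqrt (\<Prod>i<m. g x (ws ! i) (ws ! i))" for m
    by (induction m) (simp_all add: a_def real_sqrt_mult)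
  then have a1: "(\<Prod>i<q. a i) = 1" using prod1 by simp
  define es where "es = map (\<lambda>i. if i < q then lincomb (a i) (ws ! i) 0 (ws ! i) else ws ! i) [0..<q]"
  have es: "es ! i = lincomb (a i) (ws ! i) 0 (ws ! i)" if "i < q" for i using that by (simp add: es_def)
  have les: "length es = q" "set es \<subseteq> tangent x" unfolding es_def by (auto intro!: lincomb_tangent T)
  have "same_plane q x es ws"
    unfolding same_plane_def using les l alt_scale[OF _ l order_refl, of _ a] a1 by (simp add: es_def)
  then have "same_plane q x es vs" using ws(1) same_plane_trans by blast
  moreover have "orthonormal q x es"
    unfolding orthonormal_def
  proof (intro conjI les allI impI)
    fix i j assume ij: "i < q" "j < q"
    have "g x (es ! i) (es ! j) = a i * g x (ws ! i) (es ! j)"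
      using metric_linear[OF T[OF ij(1)] T[OF ij(1)], of "es ! j" "a i" 0] les ij nth_mem[of j es] by (auto simp: es)
    also have "g x (ws ! i) (es ! j) = a j * g x (ws ! i) (ws ! j)"
      using metric_linear_right[OF T[OF ij(2)] T[OF ij(2)] T[OF ij(1)], of "a j" 0] ij by (simp add: es)
    finally have "g x (es ! i) (es ! j) = a i * a j * g x (ws ! i) (ws ! j)" by simp
    then show "g x (es ! i) (es ! j) = (if i = j then 1 else 0)"
      using orth[OF ij] pos[OF ij(1)] by (auto simp: a_def)
  qed
  ultimately show thesis using that by blast
qed

end

context smooth_manifold
begin

section \<open>Coefficients of orthonormal lists\<close>

lemma smooth_bounded:
  assumes "f \<in> smooth_functions" "compact L"
  obtains B where "0 \<le> B" "\<And>z. z \<in> L \<Longrightarrow> \<bar>f z\<bar> \<le> B"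
proof -
  have "compact (f ` L)"
    by (rule compact_continuous_image[OF continuous_on_subset[OF smooth_continuous[OF assms(1)]] assms(2)]) auto
  then obtain B where B: "\<And>z. z \<in> L \<Longrightarrow> \<bar>f z\<bar> \<le> B"
    using compact_imp_bounded bounded_real by (metis imageI)
  have "0 \<le> max B 0" "\<And>z. z \<in> L \<Longrightarrow> \<bar>f z\<bar> \<le> max B 0" using B by (auto simp: le_max_iff_disj)
  then show thesis using that by blast
qed

lemma smooth_family_bounded:
  assumes "finite I" "\<And>i. i \<in> I \<Longrightarrow> f i \<in> smooth_functions" "compact L"
  obtains B where "0 \<le> B" "\<And>i z. i \<in> I \<Longrightarrow> z \<in> L \<Longrightarrow> \<bar>f i z\<bar> \<le> B"
proof -
  have "\<exists>B. 0 \<le> B \<and> (\<forall>i\<in>I. \<forall>z\<in>L. \<bar>f i z\<bar> \<le> B)"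
    using assms(1,2)
  proof (induction I rule: finite_induct)
    case (insert a I)
    obtain B where B: "0 \<le> B" "\<forall>i\<in>I. \<forall>z\<in>L. \<bar>f i z\<bar> \<le> B" using insert by auto
    obtain B' where B': "0 \<le> B'" "\<And>z. z \<in> L \<Longrightarrow> \<bar>f a z\<bar> \<le> B'"
      using smooth_bounded[OF _ assms(3), of "f a"] insert.prems by auto
    show ?case using B B' by (intro exI[of _ "max B B'"]) (auto simp: le_max_iff_disj)
  qed auto
  then show thesis using that by blast
qed

lemma alt_expand:
  fixes e :: "'n \<Rightarrow> 'a tvec"
  assumes "alternating_form_at q z \<omega>" "length vs = q" "\<And>j. e j \<in> tangent z"
    "\<And>i. i < q \<Longrightarrow> vs ! i = (\<lambda>f. \<Sum>j\<in>UNIV. a i j * e j f)"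
  shows "\<omega> vs = (\<Sum>js | length js = q. (\<Prod>i<q. a i (js ! i)) * \<omega> (map e js))"
  using assms
proof (induction q arbitrary: \<omega> vs a)
  case 0
  then show ?case by simp
next
  case (Suc q)
  obtain v ws where vs: "vs = v # ws" "length ws = q" using Suc.prems(2) by (cases vs) auto
  have comb: "(\<lambda>f. \<Sum>j\<in>UNIV. c j * e j f) \<in> tangent z" for c
    by (rule sum_tangent) (auto simp: Suc.prems(3))
  have v: "v = (\<lambda>f. \<Sum>j\<in>UNIV. a 0 j * e j f)" using Suc.prems(4)[of 0] vs by simp
  have ws: "ws ! i = (\<lambda>f. \<Sum>j\<in>UNIV. a (Suc i) j * e j f)" if "i < q" for i
    using Suc.prems(4)[of "Suc i"] vs that by simp
  have wsT: "set ws \<subseteq> tangent z"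
    using ws comb vs(2) by (auto simp: in_set_conv_nth)
  have "\<omega> vs = \<omega> ((v # ws)[0 := (\<lambda>f. \<Sum>j\<in>UNIV. a 0 j * e j f)])" using vs v by simp
  also have "\<dots> = (\<Sum>j\<in>UNIV. a 0 j * \<omega> ((v # ws)[0 := e j]))"
    by (rule alt_sum[OF Suc.prems(1)]) (use vs wsT comb v Suc.prems(3) in auto)
  also have "\<dots> = (\<Sum>j\<in>UNIV. a 0 j * (\<Sum>js | length js = q. (\<Prod>i<q. a (Suc i) (js ! i)) * \<omega> (e j # map e js)))"
    by (rule sum.cong[OF refl], subst Suc.IH[OF alt_Cons[OF Suc.prems(1) Suc.prems(3)] vs(2) Suc.prems(3) ws, symmetric])
      simp_all
  also have "\<dots> = (\<Sum>(j, js)\<in>UNIV \<times> {js. length js = q}. (\<Prod>i<Suc q. a i ((j # js) ! i)) * \<omega> (map e (j # js)))"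
    by (simp add: sum_distrib_left sum.cartesian_product prod.lessThan_Suc_shift mult.assoc del: prod.lessThan_Suc)
  also have "\<dots> = (\<Sum>js\<in>(\<lambda>(j, js). j # js) ` (UNIV \<times> {js. length js = q}). (\<Prod>i<Suc q. a i (js ! i)) * \<omega> (map e js))"
    by (subst sum.reindex) (auto simp: inj_on_def case_prod_unfold)
  also have "(\<lambda>(j, js). j # js) ` (UNIV \<times> {js. length js = q}) = {js :: 'n list. length js = Suc q}"
    by (auto simp: image_iff length_Suc_conv)
  finally show ?case .
qed

end

context oriented_riemannian_manifold
begin

lemma same_planeD: "same_plane q x vs ws \<Longrightarrow> alternating_form_at q x \<omega> \<Longrightarrow> \<omega> vs = \<omega> ws"
  by (simp add: same_plane_def)

text \<open>
  The Cauchy-Schwarz inequality \<open>c\<^sup>2 \<le> g x w w\<close> for \<open>c = g x w e\<close>, combined with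
  \<open>\<bar>c\<bar> \<le> 1 + c\<^sup>2\<close>. This keeps square roots away from functions that have to stay smooth.
\<close>

lemma unit_cauchy_schwarz:
  assumes "w \<in> tangent x" "e \<in> tangent x" "g x e e = 1"
  shows "\<bar>g x w e\<bar> \<le> 1 + g x w w"
proof -
  define c where "c = g x w e"
  let ?v = "lincomb 1 w (- c) e"
  have v: "?v \<in> tangent x" by (intro lincomb_tangent assms)
  have ew: "g x e w = c" unfolding c_def by (rule metric_sym[OF assms(2,1)])
  have "g x ?v ?v = g x w ?v - c * g x e ?v"
    using metric_linear[OF assms(1,2) v, of 1 "- c"] by simp
  also have "g x w ?v = g x w w - c * c"
    using metric_linear_right[OF assms(1,2,1), of 1 "- c"] by (simp add: c_def)
  also have "g x e ?v = 0"
    using metric_linear_right[OF assms(1,2,2), of 1 "- c"] ew assms(3) by simp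
  finally have "c * c \<le> g x w w" using metric_nonneg[OF v] by simp
  moreover have "\<bar>c\<bar> \<le> 1 + c * c"
  proof -
    have "0 \<le> (\<bar>c\<bar> - 1) * (\<bar>c\<bar> - 1)" by simp
    also have "\<dots> = c * c - 2 * \<bar>c\<bar> + 1" by (simp add: algebra_simps)
    finally show ?thesis by linarith
  qed
  ultimately show ?thesis unfolding c_def by linarith
qed

text \<open>
  The coefficients of a vector \<open>e\<close> in the frame are \<open>e (x j) = g z (grad (x j) z) e\<close>. For a unit
  vector they are bounded in terms of the length of the gradient of \<open>x j\<close>, and this is bounded
  on \<open>Q\<close>.
\<close>

lemma frame_coefficients:
  fixes y0 :: 'a
  obtains N Q R and x :: "'n \<Rightarrow> 'a \<Rightarrow> real" and E :: "'n \<Rightarrow> 'a vfield" where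
    "open N" "y0 \<in> N" "N \<subseteq> Q" "compact Q" "\<And>j. E j \<in> vector_fields" "0 \<le> R"
    "\<And>z q es i. z \<in> Q \<Longrightarrow> orthonormal q z es \<Longrightarrow> i < q \<Longrightarrow>
       es ! i = (\<lambda>f. \<Sum>j\<in>UNIV. (es ! i) (x j) * E j z f)"
    "\<And>z q es i j. z \<in> Q \<Longrightarrow> orthonormal q z es \<Longrightarrow> i < q \<Longrightarrow> \<bar>(es ! i) (x j)\<bar> \<le> R"
proof -
  obtain N Q and x :: "'n \<Rightarrow> 'a \<Rightarrow> real" and E :: "'n \<Rightarrow> 'a vfield" where
    F: "open N" "y0 \<in> N" "N \<subseteq> Q" "compact Q" "\<And>j. x j \<in> smooth_functions" "\<And>j. E j \<in> vector_fields"
    "\<And>z v f. z \<in> Q \<Longrightarrow> v \<in> tangent z \<Longrightarrow> f \<in> smooth_functions \<Longrightarrow> v f = (\<Sum>j\<in>UNIV. v (x j) * E j z f)"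
    by (rule local_frame[of y0]) blast
  have gs: "(\<lambda>z. g z (grad (x j) z) (grad (x j) z)) \<in> smooth_functions" for j
    by (rule metric_smooth[OF grad_vf[OF F(5)] grad_vf[OF F(5)]])
  obtain B where B: "0 \<le> B" "\<And>j z. z \<in> Q \<Longrightarrow> \<bar>g z (grad (x j) z) (grad (x j) z)\<bar> \<le> B"
    by (rule smooth_family_bounded[of UNIV "\<lambda>j z. g z (grad (x j) z) (grad (x j) z)", OF finite gs F(4)]) blast
  have T: "es ! i \<in> tangent z" "g z (es ! i) (es ! i) = 1" if "orthonormal q z es" "i < q" for q z es i
    using that nth_in[of es "tangent z" i] by (auto simp: orthonormal_def)
  show thesis
  proof (rule that[of N Q E "1 + B" x])
    fix z q es i assume z: "z \<in> Q" and es: "orthonormal q z es" and i: "i < q"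
    show "es ! i = (\<lambda>f. \<Sum>j\<in>UNIV. (es ! i) (x j) * E j z f)"
    proof
      fix f show "(es ! i) f = (\<Sum>j\<in>UNIV. (es ! i) (x j) * E j z f)"
        using F(7)[OF z T(1)[OF es i], of f] tangent_nonsmooth[OF T(1)[OF es i], of f]
          tangent_nonsmooth[OF vf_tangent[OF F(6)], of f]
        by (cases "f \<in> smooth_functions") auto
    qed
    fix j
    have "(es ! i) (x j) = g z (grad (x j) z) (es ! i)"
      by (rule metric_grad[OF F(5) T(1)[OF es i], symmetric])
    then show "\<bar>(es ! i) (x j)\<bar> \<le> 1 + B"
      using unit_cauchy_schwarz[OF grad_tangent[OF F(5)] T[OF es i], of j] B(2)[OF z, of j] by linarith
  qed (use F B in auto)
qed

end

context calibrated_manifold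
begin

section \<open>The first cousin principle\<close>

lemma p_Suc: "Suc (p - 1) = p"
  using degree by simp

lemmas phi_alt = form_alt[OF form]

lemma phi_planes_orthonormal:
  assumes "\<xi> \<in> phi_planes x"
  obtains es where "orthonormal p x es" "same_plane p x es \<xi>" "\<phi> x es = 1"
proof -
  obtain es where es: "orthonormal p x es" "same_plane p x es \<xi>"
    using orthonormalize[of \<xi> p x thesis] orthonormalize[of \<xi> p x] assms unfolding phi_planes_def by blast
  moreover have "\<phi> x es = 1" using same_planeD[OF es(2) phi_alt] assms by (simp add: phi_planes_def)
  ultimately show thesis using that by blast
qed

lemma orthonormal_phi_plane: "orthonormal p x es \<Longrightarrow> \<phi> x es = 1 \<Longrightarrow> es \<in> phi_planes x"
  by (simp add: phi_planes_def orthonormal_unit_simple)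

text \<open>
  Tilt the \<open>i\<close>-th vector of the plane towards \<open>n\<close>. If \<open>a e\<^sub>i + b n\<close> is a unit vector, the list
  remains orthonormal and \<open>\<phi>\<close> has the value \<open>a + b s\<close> on it, where \<open>s = \<phi> x (es[i := n])\<close>. The
  maximum of this value subject to \<open>a\<^sup>2 + b\<^sup>2 M = 1\<close>, \<open>M = g x n n\<close>, is \<open>sqrt (1 + s\<^sup>2 / M)\<close>,
  which exceeds the comass unless \<open>s = 0\<close>.
\<close>

lemma first_cousin:
  assumes es: "orthonormal p x es" "\<phi> x es = 1" and n: "n \<in> tangent x"
    and perp: "\<And>j. j < p \<Longrightarrow> g x n (es ! j) = 0" and i: "i < p"
  shows "\<phi> x (es[i := n]) = 0"
proof (rule ccontr)
  define s where "s = \<phi> x (es[i := n])"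
  define M where "M = g x n n"
  assume "\<phi> x (es[i := n]) \<noteq> 0"
  then have s: "s \<noteq> 0" by (simp add: s_def)
  have l: "length es = p" "set es \<subseteq> tangent x"
    and on: "\<And>j k. j < p \<Longrightarrow> k < p \<Longrightarrow> g x (es ! j) (es ! k) = (if j = k then 1 else 0)"
    using es(1) by (auto simp: orthonormal_def)
  have T: "es ! j \<in> tangent x" if "j < p" for j using nth_in[OF l(2)] l(1) that by simp
  have perp': "g x (es ! j) n = 0" if "j < p" for j
    using perp[OF that] metric_sym[OF T[OF that] n] by simp
  have "n \<noteq> (\<lambda>f. 0)" using s alt_zero[OF phi_alt l i] unfolding s_def by metis
  then have M: "M > 0" unfolding M_def by (rule metric_pos[OF n])
  \<comment> \<open>\<open>r\<close> is the maximum of \<open>a + b * s\<close>, and \<open>a\<close> and \<open>b\<close> are the point where it is attained.\<close>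
  define r where "r = sqrt (1 + s\<^sup>2 / M)"
  have r2: "r\<^sup>2 = 1 + s\<^sup>2 / M" using M by (simp add: r_def)
  have r: "r > 1" using M s by (simp add: r_def)
  define a where "a = 1 / r"
  define b where "b = s / (M * r)"
  have "a\<^sup>2 + b\<^sup>2 * M = (1 + s\<^sup>2 / M) / r\<^sup>2"
    using M r by (simp add: a_def b_def power_divide power_mult_distrib field_simps power2_eq_square)
  then have ab: "a\<^sup>2 + b\<^sup>2 * M = 1" unfolding r2[symmetric] using r by simp
  have "a + b * s = (1 + s\<^sup>2 / M) / r"
    using M r by (simp add: a_def b_def field_simps power2_eq_square)
  then have abs: "a + b * s = r" unfolding r2[symmetric] using r by (simp add: power2_eq_square)
  let ?w = "lincomb a (es ! i) b n"
  have w: "?w \<in> tangent x" by (intro lincomb_tangent T i n)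
  have gw: "g x ?w (es ! j) = (if j = i then a else 0)" if "j < p" for j
    using metric_linear[OF T[OF i] n T[OF that], of a b] on[OF i that] perp[OF that] by simp
  have gn: "g x ?w n = b * M"
    using metric_linear[OF T[OF i] n n, of a b] perp'[OF i] by (simp add: M_def)
  have gww: "g x ?w ?w = 1"
    using metric_linear_right[OF T[OF i] n w, of a b] gw[OF i] gn ab by (simp add: power2_eq_square)
  have "orthonormal p x (es[i := ?w])"
    unfolding orthonormal_def
  proof (intro conjI allI impI)
    show "set (es[i := ?w]) \<subseteq> tangent x" by (rule set_update_subsetI[OF l(2) w])
    fix j k assume jk: "j < p" "k < p"
    have "g x (es ! j) ?w = (if j = i then a else 0)" if "j < p" for j
      using gw[OF that] metric_sym[OF w T[OF that]] by simp
    then show "g x (es[i := ?w] ! j) (es[i := ?w] ! k) = (if j = k then 1 else 0)"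
      using jk gw[OF jk(2)] gww on[OF jk] l(1) i by (cases "j = i"; cases "k = i") auto
  qed (use l in simp)
  then have "\<phi> x (es[i := ?w]) \<le> 1" by (intro comass orthonormal_unit_simple)
  moreover have "\<phi> x (es[i := ?w]) = a + b * s"
    using alt_lin[OF phi_alt l i T[OF i] n, of a b] es(2) by (simp add: s_def)
  ultimately show False using abs r by simp
qed

text \<open>
  Split \<open>w\<close> into components along the list and a normal rest. The component along \<open>es ! m\<close> with
  \<open>m \<noteq> i\<close> repeats an entry, the one along \<open>es ! i\<close> contributes its coefficient, and the normal
  rest contributes nothing by the first cousin principle.
\<close>

lemma phi_update:
  assumes es: "orthonormal p x es" "\<phi> x es = 1" and w: "w \<in> tangent x" and i: "i < p"
  shows "\<phi> x (es[i := w]) = g x w (es ! i)"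
proof -
  have l: "length es = p" "set es \<subseteq> tangent x"
    and on: "\<And>j k. j < p \<Longrightarrow> k < p \<Longrightarrow> g x (es ! j) (es ! k) = (if j = k then 1 else 0)"
    using es(1) by (auto simp: orthonormal_def)
  have T: "es ! j \<in> tangent x" if "j < p" for j using nth_in[OF l(2)] l(1) that by simp
  have ue: "\<phi> x (es[i := es ! m]) = (if m = i then 1 else 0)" if "m < p" for m
  proof (cases "m = i")
    case False
    have "\<phi> x (es[i := es ! m]) = 0"
      by (rule alt_eq[OF phi_alt, of _ _ i m])
        (use l i that False set_update_subsetI[OF l(2) T[OF that]] in auto)
    then show ?thesis using False by simp
  qed (use es(2) in simp)
  have "\<exists>n\<in>tangent x. (\<forall>j<m. g x n (es ! j) = 0) \<and>
      \<phi> x (es[i := n]) - g x n (es ! i) = \<phi> x (es[i := w]) - g x w (es ! i)" if "m \<le> p" for m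
    using that
  proof (induction m)
    case 0
    then show ?case using w by auto
  next
    case (Suc m)
    then obtain n where n: "n \<in> tangent x" "\<And>j. j < m \<Longrightarrow> g x n (es ! j) = 0"
      "\<phi> x (es[i := n]) - g x n (es ! i) = \<phi> x (es[i := w]) - g x w (es ! i)" by auto
    have m: "m < p" using Suc.prems by simp
    let ?c = "- g x n (es ! m)"
    let ?n = "lincomb 1 n ?c (es ! m)"
    have gj: "g x ?n (es ! j) = g x n (es ! j) + ?c * (if m = j then 1 else 0)" if "j < p" for j
      using metric_linear[OF n(1) T[OF m] T[OF that], of 1 ?c] on[OF m that] by simp
    have "\<phi> x (es[i := ?n]) = \<phi> x (es[i := n]) + ?c * (if m = i then 1 else 0)"
      using alt_lin[OF phi_alt l i n(1) T[OF m], of 1 ?c] ue[OF m] by simp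
    then have "\<phi> x (es[i := ?n]) - g x ?n (es ! i) = \<phi> x (es[i := w]) - g x w (es ! i)"
      using gj[OF i] n(3) by simp
    moreover have "g x ?n (es ! j) = 0" if "j < Suc m" for j
      using gj[of j] n(2)[of j] that m by (cases "j = m") auto
    moreover have "?n \<in> tangent x" by (intro lincomb_tangent n(1) T m)
    ultimately show ?case by blast
  qed
  from this[of p] obtain n where "n \<in> tangent x" "\<And>j. j < p \<Longrightarrow> g x n (es ! j) = 0"
      "\<phi> x (es[i := n]) - g x n (es ! i) = \<phi> x (es[i := w]) - g x w (es ! i)" by auto
  then show ?thesis using first_cousin[OF es _ _ i, of n] i by simp
qed

section \<open>The operator \<open>dd\<^sup>\<phi>\<close>\<close>

lemma d_phi_interior_product: "d_phi f = interior_product (grad f) \<phi>"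
  by (simp add: d_phi_def interior_product_def)

lemma d_phi_form: "f \<in> smooth_functions \<Longrightarrow> d_phi f \<in> smooth_forms (p - 1)"
  unfolding d_phi_interior_product using interior_product_form[of \<phi> "p - 1"] form grad_vf p_Suc by simp

lemma dd_phi_form: "f \<in> smooth_functions \<Longrightarrow> dd_phi f \<in> smooth_forms p"
  unfolding dd_phi_def using ext_deriv_form[OF d_phi_form] p_Suc by simp

lemma apply_dd_phi:
  "f \<in> smooth_functions \<Longrightarrow> length Vs = p \<Longrightarrow> set Vs \<subseteq> vector_fields \<Longrightarrow>
    apply_form (dd_phi f) Vs = d_formula (p - 1) (d_phi f) Vs"
  unfolding dd_phi_def using apply_ext_deriv[OF d_phi_form] p_Suc by simp

text \<open>
  The coefficients are functions, so this includes the gradient \<open>\<psi>' (u) grad u\<close> of a composition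
  \<open>\<psi> \<circ> u\<close>.
\<close>

lemma d_phi_lincomb:
  assumes fh: "f \<in> smooth_functions" "h \<in> smooth_functions"
    and F: "\<And>x. grad F x = lincomb (a x) (grad f x) (b x) (grad h x)"
  shows "d_phi F = (\<lambda>x vs. a x * d_phi f x vs + b x * d_phi h x vs)"
proof (intro ext)
  fix x vs
  show "d_phi F x vs = a x * d_phi f x vs + b x * d_phi h x vs"
  proof (cases "Suc (length vs) = p \<and> set vs \<subseteq> tangent x")
    case True
    then show ?thesis
      using alt_lin[OF phi_alt, of "grad f x # vs" x 0 "grad f x" "grad h x" "a x" "b x"]
        grad_tangent[OF fh(1)] grad_tangent[OF fh(2)] degree by (simp add: d_phi_def F)
  next
    case False
    have "\<phi> x (v # vs) = 0" for v
      by (rule alt_out[OF phi_alt]) (use False in auto)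
    then show ?thesis by (simp add: d_phi_def)
  qed
qed

text \<open>
  The Leibniz rule; the sum is \<open>(da \<and> d\<^sup>\<phi> f + db \<and> d\<^sup>\<phi> h)\<close> evaluated on \<open>Vs\<close>.
\<close>

lemma apply_dd_phi_lincomb:
  assumes fh: "f \<in> smooth_functions" "h \<in> smooth_functions" "F \<in> smooth_functions"
    and ab: "a \<in> smooth_functions" "b \<in> smooth_functions"
    and F: "\<And>x. grad F x = lincomb (a x) (grad f x) (b x) (grad h x)"
    and Vs: "length Vs = p" "set Vs \<subseteq> vector_fields"
  shows "apply_form (dd_phi F) Vs x = a x * apply_form (dd_phi f) Vs x + b x * apply_form (dd_phi h) Vs x +
    (\<Sum>i<p. (-1) ^ i * ((Vs ! i) x a * apply_form (d_phi f) (remove_nth i Vs) x +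
      (Vs ! i) x b * apply_form (d_phi h) (remove_nth i Vs) x))"
proof -
  have "{..p - 1} = {..<p}" using degree by auto
  then show ?thesis
    using d_formula_lincomb[OF d_phi_form[OF fh(1)] d_phi_form[OF fh(2)] ab, of Vs x] Vs p_Suc
    by (simp add: apply_dd_phi fh d_phi_lincomb[OF fh(1,2) F])
qed

lemma dd_phi_lincomb:
  assumes fh: "f \<in> smooth_functions" "h \<in> smooth_functions"
  shows "dd_phi (\<lambda>y. a * f y + b * h y) = (\<lambda>x vs. a * dd_phi f x vs + b * dd_phi h x vs)"
proof -
  let ?F = "\<lambda>y. a * f y + b * h y"
  have F: "?F \<in> smooth_functions" by (intro smooth_add smooth_cmult fh)
  have gr: "grad ?F x = lincomb a (grad f x) b (grad h x)" for x
  proof (rule grad_eqI[OF F])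
    show "lincomb a (grad f x) b (grad h x) \<in> tangent x" by (intro lincomb_tangent grad_tangent fh)
    show "g x (lincomb a (grad f x) b (grad h x)) w = w ?F" if "w \<in> tangent x" for w
      using metric_linear[OF grad_tangent[OF fh(1)] grad_tangent[OF fh(2)] that] that
      by (simp add: metric_grad fh tangent_linear)
  qed
  have R: "(\<lambda>x vs. a * dd_phi f x vs + b * dd_phi h x vs) \<in> smooth_forms p"
    by (rule form_lincomb[OF dd_phi_form[OF fh(1)] dd_phi_form[OF fh(2)] smooth_const smooth_const])
  show ?thesis
  proof (rule form_eqI[OF form_alt[OF dd_phi_form[OF F]] form_alt[OF R]])
    fix Vs :: "'a vfield list" assume Vs: "length Vs = p" "set Vs \<subseteq> vector_fields"
    have z: "(Vs ! i) x (\<lambda>_. c) = 0" if "i < p" for i c x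
      using tangent_const[OF vf_tangent[OF nth_in[OF Vs(2)]]] Vs(1) that by simp
    show "apply_form (dd_phi ?F) Vs = apply_form (\<lambda>x vs. a * dd_phi f x vs + b * dd_phi h x vs) Vs"
      using apply_dd_phi_lincomb[OF fh F smooth_const smooth_const gr Vs] z
      by (simp add: apply_form_def[abs_def])
  qed
qed

lemma dd_phi_const: "dd_phi (\<lambda>_. c) = (\<lambda>x vs. 0)"
proof -
  have z: "grad (\<lambda>_. c) x = (\<lambda>f. 0)" for x and c :: real
    by (rule grad_eqI[OF smooth_const zero_tangent])
      (use metric_zero metric_sym zero_tangent in \<open>simp add: tangent_const\<close>)
  have "d_phi (\<lambda>_. c) = d_phi (\<lambda>_. 0)" by (simp add: d_phi_def z)
  then have "dd_phi (\<lambda>_. c) = dd_phi (\<lambda>_. 0)" by (simp add: dd_phi_def)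
  also have "\<dots> = (\<lambda>x vs. 0)"
    using dd_phi_lincomb[OF smooth_const smooth_const, of 0 0 0 0] by simp
  finally show ?thesis .
qed

lemma dd_phi_local_zero:
  assumes f: "f \<in> smooth_functions" and N: "open N" "y \<in> N" "\<And>z. z \<in> N \<Longrightarrow> f z = 0"
  shows "dd_phi f y vs = 0"
proof (cases "length vs = p \<and> set vs \<subseteq> tangent y")
  case True
  then obtain Vs where Vs: "set Vs \<subseteq> vector_fields" "length Vs = p" "map (\<lambda>V. V y) Vs = vs"
    by (metis map_tangent_ext)
  have gr: "grad f z = (\<lambda>h. 0)" if z: "z \<in> N" for z
  proof (rule grad_eqI[OF f zero_tangent])
    fix w assume w: "w \<in> tangent z"
    have "w f = 0" by (rule tangent_local_zero[OF w N(1) z N(3)])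
    then show "g z (\<lambda>h. 0) w = w f" using metric_zero[OF w] metric_sym[OF zero_tangent w] by simp
  qed
  have ph0: "\<phi> z ((\<lambda>h. 0) # ws) = 0" for z ws
  proof (cases "Suc (length ws) = p \<and> set ws \<subseteq> tangent z")
    case True
    then show ?thesis
      using alt_zero[OF phi_alt, of "(\<lambda>h. 0) # ws" z 0] zero_tangent degree by simp
  next
    case False
    show ?thesis by (rule alt_out[OF phi_alt]) (use False in auto)
  qed
  have d0: "apply_form (d_phi f) Ws z = 0" if "z \<in> N" for Ws z
    by (simp add: apply_form_def d_phi_def gr[OF that] ph0)
  have "(Vs ! i) y (apply_form (d_phi f) Ws) = 0" if "i \<le> p - 1" for i Ws
    by (rule tangent_local_zero[OF vf_tangent[OF nth_in[OF Vs(1)]] N(1,2)]) (use that degree Vs(2) d0 in auto)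
  then have "d_formula (p - 1) (d_phi f) Vs y = 0"
    unfolding d_formula_def using d0[OF N(2)] by simp
  then show ?thesis using apply_dd_phi[OF f Vs(2,1)] Vs(3) by (metis apply_form_def)
next
  case False
  then show ?thesis by (rule alt_out[OF form_alt[OF dd_phi_form[OF f]]])
qed

lemma dd_phi_local:
  assumes "f \<in> smooth_functions" "h \<in> smooth_functions" "open N" "y \<in> N" "\<And>z. z \<in> N \<Longrightarrow> f z = h z"
  shows "dd_phi f y vs = dd_phi h y vs"
  using dd_phi_local_zero[OF smooth_diff[OF assms(1,2)] assms(3,4), of vs]
    dd_phi_lincomb[OF assms(1,2), of 1 "-1"] assms(5) by simp

text \<open>
  The Leibniz rule for \<open>d\<^sup>\<phi> (\<psi> \<circ> u) = \<psi>1 (u) d\<^sup>\<phi> u\<close> leaves the term \<open>\<psi>2 (u) (du \<and> d\<^sup>\<phi> u)\<close>. On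
  the plane spanned by \<open>es\<close>, the \<open>i\<close>-th coefficient of \<open>d\<^sup>\<phi> u\<close> is, up to sign, \<open>\<phi>\<close> with the
  gradient in the \<open>i\<close>-th slot, and by \<open>phi_update\<close> this is \<open>(es ! i) u\<close>. So \<open>du \<and> d\<^sup>\<phi> u\<close> becomes
  a sum of squares.
\<close>

lemma dd_phi_comp:
  assumes u: "u \<in> smooth_functions" and \<psi>: "smooth_on UNIV \<psi>"
    and d1: "\<And>t. (\<psi> has_real_derivative \<psi>1 t) (at t)" and d2: "\<And>t. (\<psi>1 has_real_derivative \<psi>2 t) (at t)"
    and es: "orthonormal p x es" "\<phi> x es = 1"
  shows "dd_phi (\<lambda>y. \<psi> (u y)) x es = \<psi>1 (u x) * dd_phi u x es + \<psi>2 (u x) * (\<Sum>i<p. ((es ! i) u)\<^sup>2)"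
proof -
  have "\<psi>1 = deriv \<psi>" using DERIV_imp_deriv[OF d1] by auto
  then have \<psi>1: "smooth_on UNIV \<psi>1" using smooth_on_real_deriv(1)[OF \<psi>] by simp
  have F: "(\<lambda>y. \<psi> (u y)) \<in> smooth_functions" and F1: "(\<lambda>y. \<psi>1 (u y)) \<in> smooth_functions"
    by (rule smooth_comp_real[OF u open_UNIV \<psi>] smooth_comp_real[OF u open_UNIV \<psi>1]; simp)+
  have gr: "grad (\<lambda>y. \<psi> (u y)) z = lincomb (\<psi>1 (u z)) (grad u z) 0 (grad u z)" for z
  proof (rule grad_eqI[OF F])
    show "lincomb (\<psi>1 (u z)) (grad u z) 0 (grad u z) \<in> tangent z" by (intro lincomb_tangent grad_tangent u)
    show "g z (lincomb (\<psi>1 (u z)) (grad u z) 0 (grad u z)) w = w (\<lambda>y. \<psi> (u y))" if "w \<in> tangent z" for w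
      using metric_linear[OF grad_tangent[OF u] grad_tangent[OF u] that, of "\<psi>1 (u z)" 0]
        metric_grad[OF u that] tangent_comp_real[OF that u \<psi> d1] by simp
  qed
  have l: "length es = p" "set es \<subseteq> tangent x" using es(1) by (auto simp: orthonormal_def)
  have T: "es ! j \<in> tangent x" if "j < p" for j using nth_in[OF l(2)] l(1) that by simp
  obtain Vs where Vs: "set Vs \<subseteq> vector_fields" "length Vs = p" "map (\<lambda>V. V x) Vs = es"
    using l by (metis map_tangent_ext)
  have ap: "apply_form \<omega> Vs x = \<omega> x es" for \<omega> by (simp add: apply_form_def Vs(3))
  have Vi: "(Vs ! i) x = es ! i" if "i < p" for i using Vs(2,3) that by (metis nth_map)
  have summand: "(-1) ^ i * ((Vs ! i) x (\<lambda>y. \<psi>1 (u y)) * apply_form (d_phi u) (remove_nth i Vs) x +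
      (Vs ! i) x (\<lambda>_. 0) * apply_form (d_phi u) (remove_nth i Vs) x) = \<psi>2 (u x) * ((es ! i) u)\<^sup>2" if i: "i < p" for i
  proof -
    have "apply_form (d_phi u) (remove_nth i Vs) x = \<phi> x (grad u x # remove_nth i es)"
      by (simp add: apply_form_def d_phi_def map_remove_nth Vs(3))
    also have "\<dots> = (-1) ^ i * \<phi> x (es[i := grad u x])"
      by (rule alt_move[OF phi_alt l i grad_tangent[OF u]])
    also have "\<phi> x (es[i := grad u x]) = (es ! i) u"
      using phi_update[OF es grad_tangent[OF u] i] metric_grad[OF u T[OF i]] by simp
    finally have 1: "apply_form (d_phi u) (remove_nth i Vs) x = (-1) ^ i * (es ! i) u" .
    have 2: "(Vs ! i) x (\<lambda>y. \<psi>1 (u y)) = \<psi>2 (u x) * (es ! i) u"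
      unfolding Vi[OF i] by (rule tangent_comp_real[OF T[OF i] u \<psi>1 d2])
    have 3: "(Vs ! i) x (\<lambda>_. 0) = 0" unfolding Vi[OF i] by (rule tangent_const[OF T[OF i]])
    have "(-1) ^ i * ((-1) ^ i :: real) = 1" by (simp flip: power_mult_distrib)
    then show ?thesis unfolding 1 2 3 by (simp add: power2_eq_square mult.left_commute[of "(-1) ^ i"] mult.assoc[symmetric])
  qed
  have "(\<Sum>i<p. (-1) ^ i * ((Vs ! i) x (\<lambda>y. \<psi>1 (u y)) * apply_form (d_phi u) (remove_nth i Vs) x +
      (Vs ! i) x (\<lambda>_. 0) * apply_form (d_phi u) (remove_nth i Vs) x)) = (\<Sum>i<p. \<psi>2 (u x) * ((es ! i) u)\<^sup>2)"
    by (rule sum.cong[OF refl], rule summand) simp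
  then show ?thesis
    using apply_dd_phi_lincomb[OF u u F F1 smooth_const[of 0] gr Vs(2,1), of x]
    by (simp add: ap sum_distrib_left)
qed

end

section \<open>Uniform estimates on planes over compact sets\<close>

lemma compact_cover_induct:
  assumes L: "compact L" and local: "\<And>y. \<exists>N. open N \<and> y \<in> N \<and> P N"
    and "P {}" and Un: "\<And>A B. P A \<Longrightarrow> P B \<Longrightarrow> P (A \<union> B)" and subset: "\<And>A B. P A \<Longrightarrow> B \<subseteq> A \<Longrightarrow> P B"
  shows "P L"
proof -
  let ?C = "{N. open N \<and> P N}"
  have "L \<subseteq> \<Union>?C"
  proof
    fix y
    from local[of y] obtain N where "open N \<and> y \<in> N \<and> P N" ..
    then show "y \<in> \<Union>?C" by (intro UnionI[of N]) auto
  qed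
  then obtain D where D: "D \<subseteq> ?C" "finite D" "L \<subseteq> \<Union>D"
    using compactE[OF L, of ?C] by (metis (no_types, lifting) mem_Collect_eq)
  have "P (\<Union>D)" using D(2,1)
    by (induction D rule: finite_induct) (simp_all add: assms(3) Un)
  then show ?thesis using subset D(3) by simp
qed

context calibrated_manifold
begin

text \<open>
  The lists in \<open>Es\<close> give seminorms of order zero as in the definition of a current, and these
  dominate the values on \<open>\<phi>\<close>-planes over \<open>S\<close>.
\<close>

definition controls :: "'a vfield list set \<Rightarrow> real \<Rightarrow> 'a set \<Rightarrow> bool" where
  "controls Es R S \<longleftrightarrow> 0 \<le> R \<and> finite Es \<and> (\<forall>Ws\<in>Es. length Ws = p \<and> set Ws \<subseteq> vector_fields) \<and>
    (\<forall>\<alpha>\<in>smooth_forms p. \<forall>z\<in>S. \<forall>C\<ge>0. (\<forall>Ws\<in>Es. \<bar>apply_form \<alpha> Ws z\<bar> \<le> C) \<longrightarrow>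
      (\<forall>\<xi>\<in>phi_planes z. \<bar>\<alpha> z \<xi>\<bar> \<le> R * C))"

text \<open>
  Expand the \<open>\<phi>\<close>-plane, given by an orthonormal list, in a local frame; the coefficients are
  bounded.
\<close>

lemma controls_local:
  fixes y0 :: 'a
  obtains N R Es where "open N" "y0 \<in> N" "controls Es R N"
proof -
  obtain N Q R and x :: "'n \<Rightarrow> 'a \<Rightarrow> real" and E :: "'n \<Rightarrow> 'a vfield" where
    F: "open N" "y0 \<in> N" "N \<subseteq> Q" "compact Q" "\<And>j. E j \<in> vector_fields" "0 \<le> R"
    "\<And>z q es i. z \<in> Q \<Longrightarrow> orthonormal q z es \<Longrightarrow> i < q \<Longrightarrow>
       es ! i = (\<lambda>f. \<Sum>j\<in>UNIV. (es ! i) (x j) * E j z f)"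
    "\<And>z q es i j. z \<in> Q \<Longrightarrow> orthonormal q z es \<Longrightarrow> i < q \<Longrightarrow> \<bar>(es ! i) (x j)\<bar> \<le> R"
    by (rule frame_coefficients[of y0]) blast
  let ?J = "{js :: 'n list. length js = p}"
  have J: "finite ?J" using finite_lists_length_eq[of "UNIV :: 'n set" p] by simp
  have "\<bar>\<alpha> z \<xi>\<bar> \<le> real (card ?J) * R ^ p * C"
    if \<alpha>: "\<alpha> \<in> smooth_forms p" and z: "z \<in> N" and \<xi>: "\<xi> \<in> phi_planes z"
      and C: "\<forall>Ws\<in>map E ` ?J. \<bar>apply_form \<alpha> Ws z\<bar> \<le> C" for \<alpha> z \<xi> C
  proof -
    have zQ: "z \<in> Q" using z F by auto
    obtain es where es: "orthonormal p z es" and \<xi>es: "same_plane p z es \<xi>" by (rule phi_planes_orthonormal[OF \<xi>])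
    have le: "length es = p" using es by (simp add: orthonormal_def)
    let ?t = "\<lambda>js. (\<Prod>i<p. (es ! i) (x (js ! i))) * \<alpha> z (map (\<lambda>j. E j z) js)"
    have "\<alpha> z \<xi> = \<alpha> z es" by (rule same_planeD[OF \<xi>es form_alt[OF \<alpha>], symmetric])
    also have "\<dots> = (\<Sum>js\<in>?J. ?t js)"
      by (rule alt_expand[OF form_alt[OF \<alpha>] le]) (auto intro: vf_tangent F(5) F(7)[OF zQ es])
    also have "\<bar>\<dots>\<bar> \<le> (\<Sum>js\<in>?J. \<bar>?t js\<bar>)" by (rule sum_abs)
    also have "\<dots> \<le> (\<Sum>js\<in>?J. R ^ p * C)"
    proof (rule sum_mono)
      fix js assume js: "js \<in> ?J"
      have "\<bar>\<Prod>i<p. (es ! i) (x (js ! i))\<bar> \<le> (\<Prod>i<p. R)"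
        unfolding abs_prod by (rule prod_mono) (use F(8)[OF zQ es] in auto)
      moreover have "\<bar>\<alpha> z (map (\<lambda>j. E j z) js)\<bar> \<le> C"
        using bspec[OF C, of "map E js"] js by (simp add: apply_form_def o_def)
      ultimately show "\<bar>?t js\<bar> \<le> R ^ p * C"
        unfolding abs_mult using F(6) by (intro mult_mono) auto
    qed
    finally show ?thesis by simp
  qed
  then have "controls (map E ` ?J) (real (card ?J) * R ^ p) N"
    unfolding controls_def using F(5,6) J by auto
  then show thesis using that F(1,2) by blast
qed

lemma controls_Un:
  assumes "controls Es R S" "controls Es' R' S'" shows "controls (Es \<union> Es') (R + R') (S \<union> S')"
proof -
  have R: "0 \<le> R" "0 \<le> R'" using assms by (auto simp: controls_def)
  have "\<bar>\<alpha> z \<xi>\<bar> \<le> (R + R') * C"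
    if h: "\<alpha> \<in> smooth_forms p" "z \<in> S \<union> S'" "C \<ge> 0" "\<forall>Ws\<in>Es \<union> Es'. \<bar>apply_form \<alpha> Ws z\<bar> \<le> C" "\<xi> \<in> phi_planes z"
    for \<alpha> z C \<xi>
  proof -
    have "\<bar>\<alpha> z \<xi>\<bar> \<le> R * C \<or> \<bar>\<alpha> z \<xi>\<bar> \<le> R' * C" using assms h unfolding controls_def by blast
    moreover have "R * C \<le> (R + R') * C" "R' * C \<le> (R + R') * C" using R h(3) by (auto intro: mult_right_mono)
    ultimately show ?thesis by linarith
  qed
  moreover have "finite (Es \<union> Es')" "\<forall>Ws\<in>Es \<union> Es'. length Ws = p \<and> set Ws \<subseteq> vector_fields"
    using assms unfolding controls_def by blast+
  ultimately show ?thesis using R unfolding controls_def by auto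
qed

lemma controls_compact:
  assumes "compact L" obtains R Es where "controls Es R L"
proof -
  have "\<exists>R Es. controls Es R L"
  proof (rule compact_cover_induct[OF assms])
    show "\<exists>N. open N \<and> y \<in> N \<and> (\<exists>R Es. controls Es R N)" for y
      by (rule controls_local[of y]) blast
    have "controls {} 0 {}" by (simp add: controls_def)
    then show "\<exists>R Es. controls Es R {}" by blast
    show "\<exists>R Es. controls Es R (A \<union> B)" if "\<exists>R Es. controls Es R A" "\<exists>R Es. controls Es R B" for A B
      using that controls_Un by blast
    show "\<exists>R Es. controls Es R B" if "\<exists>R Es. controls Es R A" "B \<subseteq> A" for A B
      using that unfolding controls_def by (meson subsetD)
  qed
  then show thesis using that by blast
qed

lemma controlsD:
  "controls Es R S \<Longrightarrow> \<alpha> \<in> smooth_forms p \<Longrightarrow> z \<in> S \<Longrightarrow> 0 \<le> C \<Longrightarrow> (\<And>Ws. Ws \<in> Es \<Longrightarrow> \<bar>apply_form \<alpha> Ws z\<bar> \<le> C) \<Longrightarrow>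
    \<xi> \<in> phi_planes z \<Longrightarrow> \<bar>\<alpha> z \<xi>\<bar> \<le> R * C"
  unfolding controls_def by blast

lemma form_bounded_on_planes:
  assumes "compact L" "\<alpha> \<in> smooth_forms p"
  obtains B where "0 \<le> B" "\<And>z \<xi>. z \<in> L \<Longrightarrow> \<xi> \<in> phi_planes z \<Longrightarrow> \<bar>\<alpha> z \<xi>\<bar> \<le> B"
proof -
  obtain R Es where c: "controls Es R L" by (rule controls_compact[OF assms(1)])
  have R: "0 \<le> R" "finite Es" "\<And>Ws. Ws \<in> Es \<Longrightarrow> length Ws = p \<and> set Ws \<subseteq> vector_fields"
    using c by (auto simp: controls_def)
  have "apply_form \<alpha> Ws \<in> smooth_functions" if "Ws \<in> Es" for Ws
    using R(3)[OF that] form_smooth[OF assms(2)] by simp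
  then obtain C where C: "0 \<le> C" "\<And>Ws z. Ws \<in> Es \<Longrightarrow> z \<in> L \<Longrightarrow> \<bar>apply_form \<alpha> Ws z\<bar> \<le> C"
    by (rule smooth_family_bounded[OF R(2) _ assms(1), of "apply_form \<alpha>"]) blast+
  show thesis
  proof (rule that[of "R * C"])
    show "0 \<le> R * C" using R C by simp
    show "\<bar>\<alpha> z \<xi>\<bar> \<le> R * C" if "z \<in> L" "\<xi> \<in> phi_planes z" for z \<xi>
      by (rule controlsD[OF c assms(2) that(1) C(1) C(2)[OF _ that(1)] that(2)])
  qed
qed

text \<open>
  Tychonoff's theorem. The first index ranges over all natural numbers so that the set is a
  product of intervals over a type.
\<close>

lemma compact_coefficients: "compact {a :: nat \<Rightarrow> 'n \<Rightarrow> real. \<forall>i j. a i j \<in> {- R..R}}"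
proof -
  have 1: "compact (PiE UNIV (\<lambda>_. {- R..R}) :: ('n \<Rightarrow> real) set)"
    using compactin_PiE[of "\<lambda>_. euclidean" UNIV "\<lambda>_::'n. {- R..R}"] by (simp add: euclidean_product_topology)
  have "compact (PiE UNIV (\<lambda>_. PiE UNIV (\<lambda>_. {- R..R})) :: (nat \<Rightarrow> 'n \<Rightarrow> real) set)"
    using compactin_PiE[of "\<lambda>_. euclidean" UNIV "\<lambda>_::nat. PiE UNIV (\<lambda>_::'n. {- R..R})"] 1
    by (simp add: euclidean_product_topology)
  moreover have "(PiE UNIV (\<lambda>_. PiE UNIV (\<lambda>_. {- R..R})) :: (nat \<Rightarrow> 'n \<Rightarrow> real) set) = {a. \<forall>i j. a i j \<in> {- R..R}}"
    by (auto simp: PiE_def Pi_def)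
  ultimately show ?thesis by simp
qed

text \<open>
  Over \<open>Q\<close>, the \<open>\<phi>\<close>-planes are parametrised by pairs of a point and a matrix of coefficients
  with respect to the frame. Those that give orthonormal lists on which \<open>\<phi>\<close> is \<open>1\<close> form a
  compact set, so the positive continuous function given by \<open>\<alpha>\<close> has a positive minimum there.
\<close>

lemma strict_local:
  fixes y0 :: 'a
  assumes \<alpha>: "\<alpha> \<in> smooth_forms p" and pos: "\<And>z \<xi>. \<xi> \<in> phi_planes z \<Longrightarrow> \<alpha> z \<xi> > 0"
  obtains N c where "open N" "y0 \<in> N" "0 < c" "\<And>z \<xi>. z \<in> N \<Longrightarrow> \<xi> \<in> phi_planes z \<Longrightarrow> c \<le> \<alpha> z \<xi>"
proof -
  obtain N Q R and x :: "'n \<Rightarrow> 'a \<Rightarrow> real" and E :: "'n \<Rightarrow> 'a vfield" where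
    F: "open N" "y0 \<in> N" "N \<subseteq> Q" "compact Q" "\<And>j. E j \<in> vector_fields" "0 \<le> R"
    "\<And>z q es i. z \<in> Q \<Longrightarrow> orthonormal q z es \<Longrightarrow> i < q \<Longrightarrow>
       es ! i = (\<lambda>f. \<Sum>j\<in>UNIV. (es ! i) (x j) * E j z f)"
    "\<And>z q es i j. z \<in> Q \<Longrightarrow> orthonormal q z es \<Longrightarrow> i < q \<Longrightarrow> \<bar>(es ! i) (x j)\<bar> \<le> R"
    by (rule frame_coefficients[of y0]) blast
  let ?J = "{js :: 'n list. length js = p}"
  have ET: "E j z \<in> tangent z" for j z by (rule vf_tangent[OF F(5)])
  define A where "A z a i = (\<lambda>f. \<Sum>j\<in>UNIV. a i j * E j z f)" for z and a :: "nat \<Rightarrow> 'n \<Rightarrow> real" and i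
  define vs where "vs z a = map (A z a) [0..<p]" for z and a :: "nat \<Rightarrow> 'n \<Rightarrow> real"
  have AT: "A z a i \<in> tangent z" for z a i unfolding A_def by (rule sum_tangent) (auto simp: ET)
  have vsT: "length (vs z a) = p" "set (vs z a) \<subseteq> tangent z" "\<And>i. i < p \<Longrightarrow> vs z a ! i = A z a i" for z a
    using AT by (auto simp: vs_def)
  have smc: "continuous_on UNIV (\<lambda>w::'a \<times> (nat \<Rightarrow> 'n \<Rightarrow> real). f (fst w))" if "f \<in> smooth_functions" for f
    by (rule continuous_on_compose2[OF smooth_continuous[OF that]]) (auto intro: continuous_intros)
  have coc: "continuous_on UNIV (\<lambda>w::'a \<times> (nat \<Rightarrow> 'n \<Rightarrow> real). snd w i j)" for i j
  proof -
    have "continuous_on UNIV (\<lambda>a::nat \<Rightarrow> 'n \<Rightarrow> real. a i j)"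
      by (rule continuous_on_compose2[OF continuous_on_product_coordinates[of j] continuous_on_product_coordinates[of i]]) auto
    then show ?thesis by (rule continuous_on_compose2) (auto intro: continuous_intros)
  qed
  have form_cont: "continuous_on UNIV (\<lambda>w. \<beta> (fst w) (vs (fst w) (snd w)))" if \<beta>: "\<beta> \<in> smooth_forms p" for \<beta>
  proof -
    have "\<beta> z (vs z a) = (\<Sum>js\<in>?J. (\<Prod>i<p. a i (js ! i)) * apply_form \<beta> (map E js) z)" for z a
    proof -
      have "\<beta> z (vs z a) = (\<Sum>js\<in>?J. (\<Prod>i<p. a i (js ! i)) * \<beta> z (map (\<lambda>j. E j z) js))"
        by (rule alt_expand[OF form_alt[OF \<beta>] vsT(1) ET]) (simp add: vsT(3) A_def)
      then show ?thesis by (simp add: apply_form_def o_def)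
    qed
    moreover have "continuous_on UNIV (\<lambda>w. \<Sum>js\<in>?J. (\<Prod>i<p. snd w i (js ! i)) * apply_form \<beta> (map E js) (fst w))"
      by (intro continuous_on_sum continuous_on_mult continuous_on_prod coc smc form_smooth[OF \<beta>])
        (use F(5) in auto)
    ultimately show ?thesis by simp
  qed
  have g_cont: "continuous_on UNIV (\<lambda>w. g (fst w) (A (fst w) (snd w) i) (A (fst w) (snd w) k))" for i k
  proof -
    have "g z (A z a i) (A z a k) = (\<Sum>l\<in>UNIV. a k l * (\<Sum>j\<in>UNIV. a i j * g z (E j z) (E l z)))" for z a
    proof -
      have gE: "g z (A z a i) (E l z) = (\<Sum>j\<in>UNIV. a i j * g z (E j z) (E l z))" for l
      proof -
        have "g z (A z a i) (E l z) = g z (E l z) (A z a i)" by (rule metric_sym[OF AT ET])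
        also have "\<dots> = (\<Sum>j\<in>UNIV. a i j * g z (E l z) (E j z))"
          unfolding A_def by (rule metric_sum[OF ET]) (auto simp: ET)
        also have "\<dots> = (\<Sum>j\<in>UNIV. a i j * g z (E j z) (E l z))"
          by (rule sum.cong[OF refl], rule arg_cong[OF metric_sym[OF ET ET]])
        finally show ?thesis .
      qed
      have gR: "g z w (A z a k) = (\<Sum>l\<in>UNIV. a k l * g z w (E l z))" if "w \<in> tangent z" for w
        unfolding A_def by (rule metric_sum[OF that]) (auto simp: ET)
      have "g z (A z a i) (A z a k) = (\<Sum>l\<in>UNIV. a k l * g z (A z a i) (E l z))"
        by (rule gR[OF AT])
      also have "\<dots> = (\<Sum>l\<in>UNIV. a k l * (\<Sum>j\<in>UNIV. a i j * g z (E j z) (E l z)))"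
        by (simp only: gE)
      finally show ?thesis .
    qed
    moreover have "continuous_on UNIV (\<lambda>w. \<Sum>l\<in>UNIV. snd w k l * (\<Sum>j\<in>UNIV. snd w i j * g (fst w) (E j (fst w)) (E l (fst w))))"
      by (intro continuous_on_sum continuous_on_mult coc smc metric_smooth[OF F(5) F(5)])
    ultimately show ?thesis by simp
  qed
  define Z where "Z = (Q \<times> {a. \<forall>i j. a i j \<in> {- R..R}}) \<inter>
    ({w. \<forall>i\<in>{..<p}. \<forall>k\<in>{..<p}. g (fst w) (A (fst w) (snd w) i) (A (fst w) (snd w) k) = (if i = k then 1 else 0)} \<inter>
     {w. \<phi> (fst w) (vs (fst w) (snd w)) = 1})"
  have "closed {w. \<forall>i\<in>{..<p}. \<forall>k\<in>{..<p}. g (fst w) (A (fst w) (snd w) i) (A (fst w) (snd w) k) = (if i = k then 1 else (0::real))}"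
    unfolding Ball_def by (intro closed_Collect_all closed_Collect_imp open_Collect_const closed_Collect_eq g_cont continuous_on_const)
  moreover have "closed {w. \<phi> (fst w) (vs (fst w) (snd w)) = 1}"
    by (intro closed_Collect_eq form_cont form continuous_on_const)
  ultimately have Z: "compact Z"
    unfolding Z_def by (intro compact_Int_closed compact_Times F(4) compact_coefficients closed_Int)
  have Zpos: "\<alpha> (fst w) (vs (fst w) (snd w)) > 0" if "w \<in> Z" for w
  proof (rule pos, rule orthonormal_phi_plane)
    show "orthonormal p (fst w) (vs (fst w) (snd w))"
      unfolding orthonormal_def using that vsT(2) by (auto simp: Z_def vsT(1) vsT(3))
    show "\<phi> (fst w) (vs (fst w) (snd w)) = 1" using that by (simp add: Z_def)
  qed
  obtain c where c: "0 < c" "\<And>w. w \<in> Z \<Longrightarrow> c \<le> \<alpha> (fst w) (vs (fst w) (snd w))"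
  proof (cases "Z = {}")
    case True
    then show thesis using that[of 1] by simp
  next
    case False
    then obtain w where "w \<in> Z" "\<forall>w'\<in>Z. \<alpha> (fst w) (vs (fst w) (snd w)) \<le> \<alpha> (fst w') (vs (fst w') (snd w'))"
      using continuous_attains_inf[OF Z False continuous_on_subset[OF form_cont[OF \<alpha>]]] by auto
    then show thesis using that Zpos by blast
  qed
  show thesis
  proof (rule that[OF F(1,2) c(1)])
    fix z \<xi> assume z: "z \<in> N" and \<xi>: "\<xi> \<in> phi_planes z"
    have zQ: "z \<in> Q" using z F by auto
    obtain es where es: "orthonormal p z es" "same_plane p z es \<xi>" "\<phi> z es = 1"
      by (rule phi_planes_orthonormal[OF \<xi>])
    \<comment> \<open>Only the rows below \<open>p\<close> enter the list; zeros keep the others within the bounds.\<close>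
    define a where "a i j = (if i < p then (es ! i) (x j) else 0)" for i j
    have A_es: "A z a i = es ! i" if "i < p" for i
      using F(7)[OF zQ es(1) that] that by (simp add: A_def a_def)
    have "vs z a = es"
      by (rule nth_equalityI) (use es(1) A_es in \<open>auto simp: orthonormal_def vsT(1) vsT(3)\<close>)
    moreover have "(z, a) \<in> Z"
      using zQ F(6) F(8)[OF zQ es(1)] es(1,3) A_es \<open>vs z a = es\<close>
      by (auto simp: Z_def a_def orthonormal_def abs_le_iff minus_le_iff)
    ultimately have "c \<le> \<alpha> z es" using c(2)[of "(z, a)"] by simp
    then show "c \<le> \<alpha> z \<xi>" using same_planeD[OF es(2) form_alt[OF \<alpha>]] by simp
  qed
qed

lemma strict_on_compact:
  assumes "compact L" and \<alpha>: "\<alpha> \<in> smooth_forms p" and pos: "\<And>z \<xi>. \<xi> \<in> phi_planes z \<Longrightarrow> \<alpha> z \<xi> > 0"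
  obtains c where "0 < c" "\<And>z \<xi>. z \<in> L \<Longrightarrow> \<xi> \<in> phi_planes z \<Longrightarrow> c \<le> \<alpha> z \<xi>"
proof -
  have "\<exists>c>0. \<forall>z\<in>L. \<forall>\<xi>\<in>phi_planes z. c \<le> \<alpha> z \<xi>"
  proof (rule compact_cover_induct[OF assms(1)])
    fix y
    obtain N c where "open N" "y \<in> N" "0 < c" "\<And>z \<xi>. z \<in> N \<Longrightarrow> \<xi> \<in> phi_planes z \<Longrightarrow> c \<le> \<alpha> z \<xi>"
      by (rule strict_local[OF \<alpha> pos, of y]) blast+
    then show "\<exists>N. open N \<and> y \<in> N \<and> (\<exists>c>0. \<forall>z\<in>N. \<forall>\<xi>\<in>phi_planes z. c \<le> \<alpha> z \<xi>)" by blast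
  next
    fix A B
    assume "\<exists>c>0. \<forall>z\<in>A. \<forall>\<xi>\<in>phi_planes z. c \<le> \<alpha> z \<xi>" "\<exists>c>0. \<forall>z\<in>B. \<forall>\<xi>\<in>phi_planes z. c \<le> \<alpha> z \<xi>"
    then obtain c c' where "c > 0" "\<forall>z\<in>A. \<forall>\<xi>\<in>phi_planes z. c \<le> \<alpha> z \<xi>"
      "c' > 0" "\<forall>z\<in>B. \<forall>\<xi>\<in>phi_planes z. c' \<le> \<alpha> z \<xi>" by blast
    then show "\<exists>c>0. \<forall>z\<in>A \<union> B. \<forall>\<xi>\<in>phi_planes z. c \<le> \<alpha> z \<xi>"
      by (intro exI[of _ "min c c'"]) (auto simp: min_le_iff_disj)
  qed (auto intro: exI[of _ 1])
  then show thesis using that by blast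
qed

end

section \<open>Extension of positive functionals\<close>

text \<open>
  The vectors are real functions with the pointwise operations, so that the order on them is
  pointwise as well.
\<close>

locale function_space =
  fixes V :: "('z \<Rightarrow> real) set"
  assumes V_lin: "v \<in> V \<Longrightarrow> w \<in> V \<Longrightarrow> (\<lambda>z. a * v z + b * w z) \<in> V"
begin

text \<open>
  An inequality suffices for the scaling rule, by \<open>sublinear_scale\<close>.
\<close>

definition sublinear :: "(('z \<Rightarrow> real) \<Rightarrow> real) \<Rightarrow> bool" where
  "sublinear q \<longleftrightarrow> (\<forall>v\<in>V. \<forall>w\<in>V. q (\<lambda>z. v z + w z) \<le> q v + q w) \<and>
    (\<forall>v\<in>V. \<forall>s\<ge>0. q (\<lambda>z. s * v z) \<le> s * q v)"

lemma V_add: "v \<in> V \<Longrightarrow> w \<in> V \<Longrightarrow> (\<lambda>z. v z + w z) \<in> V"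
  using V_lin[of v w 1 1] by simp

lemma V_scale: "v \<in> V \<Longrightarrow> (\<lambda>z. s * v z) \<in> V"
  using V_lin[of v v s 0] by simp

lemma V_minus: "v \<in> V \<Longrightarrow> (\<lambda>z. - v z) \<in> V"
  using V_scale[of v "-1"] by simp

lemma sublinear_add: "sublinear q \<Longrightarrow> v \<in> V \<Longrightarrow> w \<in> V \<Longrightarrow> q (\<lambda>z. v z + w z) \<le> q v + q w"
  by (simp add: sublinear_def)

lemma sublinear_le: "sublinear q \<Longrightarrow> v \<in> V \<Longrightarrow> 0 \<le> s \<Longrightarrow> q (\<lambda>z. s * v z) \<le> s * q v"
  by (simp add: sublinear_def)

lemma sublinear_zero:
  assumes "sublinear q" "V \<noteq> {}" shows "q (\<lambda>z. 0) = 0"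
proof -
  obtain v where v: "v \<in> V" using assms(2) by blast
  have "(\<lambda>z. 0) \<in> V" using V_scale[OF v, of 0] by simp
  then have "q (\<lambda>z. 0) \<le> q (\<lambda>z. 0) + q (\<lambda>z. 0)" using sublinear_add[OF assms(1), of "\<lambda>z. 0" "\<lambda>z. 0"] by simp
  moreover have "q (\<lambda>z. 0) \<le> 0" using sublinear_le[OF assms(1) v, of 0] by simp
  ultimately show ?thesis by linarith
qed

lemma sublinear_scale:
  assumes q: "sublinear q" and v: "v \<in> V" and s: "0 \<le> s"
  shows "q (\<lambda>z. s * v z) = s * q v"
proof (cases "s = 0")
  case True
  then show ?thesis using sublinear_zero[OF q] v by auto
next
  case False
  have "q (\<lambda>z. inverse s * (s * v z)) \<le> inverse s * q (\<lambda>z. s * v z)"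
    by (rule sublinear_le[OF q V_scale[OF v]]) (use s in simp)
  moreover have "(\<lambda>z. inverse s * (s * v z)) = v" using False by (simp add: fun_eq_iff)
  ultimately have "s * q v \<le> q (\<lambda>z. s * v z)" using s False by (simp add: field_simps)
  then show ?thesis using sublinear_le[OF q v s] by linarith
qed

lemma sublinear_lower:
  assumes "sublinear q" "v \<in> V" shows "- q (\<lambda>z. - v z) \<le> q v"
proof -
  have "V \<noteq> {}" using assms(2) by blast
  then show ?thesis
    using sublinear_add[OF assms V_minus[OF assms(2)]] sublinear_zero[OF assms(1)] by simp
qed

text \<open>
  Zorn's lemma for the pointwise order. The infimum of a chain is again subadditive: given one
  member that is nearly minimal at \<open>v\<close> and one that is nearly minimal at \<open>w\<close>, the smaller of the
  two is nearly minimal at both. All functionals are taken to be \<open>0\<close> off \<open>V\<close>, which makes the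
  order antisymmetric.
\<close>

lemma minimal_sublinear:
  assumes p: "sublinear p"
  obtains q where "sublinear q" "\<And>v. v \<in> V \<Longrightarrow> q v \<le> p v"
    "\<And>r v. sublinear r \<Longrightarrow> (\<And>v. v \<in> V \<Longrightarrow> r v \<le> q v) \<Longrightarrow> v \<in> V \<Longrightarrow> r v = q v"
proof -
  let ?A = "{q. sublinear q \<and> (\<forall>v\<in>V. q v \<le> p v) \<and> (\<forall>v. v \<notin> V \<longrightarrow> q v = 0)}"
  let ?P = "\<lambda>q r. \<forall>v. r v \<le> (q v :: real)"
  have "\<exists>q\<in>?A. \<forall>r\<in>?A. ?P q r \<longrightarrow> r = q"
  proof (rule predicate_Zorn)
    show "partial_order_on ?A (relation_of ?P ?A)"
      by (rule partial_order_on_relation_ofI) (auto intro: order_trans antisym simp: fun_eq_iff)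
    fix C assume C: "C \<in> Chains (relation_of ?P ?A)"
    have "(q, r) \<in> relation_of ?P ?A \<or> (r, q) \<in> relation_of ?P ?A" if "q \<in> C" "r \<in> C" for q r
      using C that unfolding Chains_def by blast
    then have CA: "q \<in> ?A" and Cc: "?P q r \<or> ?P r q" if "q \<in> C" "r \<in> C" for q r
      using that unfolding relation_of_def by blast+
    show "\<exists>u\<in>?A. \<forall>q\<in>C. ?P q u"
    proof (cases "C = {}")
      case True
      have "(\<lambda>v. if v \<in> V then p v else 0) \<in> ?A"
        using p by (auto simp: sublinear_def V_add V_scale)
      then show ?thesis using True by blast
    next
      case False
      define u where "u v = (INF q\<in>C. q v)" for v
      have bdd: "bdd_below ((\<lambda>q. q v) ` C)" for v
      proof (cases "v \<in> V")
        case True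
        have "- p (\<lambda>z. - v z) \<le> q v" if "q \<in> C" for q
          using sublinear_lower[of q v] CA[OF that that] True V_minus[OF True] by force
        then show ?thesis by (intro bdd_belowI2)
      next
        case False
        then show ?thesis using CA by (intro bdd_belowI2[of _ 0]) force
      qed
      have le: "u v \<le> q v" if "q \<in> C" for q v
        unfolding u_def by (rule cINF_lower[OF bdd that])
      have ge: "x \<le> u v" if "\<And>q. q \<in> C \<Longrightarrow> x \<le> q v" for x v
        unfolding u_def by (rule cINF_greatest[OF False that])
      have approx: "\<exists>q\<in>C. q v < u v + e" if "e > 0" for v e
      proof (rule ccontr)
        assume "\<not> ?thesis"
        then have "u v + e \<le> u v" by (intro ge) force
        then show False using that by simp
      qed
      have "sublinear u"
        unfolding sublinear_def
      proof (intro conjI ballI allI impI)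
        fix v w assume v: "v \<in> V" and w: "w \<in> V"
        show "u (\<lambda>z. v z + w z) \<le> u v + u w"
        proof (rule field_le_epsilon)
          fix e :: real assume e: "0 < e"
          obtain q r where q: "q \<in> C" "q v < u v + e / 2" and r: "r \<in> C" "r w < u w + e / 2"
            using approx[of "e / 2"] e by (meson half_gt_zero)
          obtain s where s: "s \<in> C" "s v \<le> q v" "s w \<le> r w"
          proof (cases "?P q r")
            case True
            then show thesis using that[of r] r by blast
          next
            case False
            then show thesis using that[of q] Cc[OF q(1) r(1)] q by blast
          qed
          have "u (\<lambda>z. v z + w z) \<le> s (\<lambda>z. v z + w z)" by (rule le[OF s(1)])
          also have "\<dots> \<le> s v + s w" using CA[OF s(1) s(1)] v w by (simp add: sublinear_add)
          finally show "u (\<lambda>z. v z + w z) \<le> u v + u w + e" using s q r by linarith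
        qed
      next
        fix v and s :: real assume v: "v \<in> V" and s: "0 \<le> s"
        show "u (\<lambda>z. s * v z) \<le> s * u v"
        proof (rule field_le_epsilon)
          fix e :: real assume e: "0 < e"
          obtain q where q: "q \<in> C" "q v < u v + e / (s + 1)"
            using approx[of "e / (s + 1)"] e s by auto
          have "u (\<lambda>z. s * v z) \<le> q (\<lambda>z. s * v z)" by (rule le[OF q(1)])
          also have "\<dots> \<le> s * q v" using CA[OF q(1) q(1)] v s by (simp add: sublinear_le)
          also have "\<dots> \<le> s * (u v + e / (s + 1))" using q s by (intro mult_left_mono) auto
          also have "\<dots> = s * u v + e * (s / (s + 1))" by (simp add: algebra_simps)
          also have "\<dots> \<le> s * u v + e * 1" using e s by (intro add_left_mono mult_left_mono) auto
          finally show "u (\<lambda>z. s * v z) \<le> s * u v + e" by simp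
        qed
      qed
      moreover obtain q where q: "q \<in> C" using False by blast
      moreover have "u v = 0" if "v \<notin> V" for v
      proof (rule antisym)
        have z: "q v = 0" if "q \<in> C" for q using CA[OF that that] \<open>v \<notin> V\<close> by simp
        show "u v \<le> 0" using le[OF q, of v] z[OF q] by simp
        show "0 \<le> u v" by (rule ge) (simp add: z)
      qed
      ultimately have "u \<in> ?A" using le[OF q] CA[OF q q] by (auto intro: order_trans)
      then show ?thesis using le by blast
    qed
  qed
  then obtain q where q: "q \<in> ?A" and min: "\<And>r. r \<in> ?A \<Longrightarrow> ?P q r \<Longrightarrow> r = q" by blast
  show thesis
  proof (rule that[of q])
    show "sublinear q" "\<And>v. v \<in> V \<Longrightarrow> q v \<le> p v" using q by auto
    fix r v assume r: "sublinear r" "\<And>v. v \<in> V \<Longrightarrow> r v \<le> q v" and v: "v \<in> V"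
    let ?r = "\<lambda>v. if v \<in> V then r v else 0"
    have "?r \<in> ?A"
    proof (intro CollectI conjI)
      show "sublinear ?r" using r(1) by (auto simp: sublinear_def V_add V_scale)
      show "\<forall>v\<in>V. ?r v \<le> p v"
      proof
        fix v assume v: "v \<in> V"
        have "q v \<le> p v" using q v by blast
        then show "?r v \<le> p v" using r(2)[OF v] v by simp
      qed
    qed simp
    then have "?r = q" by (rule min) (use r(2) q in auto)
    from fun_cong[OF this, of v] show "r v = q v" using v by simp
  qed
qed

text \<open>
  For fixed \<open>w\<close>, the functional \<open>v \<mapsto> (INF t\<in>{0..}. q (v + t w) - t q w)\<close> is sublinear and at
  most \<open>q\<close>. By minimality it equals \<open>q\<close>, and its definition at \<open>t = 1\<close> gives
  \<open>q v + q w \<le> q (v + w)\<close>.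
\<close>

lemma minimal_is_linear:
  assumes q: "sublinear q"
    and min: "\<And>r v. sublinear r \<Longrightarrow> (\<And>v. v \<in> V \<Longrightarrow> r v \<le> q v) \<Longrightarrow> v \<in> V \<Longrightarrow> r v = q v"
    and v: "v \<in> V" and w: "w \<in> V"
  shows "q (\<lambda>z. a * v z + b * w z) = a * q v + b * q w"
proof -
  have add: "q (\<lambda>z. v z + w z) = q v + q w" if v: "v \<in> V" and w: "w \<in> V" for v w
  proof -
    let ?f = "\<lambda>v t. q (\<lambda>z. v z + t * w z) - t * q w"
    define r where "r v = (INF t\<in>{0..}. ?f v t)" for v
    have ge: "- q (\<lambda>z. - v z) \<le> ?f v t" if "v \<in> V" "0 \<le> t" for v t
    proof -
      have "q (\<lambda>z. t * w z) = q (\<lambda>z. (v z + t * w z) + (- v z))" by simp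
      also have "\<dots> \<le> q (\<lambda>z. v z + t * w z) + q (\<lambda>z. - v z)"
        by (rule sublinear_add[OF q V_add[OF that(1) V_scale[OF w]] V_minus[OF that(1)]])
      finally show ?thesis using sublinear_scale[OF q w that(2)] by simp
    qed
    have le: "r v \<le> ?f v t" if "v \<in> V" "0 \<le> t" for v t
      unfolding r_def by (rule cINF_lower) (use ge that in \<open>auto intro!: bdd_belowI2\<close>)
    have approx: "\<exists>t\<ge>0. ?f v t < r v + e" if "e > 0" for v e
    proof (rule ccontr)
      assume "\<not> ?thesis"
      then have "r v + e \<le> r v" unfolding r_def by (intro cINF_greatest) force+
      then show False using that by simp
    qed
    have "sublinear r"
      unfolding sublinear_def
    proof (intro conjI ballI allI impI)
      fix v v' assume vv: "v \<in> V" "v' \<in> V"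
      show "r (\<lambda>z. v z + v' z) \<le> r v + r v'"
      proof (rule field_le_epsilon)
        fix e :: real assume e: "0 < e"
        obtain t where t: "0 \<le> t" "?f v t < r v + e / 2" using approx[of "e / 2" v] e by auto
        obtain t' where t': "0 \<le> t'" "?f v' t' < r v' + e / 2" using approx[of "e / 2" v'] e by auto
        have "r (\<lambda>z. v z + v' z) \<le> ?f (\<lambda>z. v z + v' z) (t + t')"
          by (rule le) (use vv V_add t t' in auto)
        also have "q (\<lambda>z. v z + v' z + (t + t') * w z) = q (\<lambda>z. (v z + t * w z) + (v' z + t' * w z))"
          by (simp add: algebra_simps)
        also have "\<dots> \<le> q (\<lambda>z. v z + t * w z) + q (\<lambda>z. v' z + t' * w z)"
          by (rule sublinear_add[OF q]) (intro V_add V_scale vv w)+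
        finally show "r (\<lambda>z. v z + v' z) \<le> r v + r v' + e" using t t' by (simp add: algebra_simps)
      qed
    next
      fix v and s :: real assume v: "v \<in> V" and s: "0 \<le> s"
      show "r (\<lambda>z. s * v z) \<le> s * r v"
      proof (rule field_le_epsilon)
        fix e :: real assume e: "0 < e"
        obtain t where t: "0 \<le> t" "?f v t < r v + e / (s + 1)" using approx[of "e / (s + 1)" v] e s by auto
        have "r (\<lambda>z. s * v z) \<le> ?f (\<lambda>z. s * v z) (s * t)"
          by (rule le) (use v V_scale t s in auto)
        also have "q (\<lambda>z. s * v z + s * t * w z) = q (\<lambda>z. s * (v z + t * w z))"
          by (simp add: algebra_simps)
        also have "\<dots> = s * q (\<lambda>z. v z + t * w z)"
          by (rule sublinear_scale[OF q V_add[OF v V_scale[OF w]] s])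
        also have "s * q (\<lambda>z. v z + t * w z) - s * t * q w = s * ?f v t" by (simp add: algebra_simps)
        also have "\<dots> \<le> s * (r v + e / (s + 1))" using t s by (intro mult_left_mono) auto
        also have "\<dots> = s * r v + e * (s / (s + 1))" by (simp add: algebra_simps)
        also have "\<dots> \<le> s * r v + e * 1" using e s by (intro add_left_mono mult_left_mono) auto
        finally show "r (\<lambda>z. s * v z) \<le> s * r v + e" by simp
      qed
    qed
    moreover have "r v \<le> q v" if "v \<in> V" for v using le[OF that, of 0] by simp
    ultimately have "r v = q v" using min v by blast
    then have "q v \<le> q (\<lambda>z. v z + w z) - q w" using le[OF v, of 1] by simp
    then show ?thesis using sublinear_add[OF q v w] by linarith
  qed
  have minus: "q (\<lambda>z. - v z) = - q v" if "v \<in> V" for v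
  proof -
    have "V \<noteq> {}" using that by blast
    then show ?thesis using add[OF that V_minus[OF that]] sublinear_zero[OF q] by simp
  qed
  have scale: "q (\<lambda>z. s * v z) = s * q v" if v: "v \<in> V" for v s
  proof (cases "0 \<le> s")
    case True
    then show ?thesis by (rule sublinear_scale[OF q v])
  next
    case False
    then have "q (\<lambda>z. (- s) * v z) = (- s) * q v" by (intro sublinear_scale[OF q v]) simp
    then show ?thesis using minus[OF V_scale[OF v, of s]] by simp
  qed
  show ?thesis using add[OF V_scale[OF v, of a] V_scale[OF w, of b]] scale[OF v] scale[OF w] by simp
qed

lemma hahn_banach:
  assumes "sublinear p"
  shows "\<exists>q. (\<forall>v\<in>V. q v \<le> p v) \<and> (\<forall>v\<in>V. \<forall>w\<in>V. \<forall>a b. q (\<lambda>z. a * v z + b * w z) = a * q v + b * q w)"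
proof (rule minimal_sublinear[OF assms])
  fix q assume q: "sublinear q" "\<And>v. v \<in> V \<Longrightarrow> q v \<le> p v"
    "\<And>r v. sublinear r \<Longrightarrow> (\<And>v. v \<in> V \<Longrightarrow> r v \<le> q v) \<Longrightarrow> v \<in> V \<Longrightarrow> r v = q v"
  show ?thesis
  proof (intro exI[of _ q] conjI ballI allI)
    show "q v \<le> p v" if "v \<in> V" for v by (rule q(2)[OF that])
    show "q (\<lambda>z. a * v z + b * w z) = a * q v + b * q w" if "v \<in> V" "w \<in> V" for v w a b
      by (rule minimal_is_linear[OF q(1) _ that]) (rule q(3); assumption)
  qed
qed

end

text \<open>
  The functional \<open>v \<mapsto> Inf {l m | m. m \<ge> v on S}\<close> is sublinear, and \<open>V\<close> consists of functions at
  which the infimum is over a nonempty set with a lower bound. A linear functional below it is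
  nonpositive at nonpositive functions, and agrees with \<open>l\<close> on \<open>M\<close> since it is at most \<open>l\<close> at
  \<open>m\<close> and at \<open>- m\<close>.
\<close>

theorem positive_extension:
  fixes M :: "('z \<Rightarrow> real) set" and l :: "('z \<Rightarrow> real) \<Rightarrow> real" and S :: "'z set"
  defines "V \<equiv> {v. \<exists>m\<in>M. \<exists>n\<in>M. \<forall>z\<in>S. m z \<le> v z \<and> v z \<le> n z}"
  assumes M: "M \<noteq> {}" "\<And>m n a b. m \<in> M \<Longrightarrow> n \<in> M \<Longrightarrow> (\<lambda>z. a * m z + b * n z) \<in> M"
    and lin: "\<And>m n a b. m \<in> M \<Longrightarrow> n \<in> M \<Longrightarrow> l (\<lambda>z. a * m z + b * n z) = a * l m + b * l n"
    and pos: "\<And>m. m \<in> M \<Longrightarrow> (\<And>z. z \<in> S \<Longrightarrow> 0 \<le> m z) \<Longrightarrow> 0 \<le> l m"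
  obtains \<Lambda> where
    "\<And>v w a b. v \<in> V \<Longrightarrow> w \<in> V \<Longrightarrow> (\<lambda>z. a * v z + b * w z) \<in> V"
    "\<And>v w a b. v \<in> V \<Longrightarrow> w \<in> V \<Longrightarrow> \<Lambda> (\<lambda>z. a * v z + b * w z) = a * \<Lambda> v + b * \<Lambda> w"
    "\<And>v. v \<in> V \<Longrightarrow> (\<And>z. z \<in> S \<Longrightarrow> 0 \<le> v z) \<Longrightarrow> 0 \<le> \<Lambda> v"
    "\<And>m. m \<in> M \<Longrightarrow> \<Lambda> m = l m"
proof -
  have mono: "l m \<le> l n" if "m \<in> M" "n \<in> M" "\<And>z. z \<in> S \<Longrightarrow> m z \<le> n z" for m n
    using pos[OF M(2)[OF that(2,1), of 1 "-1"]] lin[OF that(2,1), of 1 "-1"] that(3) by simp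
  have VI: "v \<in> V" if "m \<in> M" "n \<in> M" "\<And>z. z \<in> S \<Longrightarrow> m z \<le> v z" "\<And>z. z \<in> S \<Longrightarrow> v z \<le> n z" for v m n
    using that unfolding V_def by blast
  have MV: "m \<in> V" if "m \<in> M" for m using that by (auto simp: V_def)
  have scale_V: "(\<lambda>z. a * v z) \<in> V" if v: "v \<in> V" for v a
  proof -
    obtain m n where mn: "m \<in> M" "n \<in> M" "\<forall>z\<in>S. m z \<le> v z \<and> v z \<le> n z" using v by (auto simp: V_def)
    have "(\<lambda>z. a * m z) \<in> M" "(\<lambda>z. a * n z) \<in> M"
      using M(2)[OF mn(1,1), of a 0] M(2)[OF mn(2,2), of a 0] by simp_all
    then show ?thesis
    proof (cases "0 \<le> a")
      case True
      then show ?thesis using mn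
        by (intro VI[OF \<open>(\<lambda>z. a * m z) \<in> M\<close> \<open>(\<lambda>z. a * n z) \<in> M\<close>]) (auto intro: mult_left_mono)
    next
      case False
      then show ?thesis using mn
        by (intro VI[OF \<open>(\<lambda>z. a * n z) \<in> M\<close> \<open>(\<lambda>z. a * m z) \<in> M\<close>]) (auto intro: mult_left_mono_neg)
    qed
  qed
  have add_V: "(\<lambda>z. v z + w z) \<in> V" if v: "v \<in> V" and w: "w \<in> V" for v w
  proof -
    obtain m n where mn: "m \<in> M" "n \<in> M" "\<forall>z\<in>S. m z \<le> v z \<and> v z \<le> n z" using v by (auto simp: V_def)
    obtain m' n' where mn': "m' \<in> M" "n' \<in> M" "\<forall>z\<in>S. m' z \<le> w z \<and> w z \<le> n' z" using w by (auto simp: V_def)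
    have "(\<lambda>z. m z + m' z) \<in> M" "(\<lambda>z. n z + n' z) \<in> M"
      using M(2)[OF mn(1) mn'(1), of 1 1] M(2)[OF mn(2) mn'(2), of 1 1] by simp_all
    then show ?thesis by (rule VI) (use mn mn' in \<open>auto intro: add_mono\<close>)
  qed
  interpret function_space V
    by unfold_locales (intro add_V scale_V)
  define p where "p v = Inf {l m | m. m \<in> M \<and> (\<forall>z\<in>S. v z \<le> m z)}" for v
  have bdd: "bdd_below {l m | m. m \<in> M \<and> (\<forall>z\<in>S. v z \<le> m z)}" if v: "v \<in> V" for v
  proof -
    obtain m where m: "m \<in> M" "\<forall>z\<in>S. m z \<le> v z" using v by (auto simp: V_def)
    show ?thesis by (rule bdd_belowI[of _ "l m"]) (use m in \<open>auto intro!: mono intro: order_trans\<close>)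
  qed
  have ne: "{l m | m. m \<in> M \<and> (\<forall>z\<in>S. v z \<le> m z)} \<noteq> {}" if v: "v \<in> V" for v using v by (auto simp: V_def)
  have p_le: "p v \<le> l m" if "v \<in> V" "m \<in> M" "\<And>z. z \<in> S \<Longrightarrow> v z \<le> m z" for v m
    unfolding p_def by (rule cInf_lower[OF _ bdd[OF that(1)]]) (use that in auto)
  have p_approx: "\<exists>m\<in>M. (\<forall>z\<in>S. v z \<le> m z) \<and> l m < p v + e" if v: "v \<in> V" and e: "e > 0" for v e
  proof -
    have "p v < p v + e" using e by simp
    then obtain y where "y \<in> {l m | m. m \<in> M \<and> (\<forall>z\<in>S. v z \<le> m z)}" "y < p v + e"
      using cInf_lessD[OF ne[OF v], of "p v + e"] by (auto simp: p_def)
    then show ?thesis by auto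
  qed
  have "sublinear p"
    unfolding sublinear_def
  proof (intro conjI ballI allI impI)
    fix v w assume v: "v \<in> V" and w: "w \<in> V"
    show "p (\<lambda>z. v z + w z) \<le> p v + p w"
    proof (rule field_le_epsilon)
      fix e :: real assume e: "0 < e"
      obtain m where m: "m \<in> M" "\<forall>z\<in>S. v z \<le> m z" "l m < p v + e / 2" using p_approx[OF v, of "e / 2"] e by auto
      obtain n where n: "n \<in> M" "\<forall>z\<in>S. w z \<le> n z" "l n < p w + e / 2" using p_approx[OF w, of "e / 2"] e by auto
      have "p (\<lambda>z. v z + w z) \<le> l (\<lambda>z. 1 * m z + 1 * n z)"
        by (rule p_le[OF add_V[OF v w] M(2)[OF m(1) n(1)]]) (use m n in \<open>auto intro: add_mono\<close>)
      then show "p (\<lambda>z. v z + w z) \<le> p v + p w + e" using lin[OF m(1) n(1), of 1 1] m(3) n(3) by simp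
    qed
  next
    fix v and s :: real assume v: "v \<in> V" and s: "0 \<le> s"
    show "p (\<lambda>z. s * v z) \<le> s * p v"
    proof (rule field_le_epsilon)
      fix e :: real assume e: "0 < e"
      obtain m where m: "m \<in> M" "\<forall>z\<in>S. v z \<le> m z" "l m < p v + e / (s + 1)"
        using p_approx[OF v, of "e / (s + 1)"] e s by auto
      have "p (\<lambda>z. s * v z) \<le> l (\<lambda>z. s * m z + 0 * m z)"
        by (rule p_le[OF scale_V[OF v] M(2)[OF m(1) m(1)]]) (use m s in \<open>auto intro: mult_left_mono\<close>)
      also have "\<dots> = s * l m" using lin[OF m(1) m(1), of s 0] by simp
      also have "\<dots> \<le> s * (p v + e / (s + 1))" using m s by (intro mult_left_mono) auto
      also have "\<dots> = s * p v + e * (s / (s + 1))" by (simp add: algebra_simps)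
      also have "\<dots> \<le> s * p v + e * 1" using e s by (intro add_left_mono mult_left_mono) auto
      finally show "p (\<lambda>z. s * v z) \<le> s * p v + e" by simp
    qed
  qed
  from hahn_banach[OF this] obtain q where q: "\<forall>v\<in>V. q v \<le> p v"
    and q': "\<forall>v\<in>V. \<forall>w\<in>V. \<forall>a b. q (\<lambda>z. a * v z + b * w z) = a * q v + b * q w" by auto
  have q_lin: "q (\<lambda>z. a * v z + b * w z) = a * q v + b * q w" if "v \<in> V" "w \<in> V" for v w a b
    using q' that by simp
  have q_minus: "q (\<lambda>z. - v z) = - q v" if "v \<in> V" for v using q_lin[OF that that, of "-1" 0] by simp
  have minus_M: "(\<lambda>z. - m z) \<in> M" "l (\<lambda>z. - m z) = - l m" if "m \<in> M" for m
    using M(2)[OF that that, of "-1" 0] lin[OF that that, of "-1" 0] by simp_all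
  show thesis
  proof (rule that[of q])
    show "(\<lambda>z. a * v z + b * w z) \<in> V" if "v \<in> V" "w \<in> V" for v w a b
      by (rule V_lin[OF that])
    show "q (\<lambda>z. a * v z + b * w z) = a * q v + b * q w" if "v \<in> V" "w \<in> V" for v w a b
      by (rule q_lin[OF that])
    show "0 \<le> q v" if v: "v \<in> V" and ge: "\<And>z. z \<in> S \<Longrightarrow> 0 \<le> v z" for v
    proof -
      obtain m where m: "m \<in> M" using M(1) by blast
      have 0: "(\<lambda>z. 0) \<in> M" "l (\<lambda>z. 0) = 0" using M(2)[OF m m, of 0 0] lin[OF m m, of 0 0] by simp_all
      have "q (\<lambda>z. - v z) \<le> p (\<lambda>z. - v z)" by (rule bspec[OF q V_minus[OF v]])
      also have "\<dots> \<le> l (\<lambda>z. 0)" by (rule p_le[OF V_minus[OF v] 0(1)]) (use ge in auto)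
      finally show ?thesis using q_minus[OF v] 0 by simp
    qed
    show "q m = l m" if m: "m \<in> M" for m
    proof (rule antisym)
      show "q m \<le> l m" using bspec[OF q MV[OF m]] p_le[OF MV[OF m] m] by simp
      have "q (\<lambda>z. - m z) \<le> l (\<lambda>z. - m z)"
        using bspec[OF q MV[OF minus_M(1)[OF m]]] p_le[OF MV[OF minus_M(1)[OF m]] minus_M(1)[OF m]] by simp
      then show "l m \<le> q m" using q_minus[OF MV[OF m]] minus_M(2)[OF m] by simp
    qed
  qed
qed

section \<open>Representing measures\<close>

lemma nat_indexed_base:
  obtains B :: "nat \<Rightarrow> 'a::second_countable_topology set"
  where "\<And>i. open (B i)" "\<And>U y. open U \<Longrightarrow> y \<in> U \<Longrightarrow> \<exists>i. y \<in> B i \<and> B i \<subseteq> U"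
proof -
  obtain \<B> :: "'a set set" where \<B>: "countable \<B>" "topological_basis \<B>"
    using ex_countable_basis by blast
  \<comment> \<open>The empty set makes the family nonempty, as an enumeration requires.\<close>
  have c: "countable (insert {} \<B>)" "insert {} \<B> \<noteq> {}" using \<B>(1) by auto
  define B where "B = from_nat_into (insert {} \<B>)"
  have r: "range B = insert {} \<B>" unfolding B_def by (rule range_from_nat_into[OF c(2,1)])
  show thesis
  proof (rule that[of B])
    show "open (B i)" for i
      using r topological_basis_open[OF \<B>(2), of "B i"] by (cases "B i = {}") auto
    show "\<exists>i. y \<in> B i \<and> B i \<subseteq> U" if U: "open U" "y \<in> U" for U y
    proof -
      obtain G where G: "G \<in> \<B>" "y \<in> G" "G \<subseteq> U" by (rule topological_basisE[OF \<B>(2) U])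
      then have "G \<in> range B" using r by simp
      then show ?thesis using G by auto
    qed
  qed
qed

definition bounded_fun :: "'a set \<Rightarrow> ('a \<Rightarrow> real) \<Rightarrow> bool" where
  "bounded_fun K h \<longleftrightarrow> (\<exists>C. \<forall>y\<in>K. \<bar>h y\<bar> \<le> C)"

text \<open>
  The mean is defined on all bounded functions, not only on continuous ones. So it has values at
  the indicator functions of arbitrary sets, and a measure can be built from the successively
  finer finite partitions of \<open>K\<close> generated by the members of the base \<open>B\<close>.
\<close>

locale mean_on_compact =
  fixes K :: "'a::{t2_space,second_countable_topology} set" and L :: "('a \<Rightarrow> real) \<Rightarrow> real"
    and B :: "nat \<Rightarrow> 'a set"
  assumes K: "compact K"
    and L_lin: "\<And>h k a b. bounded_fun K h \<Longrightarrow> bounded_fun K k \<Longrightarrow>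
      L (\<lambda>y. a * h y + b * k y) = a * L h + b * L k"
    and L_pos: "\<And>h. bounded_fun K h \<Longrightarrow> (\<And>y. y \<in> K \<Longrightarrow> 0 \<le> h y) \<Longrightarrow> 0 \<le> L h"
    and L_one: "L (\<lambda>_. 1) = 1"
    and base: "\<And>U y. open U \<Longrightarrow> y \<in> U \<Longrightarrow> \<exists>i. y \<in> B i \<and> B i \<subseteq> U"
    and base_open: "\<And>i. open (B i)"
begin

abbreviation bdd :: "('a \<Rightarrow> real) \<Rightarrow> bool" where
  "bdd \<equiv> bounded_fun K"

lemma bdd_const: "bdd (\<lambda>_. c)"
  unfolding bounded_fun_def by blast

lemma bdd_indicator: "bdd (indicator A)"
  unfolding bounded_fun_def by (rule exI[of _ 1]) (simp add: indicator_def)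

lemma bdd_continuous:
  assumes "continuous_on UNIV f" shows "bdd f"
proof -
  have "compact (f ` K)" by (rule compact_continuous_image[OF continuous_on_subset[OF assms] K]) simp
  then show ?thesis
    unfolding bounded_fun_def using compact_imp_bounded bounded_real by (metis imageI)
qed

lemma bdd_lincomb:
  assumes "bdd h" "bdd k" shows "bdd (\<lambda>y. a * h y + b * k y)"
proof -
  obtain C D where "\<forall>y\<in>K. \<bar>h y\<bar> \<le> C" "\<forall>y\<in>K. \<bar>k y\<bar> \<le> D"
    using assms unfolding bounded_fun_def by blast
  then have "\<bar>a * h y + b * k y\<bar> \<le> \<bar>a\<bar> * C + \<bar>b\<bar> * D" if "y \<in> K" for y
    using that by (intro order_trans[OF abs_triangle_ineq] add_mono) (auto simp: abs_mult intro: mult_left_mono)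
  then show ?thesis unfolding bounded_fun_def by blast
qed

lemma L_mono: "bdd h \<Longrightarrow> bdd k \<Longrightarrow> (\<And>y. y \<in> K \<Longrightarrow> h y \<le> k y) \<Longrightarrow> L h \<le> L k"
  using L_pos[OF bdd_lincomb[of k h 1 "-1"]] L_lin[of k h 1 "-1"] by simp

lemma L_cong: "bdd h \<Longrightarrow> bdd k \<Longrightarrow> (\<And>y. y \<in> K \<Longrightarrow> h y = k y) \<Longrightarrow> L h = L k"
  by (intro antisym L_mono) auto

lemma L_add: "bdd h \<Longrightarrow> bdd k \<Longrightarrow> L (\<lambda>y. h y + k y) = L h + L k"
  using L_lin[of h k 1 1] by simp

lemma L_cmult: "bdd h \<Longrightarrow> L (\<lambda>y. a * h y) = a * L h"
  using L_lin[of h h a 0] by simp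

lemma bdd_sum_L_sum:
  assumes "finite I" "\<And>i. i \<in> I \<Longrightarrow> bdd (h i)"
  shows "bdd (\<lambda>y. \<Sum>i\<in>I. c i * h i y) \<and> L (\<lambda>y. \<Sum>i\<in>I. c i * h i y) = (\<Sum>i\<in>I. c i * L (h i))"
  using assms
proof (induction I rule: finite_induct)
  case empty
  show ?case using L_cmult[OF bdd_const[of 1], of 0] bdd_const[of 0] by simp
next
  case (insert a I)
  then have "bdd (h a)" "bdd (\<lambda>y. \<Sum>i\<in>I. c i * h i y)" by auto
  from L_lin[OF this, of "c a" 1] bdd_lincomb[OF this, of "c a" 1] insert show ?case by simp
qed

text \<open>
  A word tells in which members of the base a point lies, the newest letter first.
\<close>

primrec cell :: "bool list \<Rightarrow> 'a set" where
  "cell [] = K"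
| "cell (b # ws) = {y \<in> cell ws. (y \<in> B (length ws)) = b}"

definition mass :: "bool list \<Rightarrow> real" where
  "mass ws = L (indicator (cell ws))"

text \<open>
  The slots of the words of one length are consecutive intervals that fill \<open>[0, 1)\<close>, of length
  \<open>mass ws\<close> each. A slot is cut into those of the two longer words, \<open>False\<close> on the left.
\<close>

primrec left :: "bool list \<Rightarrow> real" where
  "left [] = 0"
| "left (b # ws) = left ws + (if b then mass (False # ws) else 0)"

definition slot :: "bool list \<Rightarrow> real set" where
  "slot ws = {left ws..<left ws + mass ws}"

lemma cell_subset: "cell ws \<subseteq> K"
  by (induction ws) auto

lemma mass_nonneg: "0 \<le> mass ws"
  unfolding mass_def by (rule L_pos[OF bdd_indicator]) simp

lemma mass_Nil: "mass [] = 1"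
proof -
  have "mass [] = L (\<lambda>_. 1)"
    unfolding mass_def by (rule L_cong[OF bdd_indicator bdd_const]) simp
  then show ?thesis by (simp only: L_one)
qed

lemma mass_split: "mass ws = mass (False # ws) + mass (True # ws)"
proof -
  have "bdd (\<lambda>y. indicator (cell (False # ws)) y + indicator (cell (True # ws)) y)"
    using bdd_lincomb[OF bdd_indicator[of "cell (False # ws)"] bdd_indicator[of "cell (True # ws)"], of 1 1]
    by (simp del: cell.simps)
  then have "mass ws = L (\<lambda>y. indicator (cell (False # ws)) y + indicator (cell (True # ws)) y)"
    unfolding mass_def by (rule L_cong[OF bdd_indicator]) (auto simp: indicator_def)
  then show ?thesis by (simp only: L_add[OF bdd_indicator bdd_indicator] mass_def)
qed

lemma slot_Nil: "slot [] = {0..<1}"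
  by (simp add: slot_def mass_Nil)

lemma slot_split: "slot ws = slot (False # ws) \<union> slot (True # ws)" "slot (False # ws) \<inter> slot (True # ws) = {}"
  using mass_split[of ws] mass_nonneg[of "False # ws"] mass_nonneg[of "True # ws"]
  by (auto simp: slot_def simp del: cell.simps)

lemma slot_Cons_subset: "slot (b # ws) \<subseteq> slot ws"
  using slot_split(1)[of ws] by (cases b) auto

lemma slot_subset: "slot ws \<subseteq> {0..<1}"
proof (induction ws)
  case (Cons b ws)
  then show ?case using slot_Cons_subset[of b ws] by blast
qed (simp add: slot_Nil)

lemma slot_exists: "\<omega> \<in> {0..<1} \<Longrightarrow> \<exists>ws. length ws = n \<and> \<omega> \<in> slot ws"
proof (induction n)
  case 0
  then show ?case by (auto simp: slot_Nil)
next
  case (Suc n)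
  then obtain ws where ws: "length ws = n" "\<omega> \<in> slot ws" by blast
  then obtain b where "\<omega> \<in> slot (b # ws)" using slot_split(1)[of ws] by blast
  then show ?case using ws by (intro exI[of _ "b # ws"]) simp
qed

lemma slot_unique: "length ws = length vs \<Longrightarrow> \<omega> \<in> slot ws \<Longrightarrow> \<omega> \<in> slot vs \<Longrightarrow> ws = vs"
proof (induction ws arbitrary: vs)
  case (Cons b ws)
  then obtain c us where vs: "vs = c # us" by (cases vs) auto
  have "\<omega> \<in> slot ws" "\<omega> \<in> slot us"
    using Cons.prems(2,3) slot_Cons_subset[of b ws] slot_Cons_subset[of c us] unfolding vs by blast+
  then have "ws = us" using Cons.IH[of us] Cons.prems(1) vs by simp
  moreover have "slot (b # ws) \<inter> slot (c # ws) \<noteq> {}"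
    using Cons.prems(2,3) \<open>ws = us\<close> vs by blast
  then have "b = c" using slot_split(2)[of ws] by (cases b; cases c) (simp_all add: Int_commute)
  ultimately show ?case using vs by simp
qed simp

lemma slot_cell_mono:
  "length ws \<le> length vs \<Longrightarrow> \<omega> \<in> slot ws \<Longrightarrow> \<omega> \<in> slot vs \<Longrightarrow> cell vs \<subseteq> cell ws"
proof (induction vs)
  case (Cons b vs)
  show ?case
  proof (cases "length ws = length (b # vs)")
    case True
    then show ?thesis using slot_unique[OF True Cons.prems(2,3)] by simp
  next
    case False
    then have "length ws \<le> length vs" using Cons.prems(1) by simp
    moreover have "\<omega> \<in> slot vs" using Cons.prems(3) slot_Cons_subset[of b vs] by blast
    ultimately have "cell vs \<subseteq> cell ws" using Cons.IH Cons.prems(2) by blast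
    then show ?thesis by auto
  qed
qed simp

lemma cell_nonempty:
  assumes "\<omega> \<in> slot ws" shows "cell ws \<noteq> {}"
proof
  assume "cell ws = {}"
  then have "mass ws = L (\<lambda>y. 0 * 1)"
    unfolding mass_def by (intro L_cong bdd_indicator bdd_const) simp
  then have "mass ws = 0" using L_cmult[OF bdd_const[of 1], of 0] by simp
  then show False using assms by (simp add: slot_def)
qed

lemma cell_exists: "y \<in> K \<Longrightarrow> \<exists>!ws. length ws = n \<and> y \<in> cell ws"
proof (induction n)
  case (Suc n)
  then obtain ws where ws: "length ws = n" "y \<in> cell ws" and u: "\<And>vs. length vs = n \<Longrightarrow> y \<in> cell vs \<Longrightarrow> vs = ws"
    by blast
  show ?case
  proof (rule ex1I[of _ "(y \<in> B n) # ws"])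
    show "length ((y \<in> B n) # ws) = Suc n \<and> y \<in> cell ((y \<in> B n) # ws)" using ws by simp
    fix vs assume vs: "length vs = Suc n \<and> y \<in> cell vs"
    then obtain b us where "vs = b # us" by (cases vs) auto
    then show "vs = (y \<in> B n) # ws" using vs u[of us] by auto
  qed
qed auto

lemma cell_decides: "y \<in> cell ws \<Longrightarrow> y' \<in> cell ws \<Longrightarrow> i < length ws \<Longrightarrow> y \<in> B i \<longleftrightarrow> y' \<in> B i"
  by (induction ws) (auto simp: less_Suc_eq)

text \<open>
  Finitely many members of the base on which \<open>f\<close> varies by at most \<open>e\<close> cover \<open>K\<close>. Once a word is
  long enough to decide all of them, its cell lies in one of them.
\<close>

lemma small_oscillation:
  assumes f: "continuous_on UNIV (f :: 'a \<Rightarrow> real)" and e: "0 < e"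
  obtains n where "\<And>ws y y'. length ws = n \<Longrightarrow> y \<in> cell ws \<Longrightarrow> y' \<in> cell ws \<Longrightarrow> \<bar>f y - f y'\<bar> \<le> e"
proof -
  define G where "G = {i. \<forall>y\<in>B i. \<forall>y'\<in>B i. \<bar>f y - f y'\<bar> \<le> e}"
  have "K \<subseteq> (\<Union>i\<in>G. B i)"
  proof
    fix y
    have "open (f -` ball (f y) (e / 2))" using f by (intro open_vimage) auto
    moreover have "y \<in> f -` ball (f y) (e / 2)" using e by simp
    ultimately obtain i where i: "y \<in> B i" "B i \<subseteq> f -` ball (f y) (e / 2)" using base by blast
    have "\<bar>f z - f z'\<bar> \<le> e" if "z \<in> B i" "z' \<in> B i" for z z'
    proof -
      have "\<bar>f y - f z\<bar> < e / 2" "\<bar>f y - f z'\<bar> < e / 2" using i(2) that by (auto simp: dist_real_def)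
      then show ?thesis by linarith
    qed
    then show "y \<in> (\<Union>i\<in>G. B i)" using i(1) by (auto simp: G_def)
  qed
  then obtain J where J: "J \<subseteq> G" "finite J" "K \<subseteq> (\<Union>i\<in>J. B i)"
    by (rule compactE_image[OF K base_open])
  show thesis
  proof (rule that[of "Suc (Max J)"])
    fix ws y y' assume ws: "length ws = Suc (Max J)" and y: "y \<in> cell ws" "y' \<in> cell ws"
    obtain i where i: "i \<in> J" "y \<in> B i" using y(1) cell_subset J(3) by blast
    have "i < length ws" using Max_ge[OF J(2) i(1)] ws by simp
    then have "y' \<in> B i" using cell_decides[OF y] i(2) by simp
    then show "\<bar>f y - f y'\<bar> \<le> e" using i J(1) by (auto simp: G_def)
  qed
qed

text \<open>
  The cells of the words whose slots contain \<open>\<omega>\<close> decrease and are nonempty; they need not have a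
  common point, but their closures have one in the compact set \<open>K\<close>.
\<close>

definition point :: "real \<Rightarrow> 'a" where
  "point \<omega> = (SOME y. y \<in> K \<and> (\<forall>ws. \<omega> \<in> slot ws \<longrightarrow> y \<in> closure (cell ws)))"

lemma point:
  assumes \<omega>: "\<omega> \<in> {0..<1}"
  shows "point \<omega> \<in> K" "\<omega> \<in> slot ws \<Longrightarrow> point \<omega> \<in> closure (cell ws)"
proof -
  let ?F = "{closure (cell ws) | ws. \<omega> \<in> slot ws}"
  have "K \<inter> \<Inter>?F \<noteq> {}"
  proof (rule compact_imp_fip[OF K])
    fix F' assume F': "finite F'" "F' \<subseteq> ?F"
    then have "\<forall>T\<in>F'. \<exists>ws. T = closure (cell ws) \<and> \<omega> \<in> slot ws" by blast
    then obtain w where w: "\<And>T. T \<in> F' \<Longrightarrow> T = closure (cell (w T)) \<and> \<omega> \<in> slot (w T)" by metis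
    obtain vs where vs: "length vs = Max (insert 0 ((length \<circ> w) ` F'))" "\<omega> \<in> slot vs" using slot_exists[OF \<omega>] by blast
    obtain y where y: "y \<in> cell vs" using cell_nonempty[OF vs(2)] by blast
    have "y \<in> T" if T: "T \<in> F'" for T
    proof -
      have "length (w T) \<le> length vs" unfolding vs(1) by (rule Max_ge) (use F'(1) T in auto)
      then have "y \<in> cell (w T)" using slot_cell_mono[of "w T" vs \<omega>] w[OF T] vs(2) y by blast
      then show ?thesis using w[OF T] closure_subset by blast
    qed
    then show "K \<inter> \<Inter>F' \<noteq> {}" using y cell_subset by blast
  qed auto
  then have "\<exists>y. y \<in> K \<and> (\<forall>ws. \<omega> \<in> slot ws \<longrightarrow> y \<in> closure (cell ws))" by blast
  from someI_ex[OF this] show "point \<omega> \<in> K" "\<omega> \<in> slot ws \<Longrightarrow> point \<omega> \<in> closure (cell ws)"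
    unfolding point_def by blast+
qed

definition rep :: "bool list \<Rightarrow> 'a" where
  "rep ws = (SOME y. y \<in> cell ws)"

lemma rep: "cell ws \<noteq> {} \<Longrightarrow> rep ws \<in> cell ws"
  unfolding rep_def by (simp add: some_in_eq)

abbreviation words :: "nat \<Rightarrow> bool list set" where
  "words n \<equiv> {ws. length ws = n}"

lemma finite_words: "finite (words n)"
  using finite_lists_length_eq[of "UNIV :: bool set" n] by simp

text \<open>
  A step function that is uniformly close to \<open>f \<circ> point\<close> and whose integral is close to \<open>L f\<close>.
\<close>

definition step :: "('a \<Rightarrow> real) \<Rightarrow> nat \<Rightarrow> real \<Rightarrow> real" where
  "step f n \<omega> = (\<Sum>ws\<in>words n. f (rep ws) * indicator (slot ws) \<omega>)"

lemma step_close: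
  assumes f: "continuous_on UNIV f" and \<omega>: "\<omega> \<in> {0..<1}"
    and osc: "\<And>ws y y'. length ws = n \<Longrightarrow> y \<in> cell ws \<Longrightarrow> y' \<in> cell ws \<Longrightarrow> \<bar>f y - f y'\<bar> \<le> e"
  shows "\<bar>f (point \<omega>) - step f n \<omega>\<bar> \<le> e"
proof -
  obtain ws where ws: "length ws = n" "\<omega> \<in> slot ws" using slot_exists[OF \<omega>] by blast
  have "step f n \<omega> = (\<Sum>vs\<in>{ws}. f (rep vs) * indicator (slot vs) \<omega>)"
    unfolding step_def
  proof (rule sum.mono_neutral_right)
    show "\<forall>vs\<in>words n - {ws}. f (rep vs) * indicator (slot vs) \<omega> = 0"
    proof
      fix vs assume vs: "vs \<in> words n - {ws}"
      then have "\<omega> \<notin> slot vs" using slot_unique[of vs ws \<omega>] ws by auto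
      then show "f (rep vs) * indicator (slot vs) \<omega> = 0" by simp
    qed
  qed (use ws finite_words in auto)
  then have 1: "step f n \<omega> = f (rep ws)" using ws by simp
  have "cell ws \<subseteq> {z. \<bar>f z - f (rep ws)\<bar> \<le> e}"
    using osc[OF ws(1) _ rep[OF cell_nonempty[OF ws(2)]]] by blast
  moreover have "closed {z. \<bar>f z - f (rep ws)\<bar> \<le> e}"
    by (intro closed_Collect_le continuous_intros f)
  ultimately have "closure (cell ws) \<subseteq> {z. \<bar>f z - f (rep ws)\<bar> \<le> e}" by (rule closure_minimal)
  then show ?thesis using point(2)[OF \<omega> ws(2)] 1 by auto
qed

lemma L_step_close:
  assumes f: "continuous_on UNIV f"
    and osc: "\<And>ws y y'. length ws = n \<Longrightarrow> y \<in> cell ws \<Longrightarrow> y' \<in> cell ws \<Longrightarrow> \<bar>f y - f y'\<bar> \<le> e"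
  shows "\<bar>L f - (\<Sum>ws\<in>words n. f (rep ws) * mass ws)\<bar> \<le> e"
proof -
  let ?s = "\<lambda>y. \<Sum>ws\<in>words n. f (rep ws) * indicator (cell ws) y"
  have s: "bdd ?s" "L ?s = (\<Sum>ws\<in>words n. f (rep ws) * mass ws)"
    using bdd_sum_L_sum[OF finite_words, of n "\<lambda>ws. indicator (cell ws)" "\<lambda>ws. f (rep ws)"] bdd_indicator
    by (simp_all add: mass_def)
  have bf: "bdd f" by (rule bdd_continuous[OF f])
  have close: "\<bar>f y - ?s y\<bar> \<le> e" if y: "y \<in> K" for y
  proof -
    obtain ws where ws: "length ws = n" "y \<in> cell ws" and u: "\<And>vs. length vs = n \<Longrightarrow> y \<in> cell vs \<Longrightarrow> vs = ws"
      using cell_exists[OF y, of n] by blast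
    have "?s y = (\<Sum>vs\<in>{ws}. f (rep vs) * indicator (cell vs) y)"
    proof (rule sum.mono_neutral_right)
      show "\<forall>vs\<in>words n - {ws}. f (rep vs) * indicator (cell vs) y = 0"
      proof
        fix vs assume vs: "vs \<in> words n - {ws}"
        then have "y \<notin> cell vs" using u[of vs] by auto
        then show "f (rep vs) * indicator (cell vs) y = 0" by simp
      qed
    qed (use ws finite_words in auto)
    then have "?s y = f (rep ws)" using ws by simp
    moreover have "rep ws \<in> cell ws" using ws(2) by (intro rep) auto
    ultimately show ?thesis using osc[OF ws] by simp
  qed
  have "L f \<le> L (\<lambda>y. 1 * ?s y + e * 1)"
    by (rule L_mono[OF bf bdd_lincomb[OF s(1) bdd_const]]) (use close in force)
  moreover have "L (\<lambda>y. 1 * ?s y + (- e) * 1) \<le> L f"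
    by (rule L_mono[OF bdd_lincomb[OF s(1) bdd_const] bf]) (use close in force)
  ultimately show ?thesis
    using L_lin[OF s(1) bdd_const[of 1], of 1 e] L_lin[OF s(1) bdd_const[of 1], of 1 "- e"] L_one s(2) by (simp add: abs_le_iff)
qed

text \<open>
  The measure is the law of \<open>point\<close> under Lebesgue measure on \<open>[0, 1)\<close>. The value of \<open>L\<close> at the
  function that is constant on cells is the integral of the function that is constant on the
  corresponding slots, and both approximate what is claimed to be equal.

  For Borel measurability, \<open>f \<circ> point\<close> is a limit of step functions for every continuous \<open>f\<close>,
  and by the separation property and Lindelof's theorem every open set is a countable union of
  sets \<open>{f > 0}\<close>.
\<close>

theorem representing_measure:
  assumes separation: "\<And>(U :: 'a set) y. open U \<Longrightarrow> y \<in> U \<Longrightarrow> \<exists>f. continuous_on UNIV f \<and> 0 < f y \<and> (\<forall>z. z \<notin> U \<longrightarrow> f z \<le> (0::real))"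
  obtains \<mu> where "prob_space \<mu>" "sets \<mu> = sets borel" "emeasure \<mu> (- K) = 0"
    "\<And>f. continuous_on UNIV f \<Longrightarrow> (\<integral>y. f y \<partial>\<mu>) = L f"
proof -
  let ?M = "restrict_space lborel {0..<1::real}"
  have sp: "space ?M = {0..<1}" by (simp add: space_restrict_space)
  have slot_sets: "slot ws \<in> sets ?M" for ws
    using slot_subset[of ws] by (simp add: sets_restrict_space_iff) (simp add: slot_def)
  have slot_measure: "measure ?M (slot ws) = mass ws" for ws
    using slot_subset[of ws] mass_nonneg[of ws] by (simp add: measure_restrict_space) (simp add: slot_def)
  interpret M: prob_space ?M
    by (rule prob_space_restrict_space) simp_all
  have step_meas: "step f n \<in> borel_measurable ?M" for f n
    unfolding step_def[abs_def]
    by (intro borel_measurable_sum borel_measurable_times borel_measurable_const borel_measurable_indicator slot_sets)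
  have point_meas: "(\<lambda>\<omega>. f (point \<omega>)) \<in> borel_measurable ?M" if f: "continuous_on UNIV f" for f :: "'a \<Rightarrow> real"
  proof -
    have "\<exists>n. \<forall>ws. length ws = n \<longrightarrow> (\<forall>y\<in>cell ws. \<forall>y'\<in>cell ws. \<bar>f y - f y'\<bar> \<le> 1 / real (Suc k))" for k
      by (rule small_oscillation[OF f, of "1 / real (Suc k)"]) (simp, blast)
    then obtain n where n: "\<And>k ws y y'. length ws = n k \<Longrightarrow> y \<in> cell ws \<Longrightarrow> y' \<in> cell ws \<Longrightarrow> \<bar>f y - f y'\<bar> \<le> 1 / real (Suc k)"
      by metis
    show ?thesis
    proof (rule borel_measurable_LIMSEQ_real)
      show "step f (n k) \<in> borel_measurable ?M" for k by (rule step_meas)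
      fix \<omega> assume "\<omega> \<in> space ?M"
      then have \<omega>: "\<omega> \<in> {0..<1}" by (simp add: sp)
      have "(\<lambda>k. step f (n k) \<omega> - f (point \<omega>)) \<longlonglongrightarrow> 0"
      proof (rule Lim_null_comparison[OF always_eventually LIMSEQ_inverse_real_of_nat])
        show "\<forall>k. norm (step f (n k) \<omega> - f (point \<omega>)) \<le> inverse (real (Suc k))"
          using step_close[OF f \<omega> n] by (simp add: abs_minus_commute inverse_eq_divide)
      qed
      then show "(\<lambda>k. step f (n k) \<omega>) \<longlonglongrightarrow> f (point \<omega>)" by (simp add: LIM_zero_iff)
    qed
  qed
  have point_borel: "point \<in> measurable ?M borel"
  proof (rule borel_measurableI)
    fix U :: "'a set" assume U: "open U"
    have "\<forall>y\<in>U. \<exists>f. continuous_on UNIV f \<and> 0 < f y \<and> (\<forall>z. z \<notin> U \<longrightarrow> f z \<le> (0::real))"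
      using separation[OF U] by blast
    then obtain F where F: "\<And>y. y \<in> U \<Longrightarrow> continuous_on UNIV (F y)" "\<And>y. y \<in> U \<Longrightarrow> 0 < F y y"
      "\<And>y z. y \<in> U \<Longrightarrow> z \<notin> U \<Longrightarrow> F y z \<le> (0::real)" by metis
    have "open {z. 0 < F y z}" if "y \<in> U" for y
      by (intro open_Collect_less continuous_on_const F(1) that)
    then have op: "open S" if "S \<in> (\<lambda>y. {z. 0 < F y z}) ` U" for S using that by blast
    obtain \<F> where \<F>: "\<F> \<subseteq> (\<lambda>y. {z. 0 < F y z}) ` U" "countable \<F>" "\<Union>\<F> = \<Union>((\<lambda>y. {z. 0 < F y z}) ` U)"
      by (rule Lindelof[OF op]) blast+
    have "U = \<Union>((\<lambda>y. {z. 0 < F y z}) ` U)" using F(2,3) by force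
    then have "point -` U \<inter> space ?M = (\<Union>G\<in>\<F>. point -` G \<inter> space ?M)" using \<F>(3) by auto
    also have "\<dots> \<in> sets ?M"
    proof (rule sets.countable_UN''[OF \<F>(2)])
      fix G assume "G \<in> \<F>"
      then obtain y where y: "y \<in> U" "G = {z. 0 < F y z}" using \<F>(1) by blast
      have "{\<omega> \<in> space ?M. 0 < F y (point \<omega>)} \<in> sets ?M"
        by (intro borel_measurable_less borel_measurable_const point_meas F(1) y)
      moreover have "point -` G \<inter> space ?M = {\<omega> \<in> space ?M. 0 < F y (point \<omega>)}" using y by auto
      ultimately show "point -` G \<inter> space ?M \<in> sets ?M" by simp
    qed
    finally show "point -` U \<inter> space ?M \<in> sets ?M" .
  qed
  define \<mu> where "\<mu> = distr ?M borel point"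
  show thesis
  proof (rule that[of \<mu>])
    show "prob_space \<mu>" unfolding \<mu>_def by (rule M.prob_space_distr[OF point_borel])
    show "sets \<mu> = sets borel" by (simp add: \<mu>_def)
    have "closed K" by (rule compact_imp_closed[OF K])
    then have "emeasure \<mu> (- K) = emeasure ?M (point -` (- K) \<inter> space ?M)"
      unfolding \<mu>_def by (intro emeasure_distr[OF point_borel]) auto
    also have "point -` (- K) \<inter> space ?M = {}" using point(1) sp by auto
    finally show "emeasure \<mu> (- K) = 0" by simp
    fix f :: "'a \<Rightarrow> real" assume f: "continuous_on UNIV f"
    have fb: "f \<in> borel_measurable borel" using f by (rule borel_measurable_continuous_onI)
    have int_eq: "(\<integral>y. f y \<partial>\<mu>) = (\<integral>\<omega>. f (point \<omega>) \<partial>?M)"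
      unfolding \<mu>_def by (rule integral_distr[OF point_borel fb])
    obtain C where C: "\<And>y. y \<in> K \<Longrightarrow> \<bar>f y\<bar> \<le> C"
      using bdd_continuous[OF f] unfolding bounded_fun_def by blast
    have int1: "integrable ?M (\<lambda>\<omega>. f (point \<omega>))"
      by (rule M.integrable_const_bound[OF _ point_meas[OF f], of C]) (use C point(1) sp in \<open>auto intro!: AE_I2\<close>)
    have ind: "integrable ?M (indicator (slot ws) :: real \<Rightarrow> real)" for ws
      by (rule integrable_real_indicator[OF slot_sets]) (simp add: M.emeasure_eq_measure)
    have int2: "integrable ?M (step f n)" for n
      unfolding step_def[abs_def]
      by (intro Bochner_Integration.integrable_sum integrable_mult_right ind)
    have step_int: "(\<integral>\<omega>. step f n \<omega> \<partial>?M) = (\<Sum>ws\<in>words n. f (rep ws) * mass ws)" for n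
    proof -
      have 1: "(\<integral>\<omega>. indicator (slot ws) \<omega> \<partial>?M) = mass ws" for ws
      proof -
        have "slot ws \<inter> space ?M = slot ws" using slot_subset[of ws] sp by auto
        then show ?thesis using slot_measure by simp
      qed
      have "(\<integral>\<omega>. step f n \<omega> \<partial>?M) = (\<Sum>ws\<in>words n. \<integral>\<omega>. f (rep ws) * indicator (slot ws) \<omega> \<partial>?M)"
        unfolding step_def
        by (rule Bochner_Integration.integral_sum) (rule integrable_mult_right[OF ind])
      then show ?thesis by (simp only: integral_mult_right_zero 1)
    qed
    have "\<bar>(\<integral>y. f y \<partial>\<mu>) - L f\<bar> \<le> e" if e: "0 < e" for e
    proof -
      obtain n where n: "\<And>ws y y'. length ws = n \<Longrightarrow> y \<in> cell ws \<Longrightarrow> y' \<in> cell ws \<Longrightarrow> \<bar>f y - f y'\<bar> \<le> e / 2"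
        by (rule small_oscillation[OF f, of "e / 2"]) (use e in auto)
      have "\<bar>(\<integral>\<omega>. f (point \<omega>) \<partial>?M) - (\<integral>\<omega>. step f n \<omega> \<partial>?M)\<bar> = \<bar>\<integral>\<omega>. f (point \<omega>) - step f n \<omega> \<partial>?M\<bar>"
        by (simp only: Bochner_Integration.integral_diff[OF int1 int2])
      also have "\<dots> \<le> (\<integral>\<omega>. \<bar>f (point \<omega>) - step f n \<omega>\<bar> \<partial>?M)" by (rule integral_abs_bound)
      also have "\<dots> \<le> (\<integral>\<omega>. e / 2 \<partial>?M)"
        by (rule integral_mono)
          (use int1 int2 step_close[OF f _ n] sp in \<open>auto intro!: integrable_abs Bochner_Integration.integrable_diff\<close>)
      also have "\<dots> = e / 2" using M.prob_space by (simp add: sp)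
      finally have "\<bar>(\<integral>y. f y \<partial>\<mu>) - (\<Sum>ws\<in>words n. f (rep ws) * mass ws)\<bar> \<le> e / 2"
        unfolding int_eq step_int .
      moreover have "\<bar>L f - (\<Sum>ws\<in>words n. f (rep ws) * mass ws)\<bar> \<le> e / 2"
        by (rule L_step_close[OF f]) (rule n; assumption)
      ultimately show ?thesis by linarith
    qed
    then show "(\<integral>y. f y \<partial>\<mu>) = L f"
      using dense_ge[of 0 "\<bar>(\<integral>y. f y \<partial>\<mu>) - L f\<bar>"] by (metis abs_ge_zero abs_eq_0 antisym eq_iff_diff_eq_0)
  qed
qed

end

context smooth_manifold
begin

section \<open>Supports of currents and level cutoffs\<close>

lemma iterated_deriv_local_zero:
  assumes "set Us \<subseteq> vector_fields" "open N" "\<And>z. z \<in> N \<Longrightarrow> f z = 0" "y \<in> N"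
  shows "iterated_deriv Us f y = 0"
  using assms(1,4)
proof (induction Us arbitrary: y)
  case Nil
  then show ?case using assms(3) by (simp add: iterated_deriv_def)
next
  case (Cons U Us)
  have "iterated_deriv (U # Us) f y = U y (iterated_deriv Us f)" by (simp add: iterated_deriv_def)
  also have "\<dots> = 0"
    by (rule tangent_local_zero[OF vf_tangent assms(2) Cons.prems(2)]) (use Cons in auto)
  finally show ?case .
qed

lemma current_linear:
  "compact_current q T \<Longrightarrow> \<alpha> \<in> smooth_forms q \<Longrightarrow> \<beta> \<in> smooth_forms q \<Longrightarrow>
    T (\<lambda>x vs. a * \<alpha> x vs + b * \<beta> x vs) = a * T \<alpha> + b * T \<beta>"
  unfolding compact_current_def by blast

text \<open>
  If \<open>\<alpha>\<close> vanishes near \<open>L\<close>, then all seminorms of \<open>t \<alpha>\<close> vanish for every \<open>t\<close>, so that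
  \<open>\<bar>t * T \<alpha>\<bar> \<le> C\<close> for every \<open>t\<close>.
\<close>

lemma current_support:
  assumes T: "compact_current q T"
  obtains L where "compact L"
    "\<And>\<alpha> N. \<alpha> \<in> smooth_forms q \<Longrightarrow> open N \<Longrightarrow> L \<subseteq> N \<Longrightarrow> (\<And>z vs. z \<in> N \<Longrightarrow> \<alpha> z vs = 0) \<Longrightarrow> T \<alpha> = 0"
proof -
  obtain L F C where L: "compact L" "\<forall>(Us, Ws)\<in>F. set Us \<subseteq> vector_fields \<and> set Ws \<subseteq> vector_fields \<and> length Ws = q"
    and C: "\<forall>\<alpha>\<in>smooth_forms q. (\<forall>(Us, Ws)\<in>F. \<forall>x\<in>L. \<bar>iterated_deriv Us (apply_form \<alpha> Ws) x\<bar> \<le> 1) \<longrightarrow> \<bar>T \<alpha>\<bar> \<le> C"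
    using T unfolding compact_current_def by blast
  show thesis
  proof (rule that[OF L(1)])
    fix \<alpha> N assume \<alpha>: "\<alpha> \<in> smooth_forms q" and N: "open N" "L \<subseteq> N" and z: "\<And>z vs. z \<in> N \<Longrightarrow> \<alpha> z vs = 0"
    have bound: "\<bar>t * T \<alpha>\<bar> \<le> C" for t
    proof -
      let ?\<alpha> = "\<lambda>x vs. t * \<alpha> x vs + 0 * \<alpha> x vs"
      have "?\<alpha> \<in> smooth_forms q" by (rule form_lincomb[OF \<alpha> \<alpha> smooth_const smooth_const])
      moreover have "iterated_deriv Us (apply_form ?\<alpha> Ws) y = 0" if "(Us, Ws) \<in> F" "y \<in> L" for Us Ws y
        by (rule iterated_deriv_local_zero[OF _ N(1)]) (use L(2) that N(2) z in \<open>auto simp: apply_form_def\<close>)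
      then have "\<forall>(Us, Ws)\<in>F. \<forall>x\<in>L. \<bar>iterated_deriv Us (apply_form ?\<alpha> Ws) x\<bar> \<le> 1" by auto
      ultimately have "\<bar>T ?\<alpha>\<bar> \<le> C" using C by blast
      then show ?thesis using current_linear[OF T \<alpha> \<alpha>, of t 0] by simp
    qed
    show "T \<alpha> = 0"
    proof (rule ccontr)
      assume "T \<alpha> \<noteq> 0"
      then show False using bound[of "(C + 1) / T \<alpha>"] by simp
    qed
  qed
qed

end

context calibrated_manifold
begin

lemma strict_PSH_smooth: "u \<in> strict_PSH \<Longrightarrow> u \<in> smooth_functions"
  by (simp add: strict_PSH_def)

lemma strict_PSH_pos: "u \<in> strict_PSH \<Longrightarrow> \<xi> \<in> phi_planes z \<Longrightarrow> 0 < dd_phi u z \<xi>"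
  by (simp add: strict_PSH_def)

definition level_cutoff :: "('a \<Rightarrow> real) \<Rightarrow> real \<Rightarrow> 'a \<Rightarrow> real" where
  "level_cutoff u c y = cutoff (u y - c)"

lemma level_cutoff:
  shows level_cutoff_smooth: "u \<in> smooth_functions \<Longrightarrow> level_cutoff u c \<in> smooth_functions"
    and level_cutoff_1: "u y \<le> c + 1 \<Longrightarrow> level_cutoff u c y = 1"
    and level_cutoff_0: "u y \<ge> c + 2 \<Longrightarrow> level_cutoff u c y = 0"
    and level_cutoff_nonneg: "0 \<le> level_cutoff u c y"
proof -
  show "u \<in> smooth_functions \<Longrightarrow> level_cutoff u c \<in> smooth_functions"
    unfolding level_cutoff_def[abs_def]
    by (rule smooth_comp_real[OF smooth_diff[OF _ smooth_const] open_UNIV smooth_on_cutoff]) auto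
qed (simp_all add: level_cutoff_def cutoff_eq_1 cutoff_eq_0 cutoff_nonneg)

text \<open>
  In the chain rule for \<open>dd\<^sup>\<phi> v\<close> the second-order term is nonnegative because \<open>bend\<close> is convex,
  and the first-order factor is nonnegative, and at least \<open>1\<close> where \<open>u - c \<ge> 1\<close>.
\<close>

lemma bend_plurisubharmonic:
  fixes c :: real
  assumes u: "u \<in> strict_PSH" and \<xi>: "\<xi> \<in> phi_planes z"
  defines "v \<equiv> \<lambda>y. bend (u y - c)"
  shows "0 \<le> dd_phi v z \<xi>" "c + 1 \<le> u z \<Longrightarrow> dd_phi u z \<xi> \<le> dd_phi v z \<xi>"
proof -
  let ?d1 = "\<lambda>t. (flat_exp 2 t + flat_exp 0 t) * exp t" and ?d2 = "\<lambda>t. (flat_exp 4 t - 2 * flat_exp 3 t + 2 * flat_exp 2 t + flat_exp 0 t) * exp t"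
  note us = strict_PSH_smooth[OF u]
  have shift: "smooth_on UNIV (\<lambda>t. t - c)"
    using smooth_on_add[OF open_UNIV smooth_on_bounded_linear[OF open_UNIV bounded_linear_ident] smooth_on_const[of UNIV "- c"]]
    by simp
  have s: "smooth_on UNIV (\<lambda>t. bend (t - c))"
    by (rule smooth_on_compose[OF open_UNIV open_UNIV _ shift smooth_on_bend]) simp
  have sh: "((\<lambda>t. t - c) has_real_derivative 1) (at t)" for t
    by (auto intro!: derivative_eq_intros)
  have d1: "((\<lambda>t. bend (t - c)) has_real_derivative ?d1 (t - c)) (at t)" for t
    using DERIV_chain2[OF bend_deriv sh] by simp
  have d2: "((\<lambda>t. ?d1 (t - c)) has_real_derivative ?d2 (t - c)) (at t)" for t
    using DERIV_chain2[OF bend_deriv2 sh] by simp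
  obtain es where es: "orthonormal p z es" "same_plane p z es \<xi>" "\<phi> z es = 1"
    by (rule phi_planes_orthonormal[OF \<xi>])
  have vs: "v \<in> smooth_functions"
    unfolding v_def by (rule smooth_comp_real[OF us open_UNIV s]) simp
  have eq: "dd_phi v z \<xi> = ?d1 (u z - c) * dd_phi u z \<xi> + ?d2 (u z - c) * (\<Sum>i<p. ((es ! i) u)\<^sup>2)"
    using dd_phi_comp[OF us s d1 d2 es(1,3)] same_planeD[OF es(2) form_alt[OF dd_phi_form[OF vs]]]
      same_planeD[OF es(2) form_alt[OF dd_phi_form[OF us]]] unfolding v_def by simp
  have Q: "0 \<le> ?d2 (u z - c) * (\<Sum>i<p. ((es ! i) u)\<^sup>2)"
    by (intro mult_nonneg_nonneg bend_deriv2_nonneg sum_nonneg) simp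
  note pos = strict_PSH_pos[OF u \<xi>]
  have "0 \<le> ?d1 (u z - c) * dd_phi u z \<xi>" by (rule mult_nonneg_nonneg[OF bend_deriv_nonneg less_imp_le[OF pos]])
  then show "0 \<le> dd_phi v z \<xi>" unfolding eq using Q by linarith
  assume "c + 1 \<le> u z"
  then have "1 * dd_phi u z \<xi> \<le> ?d1 (u z - c) * dd_phi u z \<xi>"
    using pos by (intro mult_right_mono bend_deriv_ge_1) auto
  then show "dd_phi u z \<xi> \<le> dd_phi v z \<xi>" unfolding eq using Q by linarith
qed

lemma uminus_PSH:
  assumes f: "f \<in> smooth_functions" and "\<And>y \<xi>. \<xi> \<in> phi_planes y \<Longrightarrow> dd_phi f y \<xi> \<le> 0"
  shows "(\<lambda>y. - f y) \<in> PSH"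
  using dd_phi_lincomb[OF f f, of "-1" 0] assms by (simp add: PSH_def smooth_minus)

section \<open>Green's currents and hulls\<close>

text \<open>
  With a cutoff that is \<open>1\<close> near the compact set that carries \<open>T\<close>, the form \<open>dd\<^sup>\<phi> f\<close> becomes
  compactly supported and stays nonnegative on planes, while the value of \<open>T\<close> is unchanged. So
  the integral of \<open>f\<close> over \<open>\<mu>\<close> is at least \<open>f x\<close>, and it is at most the maximum of \<open>f\<close> on \<open>K\<close>.
\<close>

lemma greens_current_hull:
  assumes u: "u \<in> strict_PSH" "\<And>c. compact {y. u y \<le> c}" and K: "compact K" and T: "greens_current K x T"
  shows "x \<in> phi_hull K"
  unfolding phi_hull_def
proof (intro CollectI ballI)
  fix f assume f: "f \<in> PSH"
  then have fs: "f \<in> smooth_functions" and fp: "\<And>y \<xi>. \<xi> \<in> phi_planes y \<Longrightarrow> 0 \<le> dd_phi f y \<xi>"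
    by (auto simp: PSH_def)
  note us = strict_PSH_smooth[OF u(1)]
  from T obtain \<mu> where cc: "compact_current p T" and pc: "positive_current T"
    and \<mu>: "prob_space \<mu>" "sets \<mu> = sets borel" "emeasure \<mu> (- K) = 0"
    and bd: "\<And>f. f \<in> smooth_functions \<Longrightarrow> boundary_phi_boundary T f = (\<integral>y. f y \<partial>\<mu>) - (\<integral>y. f y \<partial>return borel x)"
    unfolding greens_current_def by blast
  obtain L where L: "compact L"
    "\<And>\<alpha> N. \<alpha> \<in> smooth_forms p \<Longrightarrow> open N \<Longrightarrow> L \<subseteq> N \<Longrightarrow> (\<And>z vs. z \<in> N \<Longrightarrow> \<alpha> z vs = 0) \<Longrightarrow> T \<alpha> = 0"
    by (rule current_support[OF cc]) blast
  obtain c where c: "\<And>z. z \<in> L \<Longrightarrow> \<bar>u z\<bar> \<le> c" by (rule smooth_bounded[OF us L(1)]) blast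
  let ?\<alpha> = "dd_phi f" and ?\<chi> = "level_cutoff u c"
  let ?\<beta> = "\<lambda>y vs. ?\<chi> y * ?\<alpha> y vs"
  have \<alpha>: "?\<alpha> \<in> smooth_forms p" by (rule dd_phi_form[OF fs])
  have \<beta>: "?\<beta> \<in> smooth_forms p" by (rule form_mult[OF \<alpha> level_cutoff_smooth[OF us]])
  have "T (\<lambda>y vs. 1 * ?\<alpha> y vs + (-1) * ?\<beta> y vs) = 0"
  proof (rule L(2))
    show "(\<lambda>y vs. 1 * ?\<alpha> y vs + (-1) * ?\<beta> y vs) \<in> smooth_forms p"
      by (rule form_lincomb[OF \<alpha> \<beta> smooth_const smooth_const])
    show "open {z. u z < c + 1}" by (intro open_Collect_less continuous_on_const smooth_continuous[OF us])
    show "L \<subseteq> {z. u z < c + 1}" using c by force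
    show "1 * ?\<alpha> z vs + (-1) * ?\<beta> z vs = 0" if "z \<in> {z. u z < c + 1}" for z vs
      using that level_cutoff_1[of u z c] by simp
  qed
  then have "T ?\<alpha> = T ?\<beta>" using current_linear[OF cc \<alpha> \<beta>, of 1 "-1"] by simp
  also have "0 \<le> T ?\<beta>"
  proof -
    have "positive_form ?\<beta>"
      unfolding positive_form_def using \<beta> fp level_cutoff_nonneg by simp
    moreover have "compactly_supported ?\<beta>"
    proof -
      have "{y. \<exists>vs. ?\<beta> y vs \<noteq> 0} \<subseteq> {y. u y \<le> c + 2}" using level_cutoff_0[of c u] by force
      then have "closure {y. \<exists>vs. ?\<beta> y vs \<noteq> 0} \<subseteq> {y. u y \<le> c + 2}"
        using compact_imp_closed[OF u(2)] by (rule closure_minimal)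
      then have "compact ({y. u y \<le> c + 2} \<inter> closure {y. \<exists>vs. ?\<beta> y vs \<noteq> 0})"
        by (intro compact_Int_closed u(2)) simp
      then show ?thesis
        using \<open>closure {y. \<exists>vs. ?\<beta> y vs \<noteq> 0} \<subseteq> {y. u y \<le> c + 2}\<close>
        unfolding compactly_supported_def by (simp add: Int_absorb1)
    qed
    ultimately show ?thesis using pc unfolding positive_current_def by blast
  qed
  finally have T_pos: "0 \<le> T ?\<alpha>" .
  interpret prob_space \<mu> by (rule \<mu>(1))
  have fb: "f \<in> borel_measurable borel"
    by (rule borel_measurable_continuous_onI[OF smooth_continuous[OF fs]])
  have fm: "f \<in> borel_measurable \<mu>" using fb \<mu>(2) by (simp cong: measurable_cong_sets)
  have sp: "space \<mu> = UNIV" using sets_eq_imp_space_eq[OF \<mu>(2)] by simp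
  have Kb: "- K \<in> sets \<mu>" using \<mu>(2) compact_imp_closed[OF K] by auto
  have ae: "AE y in \<mu>. y \<in> K"
    by (rule AE_I[OF _ \<mu>(3) Kb]) auto
  have "K \<noteq> {}" using \<mu>(3) emeasure_space_1 sp by auto
  then obtain y where y: "y \<in> K" "\<And>z. z \<in> K \<Longrightarrow> f z \<le> f y"
    using continuous_attains_sup[OF K _ continuous_on_subset[OF smooth_continuous[OF fs]]] by blast
  obtain C where C: "\<And>z. z \<in> K \<Longrightarrow> \<bar>f z\<bar> \<le> C" by (rule smooth_bounded[OF fs K]) blast
  have int: "integrable \<mu> f"
    by (rule integrable_const_bound[OF _ fm, of C]) (use ae C in \<open>auto elim!: eventually_mono\<close>)
  have "(\<integral>z. f z \<partial>\<mu>) \<le> (\<integral>z. f y \<partial>\<mu>)"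
    by (rule integral_mono_AE[OF int]) (use ae y(2) in \<open>auto elim!: eventually_mono\<close>)
  also have "\<dots> = f y" by (simp add: prob_space)
  finally have "f x \<le> f y"
    using T_pos bd[OF fs] integral_return[of x borel f] fb by (simp add: boundary_phi_boundary_def)
  then have "ereal (f x) \<le> ereal (f y)" by simp
  also have "\<dots> \<le> (SUP y\<in>K. ereal (f y))" by (rule SUP_upper[OF y(1)])
  finally show "ereal (f x) \<le> (SUP y\<in>K. ereal (f y))" .
qed

text \<open>
  A pair of a form and a function is encoded as one function on a disjoint sum, so that the
  order of pairs is the pointwise order of \<open>positive_extension\<close>.
\<close>

definition test_pair :: "'a form \<Rightarrow> ('a \<Rightarrow> real) \<Rightarrow> ('a \<times> 'a tvec list) + 'a \<Rightarrow> real" where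
  "test_pair \<alpha> h = case_sum (\<lambda>(y, \<xi>). \<alpha> y \<xi>) h"

lemma test_pair_simps [simp]:
  "test_pair \<alpha> h (Inl (y, \<xi>)) = \<alpha> y \<xi>" "test_pair \<alpha> h (Inr y) = h y"
  by (simp_all add: test_pair_def)

lemma test_pair_lincomb:
  "test_pair (\<lambda>y \<xi>. a * \<alpha> y \<xi> + b * \<beta> y \<xi>) (\<lambda>y. a * h y + b * k y) =
    (\<lambda>z. a * test_pair \<alpha> h z + b * test_pair \<beta> k z)"
  by (auto simp: test_pair_def fun_eq_iff split: sum.split)

text \<open>
  \<open>M\<close> is the space of the pairs \<open>(- dd\<^sup>\<phi> f, f)\<close>, with the functional \<open>f x\<close>, and \<open>S\<close> collects the
  \<open>\<phi>\<close>-planes and the points of \<open>K\<close>. \<open>\<Gamma>\<close> is a positive extension, \<open>\<Lambda> \<alpha>\<close> its value at \<open>(\<alpha>, 0)\<close> and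
  \<open>m h\<close> its value at \<open>(0, h)\<close>. The formula for \<open>\<Lambda> (dd\<^sup>\<phi> f)\<close> is read off from
  \<open>(dd\<^sup>\<phi> f, 0) = (0, f) - (- dd\<^sup>\<phi> f, f)\<close>. The set \<open>A\<close> is the domain of \<open>\<Lambda>\<close>; forms of noncompact
  support belong to it only if \<open>dd\<^sup>\<phi>\<close> of some function controls them.
\<close>

lemma duality_functional:
  assumes u: "u \<in> strict_PSH" and K: "compact K" and x: "x \<in> phi_hull K"
  obtains A and \<Lambda> :: "'a form \<Rightarrow> real" and \<mu> :: "'a measure" where
    "\<And>\<alpha> L. \<alpha> \<in> smooth_forms p \<Longrightarrow> compact L \<Longrightarrow> (\<And>y vs. y \<notin> L \<Longrightarrow> \<alpha> y vs = 0) \<Longrightarrow> \<alpha> \<in> A"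
    "\<And>f. f \<in> smooth_functions \<Longrightarrow> dd_phi f \<in> A"
    "\<And>\<alpha> \<beta> a b. \<alpha> \<in> A \<Longrightarrow> \<beta> \<in> A \<Longrightarrow> (\<lambda>y vs. a * \<alpha> y vs + b * \<beta> y vs) \<in> A"
    "\<And>\<alpha> \<beta> a b. \<alpha> \<in> A \<Longrightarrow> \<beta> \<in> A \<Longrightarrow> \<Lambda> (\<lambda>y vs. a * \<alpha> y vs + b * \<beta> y vs) = a * \<Lambda> \<alpha> + b * \<Lambda> \<beta>"
    "\<And>\<alpha>. \<alpha> \<in> A \<Longrightarrow> (\<And>y \<xi>. \<xi> \<in> phi_planes y \<Longrightarrow> 0 \<le> \<alpha> y \<xi>) \<Longrightarrow> 0 \<le> \<Lambda> \<alpha>"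
    "prob_space \<mu>" "sets \<mu> = sets borel" "emeasure \<mu> (- K) = 0"
    "\<And>f. f \<in> smooth_functions \<Longrightarrow> \<Lambda> (dd_phi f) = (\<integral>y. f y \<partial>\<mu>) - f x"
proof -
  note us = strict_PSH_smooth[OF u]
  define S where "S = Inl ` {(y, \<xi>). \<xi> \<in> phi_planes y} \<union> Inr ` K"
  have SE: "P z" if "z \<in> S" "\<And>y \<xi>. \<xi> \<in> phi_planes y \<Longrightarrow> P (Inl (y, \<xi>))" "\<And>y. y \<in> K \<Longrightarrow> P (Inr y)" for P z
    using that by (auto simp: S_def)
  have SI: "\<xi> \<in> phi_planes y \<Longrightarrow> Inl (y, \<xi>) \<in> S" "y \<in> K \<Longrightarrow> Inr y \<in> S" for y \<xi>
    by (auto simp: S_def)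
  define w where "w f = test_pair (\<lambda>y \<xi>. - dd_phi f y \<xi>) f" for f
  define M where "M = w ` smooth_functions"
  define l where "l m = m (Inr x)" for m :: "('a \<times> 'a tvec list) + 'a \<Rightarrow> real"
  define V where "V = {v. \<exists>m\<in>M. \<exists>n\<in>M. \<forall>z\<in>S. m z \<le> v z \<and> v z \<le> n z}"
  have w_lin: "(\<lambda>z. a * w f z + b * w h z) = w (\<lambda>y. a * f y + b * h y)"
    if "f \<in> smooth_functions" "h \<in> smooth_functions" for f h a b
  proof -
    have "(\<lambda>y \<xi>. - dd_phi (\<lambda>y. a * f y + b * h y) y \<xi>) = (\<lambda>y \<xi>. a * - dd_phi f y \<xi> + b * - dd_phi h y \<xi>)"
      using dd_phi_lincomb[OF that] by (simp add: fun_eq_iff)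
    then show ?thesis unfolding w_def test_pair_lincomb[symmetric] by simp
  qed
  have M_ne: "M \<noteq> {}" unfolding M_def using smooth_const[of 0] by blast
  have M_lin: "(\<lambda>z. a * m z + b * n z) \<in> M" if "m \<in> M" "n \<in> M" for m n a b
    using that w_lin by (auto simp: M_def intro!: imageI smooth_add smooth_cmult)
  have l_pos: "0 \<le> l m" if m: "m \<in> M" and ge: "\<And>z. z \<in> S \<Longrightarrow> 0 \<le> m z" for m
  proof -
    obtain f where f: "f \<in> smooth_functions" "m = w f" using m by (auto simp: M_def)
    have "(\<lambda>y. - f y) \<in> PSH"
      by (rule uminus_PSH[OF f(1)]) (use ge[OF SI(1)] f(2) in \<open>force simp: w_def\<close>)
    then have "ereal (- f x) \<le> (SUP y\<in>K. ereal (- f y))" using x by (auto simp: phi_hull_def)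
    also have "\<dots> \<le> 0" by (rule SUP_least) (use ge[OF SI(2)] f(2) in \<open>force simp: w_def\<close>)
    finally show ?thesis by (simp add: l_def f(2) w_def)
  qed
  obtain \<Gamma> where V_lin: "\<And>v w a b. v \<in> V \<Longrightarrow> w \<in> V \<Longrightarrow> (\<lambda>z. a * v z + b * w z) \<in> V"
    and \<Gamma>_lin: "\<And>v w a b. v \<in> V \<Longrightarrow> w \<in> V \<Longrightarrow> \<Gamma> (\<lambda>z. a * v z + b * w z) = a * \<Gamma> v + b * \<Gamma> w"
    and \<Gamma>_pos: "\<And>v. v \<in> V \<Longrightarrow> (\<And>z. z \<in> S \<Longrightarrow> 0 \<le> v z) \<Longrightarrow> 0 \<le> \<Gamma> v"
    and \<Gamma>_M: "\<And>m. m \<in> M \<Longrightarrow> \<Gamma> m = l m"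
    unfolding V_def
    by (rule positive_extension[where M=M and S=S and l=l, OF M_ne M_lin _ l_pos]) (auto simp: l_def)
  have VI: "v \<in> V" if "f \<in> smooth_functions" "h \<in> smooth_functions"
      "\<And>z. z \<in> S \<Longrightarrow> w f z \<le> v z" "\<And>z. z \<in> S \<Longrightarrow> v z \<le> w h z" for v f h
    using that unfolding V_def M_def by blast
  have wV: "w f \<in> V" if "f \<in> smooth_functions" for f by (rule VI[OF that that]) auto
  define A where "A = {\<alpha>. test_pair \<alpha> (\<lambda>_. 0) \<in> V}"
  define \<Lambda> where "\<Lambda> \<alpha> = \<Gamma> (test_pair \<alpha> (\<lambda>_. 0))" for \<alpha>
  define m where "m h = \<Gamma> (test_pair (\<lambda>_ _. 0) h)" for h
  have hV: "test_pair (\<lambda>_ _. 0) h \<in> V" if h: "bounded_fun K h" for h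
  proof -
    obtain C where C: "\<forall>y\<in>K. \<bar>h y\<bar> \<le> C" using h unfolding bounded_fun_def by blast
    show ?thesis
      by (rule VI[OF smooth_const[of "- C"] smooth_const[of C]]; erule SE)
        (use C in \<open>force simp: w_def dd_phi_const abs_le_iff\<close>)+
  qed
  obtain B :: "nat \<Rightarrow> 'a set" where B: "\<And>i. open (B i)" "\<And>U y. open U \<Longrightarrow> y \<in> U \<Longrightarrow> \<exists>i. y \<in> B i \<and> B i \<subseteq> U"
    by (rule nat_indexed_base) blast
  interpret mean_on_compact K m B
  proof
    show "m (\<lambda>y. a * h y + b * k y) = a * m h + b * m k" if "bounded_fun K h" "bounded_fun K k" for h k a b
      using \<Gamma>_lin[OF hV[OF that(1)] hV[OF that(2)], of a b]
      unfolding m_def test_pair_lincomb[symmetric] by simp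
    show "0 \<le> m h" if "bounded_fun K h" "\<And>y. y \<in> K \<Longrightarrow> 0 \<le> h y" for h
      unfolding m_def by (rule \<Gamma>_pos[OF hV[OF that(1)]], erule SE) (use that(2) in auto)
    have "test_pair (\<lambda>_ _. 0) (\<lambda>_. 1) = w (\<lambda>_. 1)" by (simp add: w_def dd_phi_const)
    then show "m (\<lambda>_. 1) = 1"
      using \<Gamma>_M[of "w (\<lambda>_. 1)"] by (simp add: m_def M_def l_def w_def)
  qed (use K B in auto)
  have sep: "\<exists>f. continuous_on UNIV f \<and> 0 < f y \<and> (\<forall>z. z \<notin> U \<longrightarrow> f z \<le> (0::real))" if U: "open U" "y \<in> U" for U :: "'a set" and y
  proof -
    obtain \<kappa> where "\<kappa> \<in> smooth_functions" "\<kappa> y = 1" "\<And>z. z \<notin> U \<Longrightarrow> \<kappa> z = 0"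
      by (rule bump_exists[OF U]) blast
    then show ?thesis using smooth_continuous by (intro exI[of _ \<kappa>]) auto
  qed
  obtain \<mu> where \<mu>: "prob_space \<mu>" "sets \<mu> = sets borel" "emeasure \<mu> (- K) = 0"
    "\<And>f. continuous_on UNIV f \<Longrightarrow> (\<integral>y. f y \<partial>\<mu>) = m f"
    by (rule representing_measure[OF sep]) blast+
  have dd: "test_pair (dd_phi f) (\<lambda>_. 0) = (\<lambda>z. 1 * test_pair (\<lambda>_ _. 0) f z + (-1) * w f z)" for f
    unfolding w_def test_pair_lincomb[symmetric] by simp
  have bf: "bounded_fun K f" if "f \<in> smooth_functions" for f
    by (rule bdd_continuous[OF smooth_continuous[OF that]])
  show thesis
  proof (rule that[of A \<Lambda> \<mu>])
    show "dd_phi f \<in> A" if "f \<in> smooth_functions" for f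
      unfolding A_def mem_Collect_eq dd by (intro V_lin hV bf wV that)
    show "\<Lambda> (dd_phi f) = (\<integral>y. f y \<partial>\<mu>) - f x" if f: "f \<in> smooth_functions" for f
      unfolding \<Lambda>_def dd \<mu>(4)[OF smooth_continuous[OF f]]
      using \<Gamma>_lin[OF hV[OF bf[OF f]] wV[OF f], of 1 "-1"] \<Gamma>_M[of "w f"] f
      by (simp add: m_def M_def l_def) (simp add: w_def)
    show "\<alpha> \<in> A" if \<alpha>: "\<alpha> \<in> smooth_forms p" and L: "compact L" and z: "\<And>y vs. y \<notin> L \<Longrightarrow> \<alpha> y vs = 0" for \<alpha> L
    proof -
      obtain b where b: "0 \<le> b" "\<And>z \<xi>. z \<in> L \<Longrightarrow> \<xi> \<in> phi_planes z \<Longrightarrow> \<bar>\<alpha> z \<xi>\<bar> \<le> b"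
        by (rule form_bounded_on_planes[OF L \<alpha>]) blast
      obtain c where c: "0 < c" "\<And>z \<xi>. z \<in> L \<Longrightarrow> \<xi> \<in> phi_planes z \<Longrightarrow> c \<le> dd_phi u z \<xi>"
        by (rule strict_on_compact[OF L dd_phi_form[OF us] strict_PSH_pos[OF u]]) blast+
      obtain d where d: "\<And>y. y \<in> K \<Longrightarrow> \<bar>u y\<bar> \<le> d" by (rule smooth_bounded[OF us K]) blast
      \<comment> \<open>On planes \<open>\<bar>\<alpha>\<bar> \<le> C * dd_phi u\<close>, so \<open>\<alpha>\<close> lies between the forms of the pairs of \<open>C * u\<close>
        and \<open>- C * u\<close>; the constant \<open>C * d\<close> corrects the functions on \<open>K\<close>, where the second
        component of the pair is \<open>0\<close>.\<close>
      define C where "C = b / c"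
      have C: "0 \<le> C" using b c by (simp add: C_def)
      have est: "\<bar>\<alpha> y \<xi>\<bar> \<le> C * dd_phi u y \<xi>" if \<xi>: "\<xi> \<in> phi_planes y" for y \<xi>
      proof (cases "y \<in> L")
        case True
        have "\<bar>\<alpha> y \<xi>\<bar> \<le> C * c" using b(2)[OF True \<xi>] c(1) by (simp add: C_def)
        also have "\<dots> \<le> C * dd_phi u y \<xi>" by (rule mult_left_mono[OF c(2)[OF True \<xi>] C])
        finally show ?thesis .
      next
        case False
        then show ?thesis using z C strict_PSH_pos[OF u \<xi>] by simp
      qed
      have estK: "\<bar>C * u y\<bar> \<le> C * d" if "y \<in> K" for y
        unfolding abs_mult using C d[OF that] by (simp add: mult_left_mono)
      have dd_comb: "dd_phi (\<lambda>y. a * u y + b * 1) = (\<lambda>y \<xi>. a * dd_phi u y \<xi>)" for a b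
        using dd_phi_lincomb[OF us smooth_const[of 1], of a b] by (simp add: dd_phi_const)
      have sm: "(\<lambda>y. a * u y + b * 1) \<in> smooth_functions" for a b
        by (intro smooth_add smooth_cmult us smooth_const)
      have wI: "w (\<lambda>y. a * u y + b * 1) (Inl (y, \<xi>)) = - (a * dd_phi u y \<xi>)" for a b y \<xi>
        by (simp only: w_def test_pair_simps dd_comb)
      have wR: "w (\<lambda>y. a * u y + b * 1) (Inr y) = a * u y + b" for a b y
        by (simp add: w_def)
      show ?thesis
        unfolding A_def mem_Collect_eq
      proof (rule VI[OF sm[of C "- (C * d)"] sm[of "- C" "C * d"]])
        fix z assume z: "z \<in> S"
        show "w (\<lambda>y. C * u y + - (C * d) * 1) z \<le> test_pair \<alpha> (\<lambda>_. 0) z"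
        proof (rule SE[OF z])
          show "w (\<lambda>y. C * u y + - (C * d) * 1) (Inl (y, \<xi>)) \<le> test_pair \<alpha> (\<lambda>_. 0) (Inl (y, \<xi>))"
            if "\<xi> \<in> phi_planes y" for y \<xi>
            unfolding wI test_pair_simps using est[OF that] by linarith
          show "w (\<lambda>y. C * u y + - (C * d) * 1) (Inr y) \<le> test_pair \<alpha> (\<lambda>_. 0) (Inr y)"
            if "y \<in> K" for y
            unfolding wR test_pair_simps using estK[OF that] by linarith
        qed
        show "test_pair \<alpha> (\<lambda>_. 0) z \<le> w (\<lambda>y. - C * u y + C * d * 1) z"
        proof (rule SE[OF z])
          show "test_pair \<alpha> (\<lambda>_. 0) (Inl (y, \<xi>)) \<le> w (\<lambda>y. - C * u y + C * d * 1) (Inl (y, \<xi>))"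
            if "\<xi> \<in> phi_planes y" for y \<xi>
            unfolding wI test_pair_simps using est[OF that] by linarith
          show "test_pair \<alpha> (\<lambda>_. 0) (Inr y) \<le> w (\<lambda>y. - C * u y + C * d * 1) (Inr y)"
            if "y \<in> K" for y
            unfolding wR test_pair_simps using estK[OF that] by linarith
        qed
      qed
    qed
    have comb: "test_pair (\<lambda>y vs. a * \<alpha> y vs + b * \<beta> y vs) (\<lambda>_. 0) =
        (\<lambda>z. a * test_pair \<alpha> (\<lambda>_. 0) z + b * test_pair \<beta> (\<lambda>_. 0) z)" for a b \<alpha> \<beta>
      unfolding test_pair_lincomb[symmetric] by simp
    show "(\<lambda>y vs. a * \<alpha> y vs + b * \<beta> y vs) \<in> A" if "\<alpha> \<in> A" "\<beta> \<in> A" for \<alpha> \<beta> a b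
      using that V_lin unfolding A_def mem_Collect_eq comb by blast
    show "\<Lambda> (\<lambda>y vs. a * \<alpha> y vs + b * \<beta> y vs) = a * \<Lambda> \<alpha> + b * \<Lambda> \<beta>" if "\<alpha> \<in> A" "\<beta> \<in> A" for \<alpha> \<beta> a b
      using that unfolding A_def \<Lambda>_def mem_Collect_eq comb by (intro \<Gamma>_lin)
    show "0 \<le> \<Lambda> \<alpha>" if "\<alpha> \<in> A" "\<And>y \<xi>. \<xi> \<in> phi_planes y \<Longrightarrow> 0 \<le> \<alpha> y \<xi>" for \<alpha>
      unfolding \<Lambda>_def by (rule \<Gamma>_pos, use that(1) in \<open>simp add: A_def\<close>, erule SE) (use that(2) in auto)
  qed (fact \<mu>)+
qed

text \<open>
  \<open>\<Lambda>\<close> is zero on compactly supported forms that vanish where \<open>u < c + 1\<close>. So multiplying a form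
  by a cutoff that is \<open>1\<close> where \<open>u \<le> c + 1\<close> before applying \<open>\<Lambda>\<close> does not change the boundary,
  while the result is a functional on all smooth forms that depends only on their values where
  \<open>u \<le> c + 2\<close>.
\<close>

lemma greens_current_exists:
  assumes u: "u \<in> strict_PSH" "\<And>c. compact {y. u y \<le> c}" and K: "compact K" and x: "x \<in> phi_hull K"
  shows "\<exists>T. greens_current K x T"
proof (rule duality_functional[OF u(1) K x])
  note us = strict_PSH_smooth[OF u(1)]
  fix A and \<Lambda> :: "'a form \<Rightarrow> real" and \<mu> :: "'a measure"
  assume A_supp: "\<And>\<alpha> L. \<alpha> \<in> smooth_forms p \<Longrightarrow> compact L \<Longrightarrow> (\<And>y vs. y \<notin> L \<Longrightarrow> \<alpha> y vs = 0) \<Longrightarrow> \<alpha> \<in> A"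
    and A_dd: "\<And>f. f \<in> smooth_functions \<Longrightarrow> dd_phi f \<in> A"
    and A_lin: "\<And>\<alpha> \<beta> a b. \<alpha> \<in> A \<Longrightarrow> \<beta> \<in> A \<Longrightarrow> (\<lambda>y vs. a * \<alpha> y vs + b * \<beta> y vs) \<in> A"
    and \<Lambda>_lin: "\<And>\<alpha> \<beta> a b. \<alpha> \<in> A \<Longrightarrow> \<beta> \<in> A \<Longrightarrow> \<Lambda> (\<lambda>y vs. a * \<alpha> y vs + b * \<beta> y vs) = a * \<Lambda> \<alpha> + b * \<Lambda> \<beta>"
    and \<Lambda>_pos: "\<And>\<alpha>. \<alpha> \<in> A \<Longrightarrow> (\<And>y \<xi>. \<xi> \<in> phi_planes y \<Longrightarrow> 0 \<le> \<alpha> y \<xi>) \<Longrightarrow> 0 \<le> \<Lambda> \<alpha>"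
    and \<mu>: "prob_space \<mu>" "sets \<mu> = sets borel" "emeasure \<mu> (- K) = 0"
    and \<Lambda>_dd: "\<And>f. f \<in> smooth_functions \<Longrightarrow> \<Lambda> (dd_phi f) = (\<integral>y. f y \<partial>\<mu>) - f x"
  have \<Lambda>_mono: "\<Lambda> \<alpha> \<le> C * \<Lambda> \<beta>"
    if "\<alpha> \<in> A" "\<beta> \<in> A" "\<And>y \<xi>. \<xi> \<in> phi_planes y \<Longrightarrow> \<alpha> y \<xi> \<le> C * \<beta> y \<xi>" for \<alpha> \<beta> C
    using \<Lambda>_pos[OF A_lin[OF that(2,1), of C "-1"]] \<Lambda>_lin[OF that(2,1), of C "-1"] that(3) by simp
  have Kb: "- K \<in> sets \<mu>" using \<mu>(2) compact_imp_closed[OF K] by auto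
  have ae: "AE y in \<mu>. y \<in> K" by (rule AE_I[OF _ \<mu>(3) Kb]) auto
  have meas: "f \<in> borel_measurable \<mu>" if "f \<in> smooth_functions" for f
    using borel_measurable_continuous_onI[OF smooth_continuous[OF that]] \<mu>(2) by (simp cong: measurable_cong_sets)
  have int_cong: "(\<integral>y. f y \<partial>\<mu>) = (\<integral>y. h y \<partial>\<mu>)"
    if "f \<in> smooth_functions" "h \<in> smooth_functions" "\<And>y. y \<in> K \<Longrightarrow> f y = h y" for f h
    by (rule integral_cong_AE) (use meas that ae in \<open>auto elim!: eventually_mono\<close>)
  obtain c where "\<And>y. y \<in> insert x K \<Longrightarrow> \<bar>u y\<bar> \<le> c"
    by (rule smooth_bounded[OF us, of "insert x K"]) (use K in auto)
  then have c: "u y \<le> c" if "y \<in> insert x K" for y using that by (meson abs_le_D1)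
  let ?v = "\<lambda>y. bend (u y - c)"
  have v: "?v \<in> smooth_functions"
    by (rule smooth_comp_real[OF smooth_diff[OF us smooth_const] open_UNIV smooth_on_bend]) simp
  \<comment> \<open>\<open>?v\<close> vanishes on \<open>K\<close> and at \<open>x\<close> by the choice of \<open>c\<close>.\<close>
  have \<Lambda>_v: "\<Lambda> (dd_phi ?v) = 0"
  proof -
    have "(\<integral>y. ?v y \<partial>\<mu>) = (\<integral>y. 0 \<partial>\<mu>)"
      by (rule int_cong[OF v smooth_const]) (use c bend_eq_0 in auto)
    then show ?thesis using \<Lambda>_dd[OF v] c[of x] bend_eq_0[of "u x - c"] by simp
  qed
  have vanish: "\<Lambda> \<alpha> = 0"
    if \<alpha>: "\<alpha> \<in> smooth_forms p" and L: "compact L" "\<And>y vs. y \<notin> L \<Longrightarrow> \<alpha> y vs = 0"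
      and low: "\<And>y vs. u y < c + 1 \<Longrightarrow> \<alpha> y vs = 0" for \<alpha> L
  proof -
    have \<alpha>A: "\<alpha> \<in> A" by (rule A_supp[OF \<alpha> L])
    obtain b where b: "0 \<le> b" "\<And>z \<xi>. z \<in> L \<Longrightarrow> \<xi> \<in> phi_planes z \<Longrightarrow> \<bar>\<alpha> z \<xi>\<bar> \<le> b"
      by (rule form_bounded_on_planes[OF L(1) \<alpha>]) blast
    obtain e where e: "0 < e" "\<And>z \<xi>. z \<in> L \<Longrightarrow> \<xi> \<in> phi_planes z \<Longrightarrow> e \<le> dd_phi u z \<xi>"
      by (rule strict_on_compact[OF L(1) dd_phi_form[OF us] strict_PSH_pos[OF u(1)]]) blast+
    have est: "\<bar>\<alpha> y \<xi>\<bar> \<le> b / e * dd_phi ?v y \<xi>" if \<xi>: "\<xi> \<in> phi_planes y" for y \<xi>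
    proof (cases "y \<in> L \<and> c + 1 \<le> u y")
      case True
      have "\<bar>\<alpha> y \<xi>\<bar> \<le> b / e * e" using b(2)[of y \<xi>] True \<xi> e(1) by simp
      also have "\<dots> \<le> b / e * dd_phi u y \<xi>"
        by (rule mult_left_mono) (use e True \<xi> b(1) in auto)
      also have "\<dots> \<le> b / e * dd_phi ?v y \<xi>"
        by (rule mult_left_mono[OF bend_plurisubharmonic(2)[OF u(1) \<xi>]]) (use True e(1) b(1) in auto)
      finally show ?thesis .
    next
      case False
      then have "\<alpha> y \<xi> = 0" using L(2) low by (cases "y \<in> L") auto
      moreover have "0 \<le> b / e * dd_phi ?v y \<xi>"
        by (intro mult_nonneg_nonneg bend_plurisubharmonic(1)[OF u(1) \<xi>]) (use e(1) b(1) in auto)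
      ultimately show ?thesis by simp
    qed
    have "\<Lambda> \<alpha> \<le> b / e * \<Lambda> (dd_phi ?v)"
      by (rule \<Lambda>_mono[OF \<alpha>A A_dd[OF v]]) (use est in \<open>auto simp: abs_le_iff\<close>)
    moreover have "\<Lambda> (\<lambda>y vs. (-1) * \<alpha> y vs + 0 * \<alpha> y vs) \<le> b / e * \<Lambda> (dd_phi ?v)"
      by (rule \<Lambda>_mono[OF A_lin[OF \<alpha>A \<alpha>A] A_dd[OF v]]) (use est in \<open>auto simp: abs_le_iff\<close>)
    ultimately show ?thesis using \<Lambda>_lin[OF \<alpha>A \<alpha>A, of "-1" 0] \<Lambda>_v by simp
  qed
  let ?\<chi> = "level_cutoff u c"
  let ?L = "{y. u y \<le> c + 2}"
  note \<chi> = level_cutoff_smooth[OF us, of c]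
  define T where "T \<alpha> = \<Lambda> (\<lambda>y vs. ?\<chi> y * \<alpha> y vs)" for \<alpha>
  have cut: "(\<lambda>y vs. ?\<chi> y * \<alpha> y vs) \<in> smooth_forms p" "(\<lambda>y vs. ?\<chi> y * \<alpha> y vs) \<in> A"
    if \<alpha>: "\<alpha> \<in> smooth_forms p" for \<alpha>
  proof -
    show "(\<lambda>y vs. ?\<chi> y * \<alpha> y vs) \<in> smooth_forms p" by (rule form_mult[OF \<alpha> \<chi>])
    then show "(\<lambda>y vs. ?\<chi> y * \<alpha> y vs) \<in> A"
      by (rule A_supp[OF _ u(2)[of "c + 2"]]) (use level_cutoff_0[of c u] in simp)
  qed
  have T_lin: "T (\<lambda>y vs. a * \<alpha> y vs + b * \<beta> y vs) = a * T \<alpha> + b * T \<beta>"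
    if "\<alpha> \<in> smooth_forms p" "\<beta> \<in> smooth_forms p" for \<alpha> \<beta> a b
  proof -
    have "(\<lambda>y vs. ?\<chi> y * (a * \<alpha> y vs + b * \<beta> y vs)) =
        (\<lambda>y vs. a * (?\<chi> y * \<alpha> y vs) + b * (?\<chi> y * \<beta> y vs))"
      by (simp add: fun_eq_iff algebra_simps)
    then show ?thesis unfolding T_def using \<Lambda>_lin[OF cut(2)[OF that(1)] cut(2)[OF that(2)]] by simp
  qed
  \<comment> \<open>The calibration is the constant \<open>1\<close> on all \<open>\<phi>\<close>-planes, so positivity bounds \<open>T\<close> by its value
    there.\<close>
  have T_abs: "\<bar>T \<alpha>\<bar> \<le> C * T \<phi>"
    if \<alpha>: "\<alpha> \<in> smooth_forms p" and le: "\<And>y \<xi>. y \<in> ?L \<Longrightarrow> \<xi> \<in> phi_planes y \<Longrightarrow> \<bar>\<alpha> y \<xi>\<bar> \<le> C" for \<alpha> C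
  proof -
    have est: "\<bar>?\<chi> y * \<alpha> y \<xi>\<bar> \<le> C * (?\<chi> y * \<phi> y \<xi>)" if \<xi>: "\<xi> \<in> phi_planes y" for y \<xi>
    proof (cases "y \<in> ?L")
      case True
      have "\<phi> y \<xi> = 1" using \<xi> by (simp add: phi_planes_def)
      then show ?thesis
        using mult_left_mono[OF le[OF True \<xi>] level_cutoff_nonneg[of u c y]] level_cutoff_nonneg[of u c y]
        by (simp add: abs_mult mult.commute)
    next
      case False
      then show ?thesis using level_cutoff_0[of c u y] by simp
    qed
    have "T \<alpha> \<le> C * T \<phi>"
      unfolding T_def by (rule \<Lambda>_mono[OF cut(2)[OF \<alpha>] cut(2)[OF form]]) (use est in \<open>auto simp: abs_le_iff\<close>)
    moreover have "\<Lambda> (\<lambda>y vs. (-1) * (?\<chi> y * \<alpha> y vs) + 0 * (?\<chi> y * \<alpha> y vs)) \<le> C * T \<phi>"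
      unfolding T_def
      by (rule \<Lambda>_mono[OF A_lin[OF cut(2)[OF \<alpha>] cut(2)[OF \<alpha>]] cut(2)[OF form]]) (use est in \<open>auto simp: abs_le_iff\<close>)
    then have "- T \<alpha> \<le> C * T \<phi>"
      using \<Lambda>_lin[OF cut(2)[OF \<alpha>] cut(2)[OF \<alpha>], of "-1" 0] by (simp add: T_def)
    ultimately show ?thesis by (simp add: abs_le_iff)
  qed
  have "compact_current p T"
    unfolding compact_current_def
  proof (intro conjI ballI allI T_lin)
    obtain R Es where Es: "controls Es R ?L" by (rule controls_compact[OF u(2)])
    let ?F = "Pair [] ` Es"
    show "\<exists>L F C. compact L \<and> finite F \<and>
        (\<forall>(Us, Ws)\<in>F. set Us \<subseteq> vector_fields \<and> set Ws \<subseteq> vector_fields \<and> length Ws = p) \<and>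
        (\<forall>\<alpha>\<in>smooth_forms p.
           (\<forall>(Us, Ws)\<in>F. \<forall>x\<in>L. \<bar>iterated_deriv Us (apply_form \<alpha> Ws) x\<bar> \<le> 1) \<longrightarrow> \<bar>T \<alpha>\<bar> \<le> C)"
    proof (intro exI[of _ ?L] exI[of _ ?F] exI[of _ "R * T \<phi>"] conjI ballI impI)
      show "compact ?L" by (rule u(2))
      show "finite ?F" using Es by (simp add: controls_def)
      show "case z of (Us, Ws) \<Rightarrow> set Us \<subseteq> vector_fields \<and> set Ws \<subseteq> vector_fields \<and> length Ws = p" if "z \<in> ?F" for z
        using that Es by (auto simp: controls_def)
      fix \<alpha> assume \<alpha>: "\<alpha> \<in> smooth_forms p"
        and b: "\<forall>(Us, Ws)\<in>?F. \<forall>x\<in>?L. \<bar>iterated_deriv Us (apply_form \<alpha> Ws) x\<bar> \<le> 1"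
      show "\<bar>T \<alpha>\<bar> \<le> R * T \<phi>"
      proof (rule T_abs[OF \<alpha>])
        fix y \<xi> assume y: "y \<in> ?L" and \<xi>: "\<xi> \<in> phi_planes y"
        have "\<bar>apply_form \<alpha> Ws y\<bar> \<le> 1" if "Ws \<in> Es" for Ws
          using b y that by (auto simp: iterated_deriv_def)
        then show "\<bar>\<alpha> y \<xi>\<bar> \<le> R" using controlsD[OF Es \<alpha> y _ _ \<xi>, of 1] by simp
      qed
    qed
  qed
  moreover have "positive_current T"
    unfolding positive_current_def
  proof (intro allI impI)
    fix \<alpha> assume \<alpha>: "positive_form \<alpha>"
    then have "\<alpha> \<in> smooth_forms p" by (simp add: positive_form_def)
    then show "0 \<le> T \<alpha>"
      unfolding T_def
      by (intro \<Lambda>_pos[OF cut(2)] mult_nonneg_nonneg level_cutoff_nonneg) (use \<alpha> in \<open>auto simp: positive_form_def\<close>)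
  qed
  moreover have "boundary_phi_boundary T f = (\<integral>y. f y \<partial>\<mu>) - (\<integral>y. f y \<partial>return borel x)"
    if f: "f \<in> smooth_functions" for f
  proof -
    \<comment> \<open>The difference of \<open>dd_phi f\<close> and its product with \<open>?\<chi>\<close> need not have compact support, as
      \<open>vanish\<close> requires. So \<open>f\<close> is first replaced by a compactly supported function that agrees
      with it where \<open>u < c + 3\<close>, a neighbourhood of the support of \<open>?\<chi>\<close>.\<close>
    let ?f = "\<lambda>y. level_cutoff u (c + 2) y * f y"
    have f2: "?f \<in> smooth_functions" by (intro smooth_mult level_cutoff_smooth us f)
    have o1: "open {y. u y < c + 3}" by (intro open_Collect_less continuous_on_const smooth_continuous[OF us])
    have o2: "open {y. c + 4 < u y}" by (intro open_Collect_less continuous_on_const smooth_continuous[OF us])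
    have "?\<chi> y * dd_phi f y vs = ?\<chi> y * dd_phi ?f y vs" for y vs
    proof (cases "u y < c + 2")
      case True
      have "dd_phi f y vs = dd_phi ?f y vs"
        by (rule dd_phi_local[OF f f2 o1]) (use True level_cutoff_1[of u _ "c + 2"] in auto)
      then show ?thesis by simp
    qed (simp add: level_cutoff_0)
    then have "(\<lambda>y vs. ?\<chi> y * dd_phi f y vs) = (\<lambda>y vs. ?\<chi> y * dd_phi ?f y vs)"
      by (intro ext)
    then have "T (dd_phi f) = \<Lambda> (\<lambda>y vs. ?\<chi> y * dd_phi ?f y vs)" by (simp only: T_def)
    also have "\<dots> = \<Lambda> (dd_phi ?f)"
    proof -
      note d = dd_phi_form[OF f2]
      have "\<Lambda> (\<lambda>y vs. 1 * dd_phi ?f y vs + (-1) * (?\<chi> y * dd_phi ?f y vs)) = 0"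
      proof (rule vanish)
        show "(\<lambda>y vs. 1 * dd_phi ?f y vs + (-1) * (?\<chi> y * dd_phi ?f y vs)) \<in> smooth_forms p"
          by (rule form_lincomb[OF d cut(1)[OF d] smooth_const smooth_const])
        show "compact {y. u y \<le> c + 4}" by (rule u(2))
        show "1 * dd_phi ?f y vs + (-1) * (?\<chi> y * dd_phi ?f y vs) = 0" if "y \<notin> {y. u y \<le> c + 4}" for y vs
          using dd_phi_local_zero[OF f2 o2, of y vs] level_cutoff_0[of "c + 2" u] that by simp
        show "1 * dd_phi ?f y vs + (-1) * (?\<chi> y * dd_phi ?f y vs) = 0" if "u y < c + 1" for y vs
          using level_cutoff_1[of u y c] that by simp
      qed
      then show ?thesis using \<Lambda>_lin[OF A_dd[OF f2] cut(2)[OF d], of 1 "-1"] by simp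
    qed
    also have "\<dots> = (\<integral>y. ?f y \<partial>\<mu>) - ?f x" by (rule \<Lambda>_dd[OF f2])
    also have "(\<integral>y. ?f y \<partial>\<mu>) = (\<integral>y. f y \<partial>\<mu>)"
    proof (rule int_cong[OF f2 f])
      show "?f y = f y" if "y \<in> K" for y using c[of y] that level_cutoff_1[of u y "c + 2"] by simp
    qed
    also have "?f x = f x" using c[of x] level_cutoff_1[of u x "c + 2"] by simp
    finally show ?thesis
      using integral_return[of x borel f] borel_measurable_continuous_onI[OF smooth_continuous[OF f]]
      by (simp add: boundary_phi_boundary_def)
  qed
  ultimately have "greens_current K x T"
    unfolding greens_current_def using \<mu> by blast
  then show ?thesis by blast
qed

end

theorem theorem3p8:
  fixes atlas :: "('a::{t2_space,second_countable_topology}, 'n::finite) chart set"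
    and g :: "'a \<Rightarrow> 'a tvec \<Rightarrow> 'a tvec \<Rightarrow> real"
    and p :: nat and \<phi> :: "'a form" and K :: "'a set" and x :: 'a
  assumes "calibrated_manifold atlas g p \<phi>"
    and "\<not> compact (UNIV :: 'a set)"
    and "connected (UNIV :: 'a set)"
    and "oriented_riemannian_manifold.parallel atlas g p \<phi>"
    and "calibrated_manifold.strictly_convex atlas g p \<phi>"
    and "compact K"
    and "x \<notin> K"
  shows "(\<exists>T. calibrated_manifold.greens_current atlas g p \<phi> K x T) \<longleftrightarrow>
         x \<in> calibrated_manifold.phi_hull atlas g p \<phi> K"
proof -
  interpret calibrated_manifold atlas g p \<phi> by (rule assms(1))
  obtain u where u: "u \<in> strict_PSH" "\<And>c. compact {y. u y \<le> c}"
    using assms(5) unfolding strictly_convex_def by blast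
  show ?thesis
    using greens_current_hull[OF u assms(6)] greens_current_exists[OF u assms(6)] by blast
qed

end
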